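(* The graphical trace map induces a well-defined cocycle $\operatorname{Tr}^{\mathcal G}\colon f\mathcal G'\to c\mathcal G'$; that is, the prescription for $\operatorname{Tr}^{\mathcal G}$ on oriented forested graphs given in the context descends to a linear map on the quotient $f\mathcal G'$, and $\operatorname{Tr}^{\mathcal G}\circ\partial=0$.
   Context: All vector spaces are over $\mathbb Q$; graphs are finite, with loops and multiple edges allowed. **The complex $f\mathcal G'$.** A (trivalent) forested graph is a pair $(G,F)$ with $G$ a finite graph all of whose vertices are trivalent and $F\subset G$ an acyclic subgraph containing all vertices of $G$ (components of $F$ may be single vertices). An orientation is an ordering of the edges of $F$ up to even permutation. $f\mathcal G'$ is the $\mathbb Q$-vector space spanned by isomorphism classes of oriented connected trivalent forested graphs, modulo: (i) $(G,F,-or)=-(G,F,or)$; (ii) $(G,F)=0$ if $G$ has a separating edge (an edge whose removal disconnects $G$); (iii) IHX: for an edge $e\in F$, contract $e$ to get a $4$-valent vertex; the three ways of splitting the four half-edges at this vertex into two pairs give three re-expansions into trivalent graphs with a new edge inserted; the new edge takes the place of $e$ in the forest and in the ordering. The sum of the three resulting oriented forested graphs (one of which is $(G,F)$) is $0$. It is graded by the number of components of $F$. The boundary is $\partial(G,F)=\sum_e (G,F\cup e)$, over all edges $e$ of $G-F$ with $F\cup e$ still a forest, with $e$ placed first in the ordering. **The space $c\mathcal G'$.** It is spanned by isomorphism classes of oriented connected graphs all of whose vertices have odd valence, modulo $(\Gamma,-or)=-(\Gamma,or)$ and modulo graphs with a separating edge. An orientation is an ordering of the half-edges at each vertex; a reordering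 multiplies by the product of the signs of the permutations. (A graph with a loop is $0$.) **The graphical trace.** $\operatorname{Tr}^{\mathcal G}(G,F)=0$ unless $F$ is a disjoint union of linear trees (paths) $T_1,\dots,T_m$, each with an even number of edges, and for each $i$ there is an edge $e_i$ of $G-F$ joining the two ends of $T_i$. In that case $\operatorname{Tr}^{\mathcal G}(G,F)$ is $(-2)^m$ times the graph obtained by collapsing each cycle $T_i\cup e_i$ to a point, oriented as follows: choose a direction along each $T_i$; if the edges of $F$ are ordered by listing the edges of $T_1$ in order along $T_1$, then those of $T_2$ in order along $T_2$, etc., then the half-edges at the vertex coming from $T_i$ are ordered as they occur along $T_i$. (If several choices of $e_i$ exist, the result contains a loop, hence is $0$.) *)

theory Defs
  imports
    Complex_Main
    "HOL-Library.Poly_Mapping"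
    "HOL-Library.Disjoint_Sets"
    "HOL-Combinatorics.Permutations"
begin

section \<open>Graphs\<close>

text \<open>
  A finite graph, with loops and multiple edges allowed, is given by its half-edges: vertices and
  edges are the blocks of two partitions of a finite set of half-edges, the edges having exactly
  two elements. Graphs with vertices of valence \<open>0\<close> are not represented; all vertices below
  have odd valence. Half-edges are natural numbers, which is no restriction up to isomorphism.
\<close>

type_synonym halfedges = "nat set"

definition multigraph :: "halfedges set \<Rightarrow> halfedges set \<Rightarrow> bool" where
  "multigraph V E \<longleftrightarrow>
     finite (\<Union>V) \<and> partition_on (\<Union>V) V \<and> partition_on (\<Union>V) E \<and> (\<forall>e\<in>E. card e = 2)"

definition joins :: "halfedges \<Rightarrow> halfedges \<Rightarrow> halfedges \<Rightarrow> bool" where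
  "joins e v w \<longleftrightarrow> (\<exists>a b. a \<in> v \<and> b \<in> w \<and> a \<noteq> b \<and> e = {a, b})"

text \<open>In the next definitions \<open>D\<close> is the edge set of a subgraph containing all the vertices \<open>V\<close>.\<close>

definition connected_graph :: "halfedges set \<Rightarrow> halfedges set \<Rightarrow> bool" where
  "connected_graph V D \<longleftrightarrow> V \<noteq> {} \<and>
     (\<forall>v\<in>V. \<forall>w\<in>V. (v, w) \<in> {(x, y). x \<in> V \<and> y \<in> V \<and> (\<exists>e\<in>D. joins e x y)}\<^sup>*)"

definition separating_edge :: "halfedges set \<Rightarrow> halfedges set \<Rightarrow> halfedges \<Rightarrow> bool" where
  "separating_edge V E e \<longleftrightarrow> e \<in> E \<and> \<not> connected_graph V (E - {e})"

text \<open>Cycles of length \<open>1\<close> are loops, cycles of length \<open>2\<close> are pairs of parallel edges.\<close>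

definition is_cycle ::
  "halfedges set \<Rightarrow> halfedges set \<Rightarrow> halfedges list \<Rightarrow> halfedges list \<Rightarrow> bool" where
  "is_cycle V D vs es \<longleftrightarrow>
     es \<noteq> [] \<and> length vs = length es \<and> distinct vs \<and> distinct es \<and> set vs \<subseteq> V \<and> set es \<subseteq> D \<and>
     (\<forall>i<length es. joins (es ! i) (vs ! i) (vs ! (Suc i mod length es)))"

definition forest :: "halfedges set \<Rightarrow> halfedges set \<Rightarrow> bool" where
  "forest V D \<longleftrightarrow> (\<nexists>vs es. is_cycle V D vs es)"


section \<open>Free vector spaces\<close>

definition scale_chain :: "rat \<Rightarrow> ('a \<Rightarrow>\<^sub>0 rat) \<Rightarrow> ('a \<Rightarrow>\<^sub>0 rat)" where
  "scale_chain c = Poly_Mapping.map ((*) c)"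

lemma lookup_scale_chain [simp]: "Poly_Mapping.lookup (scale_chain c x) a =
  c * Poly_Mapping.lookup x a"
  unfolding scale_chain_def by (transfer) (auto simp: when_def)

interpretation chain: vector_space "scale_chain :: rat \<Rightarrow> ('a \<Rightarrow>\<^sub>0 rat) \<Rightarrow> ('a \<Rightarrow>\<^sub>0 rat)"
  by unfold_locales (auto intro!: poly_mapping_eqI simp: lookup_add algebra_simps)

lemma equivp_chain_span: "equivp (\<lambda>x y. x - y \<in> chain.span R)"
proof (rule equivpI)
  show "reflp (\<lambda>x y. x - y \<in> chain.span R)"
    by (simp add: reflp_def chain.span_zero)
  show "symp (\<lambda>x y. x - y \<in> chain.span R)"
  proof (rule sympI)
    fix x y assume "x - y \<in> chain.span R"
    from chain.span_neg[OF this] show "y - x \<in> chain.span R" by simp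
  qed
  show "transp (\<lambda>x y. x - y \<in> chain.span R)"
  proof (rule transpI)
    fix x y z assume "x - y \<in> chain.span R" "y - z \<in> chain.span R"
    from chain.span_add[OF this] show "x - z \<in> chain.span R" by simp
  qed
qed

lemma chain_span_cong:
  assumes "x - x' \<in> chain.span R"
  shows "- x - - x' \<in> chain.span R"
    and "scale_chain c x - scale_chain c x' \<in> chain.span R"
    and "y - y' \<in> chain.span R \<Longrightarrow> (x + y) - (x' + y') \<in> chain.span R"
    and "y - y' \<in> chain.span R \<Longrightarrow> (x - y) - (x' - y') \<in> chain.span R"
proof -
  show "- x - - x' \<in> chain.span R"
    using chain.span_neg[OF assms] by simp
  show "scale_chain c x - scale_chain c x' \<in> chain.span R"
    using chain.span_scale[OF assms, of c] by (simp only: chain.scale_right_diff_distrib)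
  assume y: "y - y' \<in> chain.span R"
  have "(x + y) - (x' + y') = (x - x') + (y - y')"
    by (rule add_diff_add)
  then show "(x + y) - (x' + y') \<in> chain.span R"
    using chain.span_add[OF assms y] by (simp only:)
  have "(x - y) - (x' - y') = (x - x') - (y - y')"
    by simp
  then show "(x - y) - (x' - y') \<in> chain.span R"
    using chain.span_diff[OF assms y] by (simp only:)
qed


section \<open>The space of forested graphs\<close>

text \<open>
  An oriented forested graph is a triple of the vertices, the edges and the list of the edges of
  the forest, in an order representing the orientation.
\<close>

definition oriented_forested_graph ::
  "halfedges set \<times> halfedges set \<times> halfedges list \<Rightarrow> bool" where
  "oriented_forested_graph = (\<lambda>(V, E, fs).
     multigraph V E \<and> connected_graph V E \<and> (\<forall>v\<in>V. card v = 3) \<and>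
     distinct fs \<and> set fs \<subseteq> E \<and> forest V (set fs))"

lemma connected_graph_two_vertices:
  assumes "{a, b} \<in> E" "a \<in> v" "b \<in> w" "a \<noteq> b"
  shows "connected_graph {v, w} E"
proof -
  let ?R = "{(x, y). x \<in> {v, w} \<and> y \<in> {v, w} \<and> (\<exists>e\<in>E. joins e x y)}"
  have "joins {a, b} v w" "joins {a, b} w v"
    using assms unfolding joins_def by blast+
  then have "(v, w) \<in> ?R" "(w, v) \<in> ?R"
    using assms(1) by blast+
  then show ?thesis
    unfolding connected_graph_def by (auto intro: r_into_rtrancl)
qed

typedef forested_graph = "{X. oriented_forested_graph X}"
proof
  have "connected_graph {{0, 1, 2}, {3, 4, 5}} {{0, 3}, {1, 4}, {2, 5}}"
    by (rule connected_graph_two_vertices[of 0 3]) simp_all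
  then show "({{0, 1, 2}, {3, 4, 5}}, {{0, 3}, {1, 4}, {2, 5}}, [])
      \<in> {X. oriented_forested_graph X}"
    by (auto simp: oriented_forested_graph_def multigraph_def partition_on_def disjoint_def
        forest_def is_cycle_def)
qed

definition forested_isomorphic :: "forested_graph \<Rightarrow> forested_graph \<Rightarrow> bool" where
  "forested_isomorphic X Y \<longleftrightarrow>
     (\<exists>V E fs V' E' fs' f. Rep_forested_graph X = (V, E, fs) \<and> Rep_forested_graph Y = (V', E', fs') \<and>
        bij_betw f (\<Union>V) (\<Union>V') \<and> (image f) ` V = V' \<and> (image f) ` E = E' \<and>
        map (image f) fs = fs')"

text \<open>
  In the IHX relation, the edge \<open>{a, b}\<close> is contracted and the four half-edges \<open>x\<^sub>1, x\<^sub>2, x\<^sub>3, x\<^sub>4\<close>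
  at the resulting vertex are regrouped into pairs in three ways. The new edge is again called
  \<open>{a, b}\<close>, so that the edges and the ordering of the forest do not change.
\<close>

inductive_set forested_relations :: "(forested_graph \<Rightarrow>\<^sub>0 rat) set" where
  isomorphism:
    "forested_isomorphic X Y \<Longrightarrow>
     Poly_Mapping.single X 1 - Poly_Mapping.single Y 1 \<in> forested_relations"
| orientation:
    "\<lbrakk>Rep_forested_graph X = (V, E, fs); Rep_forested_graph Y = (V, E, permute_list p fs);
      p permutes {..<length fs}\<rbrakk> \<Longrightarrow>
     Poly_Mapping.single Y 1 - Poly_Mapping.single X (of_int (sign p)) \<in> forested_relations"
| separating:
    "\<lbrakk>Rep_forested_graph X = (V, E, fs); separating_edge V E e\<rbrakk> \<Longrightarrow>
     Poly_Mapping.single X 1 \<in> forested_relations"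
| IHX:
    "\<lbrakk>{a, b} \<in> set fs; distinct [a, b, x\<^sub>1, x\<^sub>2, x\<^sub>3, x\<^sub>4];
      {a, x\<^sub>1, x\<^sub>2} \<notin> U; {b, x\<^sub>3, x\<^sub>4} \<notin> U;
      Rep_forested_graph X = (U \<union> {{a, x\<^sub>1, x\<^sub>2}, {b, x\<^sub>3, x\<^sub>4}}, E, fs);
      Rep_forested_graph Y = (U \<union> {{a, x\<^sub>1, x\<^sub>3}, {b, x\<^sub>2, x\<^sub>4}}, E, fs);
      Rep_forested_graph Z = (U \<union> {{a, x\<^sub>1, x\<^sub>4}, {b, x\<^sub>2, x\<^sub>3}}, E, fs)\<rbrakk> \<Longrightarrow>
     Poly_Mapping.single X 1 + Poly_Mapping.single Y 1 + Poly_Mapping.single Z 1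
       \<in> forested_relations"

quotient_type forested_space =
  "forested_graph \<Rightarrow>\<^sub>0 rat" / "\<lambda>x y. x - y \<in> chain.span forested_relations"
  by (rule equivp_chain_span)

instantiation forested_space :: ab_group_add
begin

lift_definition zero_forested_space :: forested_space is 0 .

lift_definition plus_forested_space :: "forested_space \<Rightarrow> forested_space \<Rightarrow> forested_space"
  is "(+)"
  by (rule chain_span_cong(3))

lift_definition uminus_forested_space :: "forested_space \<Rightarrow> forested_space" is uminus
  by (rule chain_span_cong(1))

lift_definition minus_forested_space :: "forested_space \<Rightarrow> forested_space \<Rightarrow> forested_space"
  is "(-)"
  by (rule chain_span_cong(4))

instance
  by standard (transfer; simp add: algebra_simps chain.span_zero)+

end

lift_definition scale_forested :: "rat \<Rightarrow> forested_space \<Rightarrow> forested_space" is scale_chain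
  by (rule chain_span_cong(2))

interpretation forested: vector_space scale_forested
  by unfold_locales (transfer; simp add: chain.span_zero chain.scale_right_distrib
      chain.scale_left_distrib)+

abbreviation forested_class :: "(forested_graph \<Rightarrow>\<^sub>0 rat) \<Rightarrow> forested_space" where
  "forested_class \<equiv> abs_forested_space"

text \<open>The boundary operator, on the free vector space spanned by oriented forested graphs.\<close>

definition boundary_graph :: "forested_graph \<Rightarrow> (forested_graph \<Rightarrow>\<^sub>0 rat)" where
  "boundary_graph X = (case Rep_forested_graph X of (V, E, fs) \<Rightarrow>
     \<Sum>e \<in> {e \<in> E - set fs. forest V (insert e (set fs))}.
       Poly_Mapping.single (Abs_forested_graph (V, E, e # fs)) 1)"

text \<open>The argument of the abstraction function above is indeed an oriented forested graph.\<close>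

lemma oriented_forested_graph_add_edge:
  assumes "Rep_forested_graph X = (V, E, fs)" "e \<in> E - set fs" "forest V (insert e (set fs))"
  shows "oriented_forested_graph (V, E, e # fs)"
  using assms Rep_forested_graph[of X] by (auto simp: oriented_forested_graph_def)

definition boundary :: "(forested_graph \<Rightarrow>\<^sub>0 rat) \<Rightarrow> (forested_graph \<Rightarrow>\<^sub>0 rat)" where
  "boundary x = (\<Sum>X \<in> Poly_Mapping.keys x.
     scale_chain (Poly_Mapping.lookup x X) (boundary_graph X))"


section \<open>The space of graphs with vertices of odd valence\<close>

text \<open>
  A graph with an ordering of the half-edges at each vertex is a set of lists, one for each
  vertex, together with the set of edges.
\<close>

definition oriented_odd_graph :: "nat list set \<times> halfedges set \<Rightarrow> bool" where
  "oriented_odd_graph = (\<lambda>(L, E).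
     multigraph (set ` L) E \<and> connected_graph (set ` L) E \<and> inj_on set L \<and>
     (\<forall>l\<in>L. distinct l \<and> odd (length l)))"

typedef odd_graph = "{X. oriented_odd_graph X}"
proof
  have "connected_graph {{0}, {1}} {{0, 1}}"
    by (rule connected_graph_two_vertices[of 0 1]) simp_all
  then show "({[0], [1]}, {{0, 1}}) \<in> {X. oriented_odd_graph X}"
    by (auto simp: oriented_odd_graph_def multigraph_def partition_on_def disjoint_def)
qed

definition odd_isomorphic :: "odd_graph \<Rightarrow> odd_graph \<Rightarrow> bool" where
  "odd_isomorphic X Y \<longleftrightarrow>
     (\<exists>L E L' E' f. Rep_odd_graph X = (L, E) \<and> Rep_odd_graph Y = (L', E') \<and>
        bij_betw f (\<Union>(set ` L)) (\<Union>(set ` L')) \<and> (map f) ` L = L' \<and> (image f) ` E = E')"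

inductive_set odd_relations :: "(odd_graph \<Rightarrow>\<^sub>0 rat) set" where
  isomorphism:
    "odd_isomorphic X Y \<Longrightarrow>
     Poly_Mapping.single X 1 - Poly_Mapping.single Y 1 \<in> odd_relations"
| orientation:
    "\<lbrakk>Rep_odd_graph X = (L, E); l \<in> L; p permutes {..<length l};
      Rep_odd_graph Y = (insert (permute_list p l) (L - {l}), E)\<rbrakk> \<Longrightarrow>
     Poly_Mapping.single Y 1 - Poly_Mapping.single X (of_int (sign p)) \<in> odd_relations"
| separating:
    "\<lbrakk>Rep_odd_graph X = (L, E); separating_edge (set ` L) E e\<rbrakk> \<Longrightarrow>
     Poly_Mapping.single X 1 \<in> odd_relations"

quotient_type odd_space =
  "odd_graph \<Rightarrow>\<^sub>0 rat" / "\<lambda>x y. x - y \<in> chain.span odd_relations"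
  by (rule equivp_chain_span)

instantiation odd_space :: ab_group_add
begin

lift_definition zero_odd_space :: odd_space is 0 .

lift_definition plus_odd_space :: "odd_space \<Rightarrow> odd_space \<Rightarrow> odd_space" is "(+)"
  by (rule chain_span_cong(3))

lift_definition uminus_odd_space :: "odd_space \<Rightarrow> odd_space" is uminus
  by (rule chain_span_cong(1))

lift_definition minus_odd_space :: "odd_space \<Rightarrow> odd_space \<Rightarrow> odd_space" is "(-)"
  by (rule chain_span_cong(4))

instance
  by standard (transfer; simp add: algebra_simps chain.span_zero)+

end

lift_definition scale_odd :: "rat \<Rightarrow> odd_space \<Rightarrow> odd_space" is scale_chain
  by (rule chain_span_cong(2))

interpretation odd: vector_space scale_odd
  by unfold_locales (transfer; simp add: chain.span_zero chain.scale_right_distrib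
      chain.scale_left_distrib)+

abbreviation odd_class :: "(odd_graph \<Rightarrow>\<^sub>0 rat) \<Rightarrow> odd_space" where
  "odd_class \<equiv> abs_odd_space"


section \<open>The graphical trace\<close>

text \<open>
  A linear tree with a chosen direction and a chosen closing edge: \<open>vs\<close> and \<open>es\<close> are its
  vertices and edges in order, \<open>c\<close> is the edge not in the forest \<open>F\<close> which joins its two ends.
  If \<open>es\<close> is empty, the tree is a single vertex and \<open>c\<close> is a loop.
\<close>

definition closed_linear_tree ::
  "halfedges set \<Rightarrow> halfedges set \<Rightarrow> halfedges set \<Rightarrow>
   halfedges list \<times> halfedges list \<times> halfedges \<Rightarrow> bool" where
  "closed_linear_tree V E F = (\<lambda>(vs, es, c).
     length vs = Suc (length es) \<and> distinct vs \<and> set vs \<subseteq> V \<and> set es \<subseteq> F \<and>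
     (\<forall>i<length es. joins (es ! i) (vs ! i) (vs ! Suc i)) \<and>
     even (length es) \<and> c \<in> E - F \<and> joins c (last vs) (hd vs))"

text \<open>
  A list of such trees, pairwise disjoint and with union the whole forest; its entries are then
  the components of the forest.
\<close>

definition trace_data ::
  "halfedges set \<times> halfedges set \<times> halfedges list \<Rightarrow>
   (halfedges list \<times> halfedges list \<times> halfedges) list \<Rightarrow> bool" where
  "trace_data = (\<lambda>(V, E, fs) ts.
     (\<forall>t\<in>set ts. closed_linear_tree V E (set fs) t) \<and>
     distinct (concat (map (\<lambda>(vs, es, c). vs) ts)) \<and>
     set (concat (map (\<lambda>(vs, es, c). vs) ts)) = V \<and>
     set (concat (map (\<lambda>(vs, es, c). es) ts)) = set fs)"

text \<open>
  Each vertex of the tree has exactly one half-edge outside the cycle formed by the tree and the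
  closing edge. These half-edges, in order, form the vertex to which the cycle is collapsed.
\<close>

definition collapsed_vertex :: "halfedges list \<times> halfedges list \<times> halfedges \<Rightarrow> nat list" where
  "collapsed_vertex = (\<lambda>(vs, es, c). map (\<lambda>v. the_elem (v - \<Union>(insert c (set es)))) vs)"

definition collapse ::
  "halfedges set \<times> halfedges set \<times> halfedges list \<Rightarrow>
   (halfedges list \<times> halfedges list \<times> halfedges) list \<Rightarrow> nat list set \<times> halfedges set" where
  "collapse = (\<lambda>(V, E, fs) ts.
     (collapsed_vertex ` set ts, E - set fs - (\<lambda>(vs, es, c). c) ` set ts))"

text \<open>
  The prescription for the trace, as a relation: \<open>graphical_trace X y\<close> holds if \<open>y\<close> is the
  value obtained from some choice of the ordering of the trees, their directions and the closing
  edges. The permutation \<open>p\<close> compares the order of the edges along the trees with the order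
  \<open>fs\<close> which orients \<open>X\<close>.
\<close>

inductive graphical_trace :: "forested_graph \<Rightarrow> odd_space \<Rightarrow> bool" where
  collapsing:
    "\<lbrakk>Rep_forested_graph X = (V, E, fs); trace_data (V, E, fs) ts;
      p permutes {..<length fs};
      fs = permute_list p (concat (map (\<lambda>(vs, es, c). es) ts));
      Rep_odd_graph Y = collapse (V, E, fs) ts\<rbrakk> \<Longrightarrow>
     graphical_trace X
       (scale_odd (of_int (sign p) * (-2) ^ length ts) (odd_class (Poly_Mapping.single Y 1)))"
| vanishing:
    "(\<nexists>ts. trace_data (Rep_forested_graph X) ts) \<Longrightarrow> graphical_trace X 0"

end

theory Submission
  imports Defs
begin

text \<open>
  Up to the reversal of its trees and the choice of closing edges, a decomposition of a linear
  forest into paths is determined by the forest. Reversing a tree with \<open>2k\<close> edges and \<open>2k + 1\<close>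
  vertices changes the ordering of edges and the ordering of vertices by the same sign; if two
  decompositions differ in a closing edge, both collapsed graphs have a loop, hence are \<open>0\<close>, because
  exchanging the ends of a loop is an orientation-reversing automorphism. So the trace is well defined.

  For IHX, let the contracted edge lie on a cycle, so that the cycle enters by \<open>p\<close> and leaves by \<open>q\<close>,
  and let \<open>r, s\<close> be the other two half-edges. The expansions \<open>pr|qs\<close> and \<open>ps|qr\<close> have collapses
  which differ by a transposition of \<open>r, s\<close>; in \<open>pq|rs\<close> the forest branches, or a former closing
  edge becomes a loop.

  For the boundary, if adding \<open>e\<close> gives linear trees \<open>A e B\<close> with closing edge \<open>c\<close>, then adding \<open>c\<close>
  gives \<open>B c A\<close> with closing edge \<open>e\<close>. The two terms cancel, since \<open>A\<close> and \<open>B\<close> have an odd total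
  number of edges.
\<close>


section \<open>Alternating functions and orderings\<close>

text \<open>A value of the trace carries two kinds of sign, from the order of the forest edges and
  from the order of the half-edges at each new vertex. Both are treated as functions of a list that
  change sign when two neighbours are exchanged, so every comparison becomes a count of exchanges.
  Since each tree has an even number of edges, its block of edges passes any other block without a
  sign; hence the trees may be listed in any order.

  Trace data give vertices and edges as sets of half-edges and do not say by which half-edge a path
  enters or leaves a vertex. Reversal, IHX and the rotation of \<open>A e B\<close> to
  \<open>B c A\<close> need exactly this, so trace data are translated into lists of corners.

  In the boundary, \<open>c\<close> is determined by \<open>e\<close> only if the term of
  \<open>e\<close> has nonzero trace: a second candidate would be a loop after collapsing. The
  sign-reversing involution is therefore defined on the nonzero terms. Terms that cancel, here and
  in IHX, have the same number of trees, so the power of -2 is a common factor.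

  Edges on the cycles never separate the graph; a separating edge thus survives the collapse, and
  remains separating.\<close>

definition alternating :: "('a list \<Rightarrow> 'b::ab_group_add) \<Rightarrow> bool" where
  "alternating \<phi> \<longleftrightarrow> (\<forall>us x y ws. distinct (us @ x # y # ws) \<longrightarrow>
     \<phi> (us @ y # x # ws) = - \<phi> (us @ x # y # ws))"

lemma alternatingD:
  "alternating \<phi> \<Longrightarrow> distinct (us @ x # y # ws) \<Longrightarrow> \<phi> (us @ y # x # ws) = - \<phi> (us @ x # y # ws)"
  by (simp add: alternating_def)

text \<open>This is (-1)^k x, written without scalars so that the same lemmas serve rational
  ordering signs and classes in \<open>odd_space\<close>.\<close>

definition signed :: "nat \<Rightarrow> 'b::ab_group_add \<Rightarrow> 'b" where
  "signed k x = (if even k then x else - x)"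

lemma alternating_move_element:
  assumes "alternating \<phi>" "distinct (us @ ys @ x # ws)"
  shows "\<phi> (us @ ys @ x # ws) = signed (length ys) (\<phi> (us @ x # ys @ ws))"
  using assms(2)
proof (induction ys arbitrary: us)
  case Nil
  then show ?case by (simp add: signed_def)
next
  case (Cons y ys)
  have "\<phi> ((us @ [y]) @ ys @ x # ws) = signed (length ys) (\<phi> ((us @ [y]) @ x # ys @ ws))"
    by (rule Cons.IH) (use Cons.prems in auto)
  moreover have "\<phi> (us @ y # x # ys @ ws) = - \<phi> (us @ x # y # ys @ ws)"
    by (rule alternatingD[OF assms(1)]) (use Cons.prems in auto)
  ultimately show ?case by (simp add: signed_def)
qed

lemma alternating_move_block:
  assumes "alternating \<phi>" "distinct (us @ ys @ xs @ ws)"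
  shows "\<phi> (us @ ys @ xs @ ws) = signed (length ys * length xs) (\<phi> (us @ xs @ ys @ ws))"
  using assms(2)
proof (induction xs arbitrary: us)
  case Nil
  then show ?case by (simp add: signed_def)
next
  case (Cons x xs)
  have "\<phi> (us @ ys @ x # xs @ ws) = signed (length ys) (\<phi> (us @ x # ys @ xs @ ws))"
    by (rule alternating_move_element[OF assms(1)]) (use Cons.prems in auto)
  moreover have "\<phi> ((us @ [x]) @ ys @ xs @ ws) =
      signed (length ys * length xs) (\<phi> ((us @ [x]) @ xs @ ys @ ws))"
    by (rule Cons.IH) (use Cons.prems in auto)
  ultimately show ?case by (simp add: signed_def)
qed

text \<open>A reversal of n entries has n(n-1)/2 inversions: in the induction the head has to cross
  the n-1 other entries.\<close>

lemma alternating_rev_block: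
  assumes "alternating \<phi>" "distinct (us @ xs @ ws)"
  shows "\<phi> (us @ rev xs @ ws) = signed (length xs * (length xs - 1) div 2) (\<phi> (us @ xs @ ws))"
  using assms(2)
proof (induction xs arbitrary: ws)
  case Nil
  then show ?case by (simp add: signed_def)
next
  case (Cons x xs)
  have "\<phi> (us @ rev xs @ x # ws) =
      signed (length xs * (length xs - 1) div 2) (\<phi> (us @ xs @ x # ws))"
    by (rule Cons.IH) (use Cons.prems in auto)
  moreover have "\<phi> (us @ xs @ x # ws) = signed (length xs) (\<phi> (us @ x # xs @ ws))"
    by (rule alternating_move_element[OF assms(1)]) (use Cons.prems in auto)
  moreover have "Suc (length xs) * length xs div 2 =
      length xs * (length xs - 1) div 2 + length xs"
  proof (cases "length xs")
    case (Suc k)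
    have "Suc (Suc k) * Suc k = Suc k * k + Suc k * 2" by simp
    then show ?thesis using Suc by (metis div_mult_self1 diff_Suc_1 zero_neq_numeral add.commute)
  qed simp
  ultimately show ?case by (simp add: signed_def)
qed

text \<open>A block of even length crosses any other block without a sign. The prefix
  \<open>us\<close> collects the blocks already in place, while the next one is pulled to the front
  of \<open>cs\<close>.\<close>

lemma alternating_permute_even_blocks:
  assumes "alternating \<phi>" "distinct (us @ concat bs)" "\<forall>b\<in>set bs. even (length b)"
    "mset bs = mset cs"
  shows "\<phi> (us @ concat bs) = \<phi> (us @ concat cs)"
  using assms(2-)
proof (induction bs arbitrary: us cs)
  case Nil
  then show ?case by simp
next
  case (Cons b bs)
  then have "b \<in> set cs" by (metis list.set_intros(1) mset_eq_setD)
  then obtain ds es where cs: "cs = ds @ b # es" by (meson split_list)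
  then have m: "mset bs = mset (ds @ es)" using Cons.prems by simp
  have mc: "mset (concat bs) = mset (concat (ds @ es))"
    by (simp only: mset_concat sum_mset_sum_list[symmetric] mset_map m)
  have "mset (us @ concat ds @ b @ concat es) = mset (us @ b @ concat bs)"
    using mc by simp
  then have d: "distinct (us @ concat ds @ b @ concat es)"
    using Cons.prems(1) mset_eq_imp_distinct_iff[of "us @ concat ds @ b @ concat es"
        "us @ b @ concat bs"] by (simp only: concat.simps append_assoc)
  have "\<phi> ((us @ b) @ concat bs) = \<phi> ((us @ b) @ concat (ds @ es))"
    by (rule Cons.IH) (use Cons.prems m in auto)
  also have "\<dots> = \<phi> (us @ concat ds @ b @ concat es)"
    using alternating_move_block[OF assms(1) d] Cons.prems(2) by (simp add: signed_def)
  finally show ?case by (simp add: cs)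
qed

section \<open>The sign of one ordering relative to another\<close>

lemma permute_list_swap:
  "permute_list (transpose (length us) (Suc (length us))) (us @ x # y # ws) = us @ y # x # ws"
  proof (rule nth_equalityI)
  fix i assume "i < length (permute_list (transpose (length us) (Suc (length us))) (us @ x # y # ws))"
  then have "permute_list (transpose (length us) (Suc (length us))) (us @ x # y # ws) ! i =
      (us @ x # y # ws) ! transpose (length us) (Suc (length us)) i"
    by (simp add: permute_list_def del: upt_Suc)
  also consider "i < length us" | "i = length us" | "i = Suc (length us)"
    | k where "i = Suc (Suc (length us)) + k"
    by (metis less_antisym linorder_neqE_nat less_iff_Suc_add add_Suc add_Suc_right)
  then have "(us @ x # y # ws) ! transpose (length us) (Suc (length us)) i = (us @ y # x # ws) ! i"
    by cases (simp_all add: transpose_def nth_append)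
  finally show "permute_list (transpose (length us) (Suc (length us))) (us @ x # y # ws) ! i =
      (us @ y # x # ws) ! i" .
qed simp

text \<open>For distinct \<open>gs\<close> the permutation is unique, so \<open>SOME\<close> makes
  no real choice. The value 0 on lists that are not rearrangements of each other makes the function
  alternating in \<open>gs\<close> for every \<open>fs\<close>.\<close>

definition ordering_sign :: "'a list \<Rightarrow> 'a list \<Rightarrow> rat" where
  "ordering_sign fs gs = (if \<exists>p. p permutes {..<length fs} \<and> fs = permute_list p gs
     then of_int (sign (SOME p. p permutes {..<length fs} \<and> fs = permute_list p gs)) else 0)"

lemma permute_list_inject:
  assumes "distinct gs" "p permutes {..<length gs}" "q permutes {..<length gs}"
    "permute_list p gs = permute_list q gs"
  shows "p = q"
proof
  fix i
  show "p i = q i"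
  proof (cases "i < length gs")
    case True
    then have "gs ! p i = gs ! q i"
      using assms(2-) by (metis permute_list_nth)
    moreover have "p i < length gs" "q i < length gs"
      using True assms(2,3) by (metis lessThan_iff permutes_in_image)+
    ultimately show ?thesis using assms(1) by (simp add: nth_eq_iff_index_eq)
  next
    case False
    then show ?thesis using assms(2,3) by (simp add: permutes_not_in)
  qed
qed

lemma ordering_sign_eqI:
  assumes "distinct gs" "p permutes {..<length gs}" "fs = permute_list p gs"
  shows "ordering_sign fs gs = of_int (sign p)"
proof -
  have l: "length fs = length gs" using assms(3) by simp
  let ?P = "\<lambda>p. p permutes {..<length fs} \<and> fs = permute_list p gs"
  have p: "?P p" using assms(2,3) l by simp
  moreover have "q = p" if "?P q" for q
    by (rule permute_list_inject[OF assms(1)]) (use that p l in metis)+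
  ultimately have "(SOME q. ?P q) = p" by (rule some_equality)
  moreover have "\<exists>q. ?P q" using p by blast
  ultimately show ?thesis unfolding ordering_sign_def by (simp only: if_True)
qed

lemma ordering_sign_permute_right:
  assumes "distinct gs" "p permutes {..<length gs}"
  shows "ordering_sign fs (permute_list p gs) = of_int (sign p) * ordering_sign fs gs"
proof -
  let ?gs = "permute_list p gs"
  have p: "p permutes {..<length ?gs}" "distinct ?gs"
    using assms by (simp_all add: distinct_permute_list)
  have ip: "permute_list (inv p) ?gs = gs"
    using permute_list_compose[OF permutes_inv[OF assms(2)], of p] permutes_inv_o(1)[OF assms(2)]
    by simp
  show ?thesis
  proof (cases "\<exists>q. q permutes {..<length fs} \<and> fs = permute_list q gs")
    case True
    then obtain q where q: "q permutes {..<length gs}" "fs = permute_list q gs" by auto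
    have "fs = permute_list (inv p \<circ> q) ?gs"
      using q permute_list_compose[of q ?gs "inv p"] ip by simp
    moreover have "inv p \<circ> q permutes {..<length ?gs}"
      using q(1) assms(2) by (simp add: permutes_compose permutes_inv)
    ultimately have "ordering_sign fs ?gs = of_int (sign (inv p \<circ> q))"
      using ordering_sign_eqI[OF p(2)] by blast
    moreover have "permutation p" "permutation q"
      using q assms(2) by (metis finite_lessThan permutes_imp_permutation)+
    then have "sign (inv p \<circ> q) = sign p * sign q"
      by (simp add: sign_compose permutation_inverse sign_inverse)
    ultimately show ?thesis using ordering_sign_eqI[OF assms(1) q] by simp
  next
    case False
    have "\<not> (\<exists>q. q permutes {..<length fs} \<and> fs = permute_list q ?gs)"
    proof
      assume "\<exists>q. q permutes {..<length fs} \<and> fs = permute_list q ?gs"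
      then obtain q where q: "q permutes {..<length gs}" "fs = permute_list q ?gs" by auto
      then have "fs = permute_list (p \<circ> q) gs"
        by (simp add: permute_list_compose)
      moreover have "p \<circ> q permutes {..<length fs}"
        using q assms(2) by (simp add: permutes_compose)
      ultimately show False using False by blast
    qed
    then show ?thesis using False by (simp add: ordering_sign_def)
  qed
qed

lemma ordering_sign_permute_left:
  assumes "distinct gs" "p permutes {..<length fs}" "mset fs = mset gs"
  shows "ordering_sign (permute_list p fs) gs = of_int (sign p) * ordering_sign fs gs"
proof -
  obtain q where q: "q permutes {..<length gs}" "permute_list q gs = fs"
    using mset_eq_permutation[OF assms(3)] by auto
  have l: "length fs = length gs" using assms(3) by (rule mset_eq_length)
  have "permute_list p fs = permute_list (q \<circ> p) gs"
    using q assms(2) l by (simp add: permute_list_compose)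
  moreover have "q \<circ> p permutes {..<length gs}"
    using q assms(2) l by (simp add: permutes_compose)
  ultimately have "ordering_sign (permute_list p fs) gs = of_int (sign (q \<circ> p))"
    using ordering_sign_eqI[OF assms(1)] by blast
  moreover have "permutation p" "permutation q"
    using q assms(2) by (metis finite_lessThan permutes_imp_permutation)+
  ultimately show ?thesis
    using ordering_sign_eqI[OF assms(1) q(1) q(2)[symmetric]] by (simp add: sign_compose)
qed

lemma alternating_ordering_sign: "alternating (ordering_sign fs)"
  unfolding alternating_def
proof (intro allI impI)
  fix us x y ws
  assume d: "distinct (us @ x # y # ws :: 'a list)"
  let ?p = "transpose (length us) (Suc (length us))"
  have "?p permutes {..<length (us @ x # y # ws)}"
    by (rule permutes_swap_id) auto
  from ordering_sign_permute_right[OF d this]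
  show "ordering_sign fs (us @ y # x # ws) = - ordering_sign fs (us @ x # y # ws)"
    by (simp add: permute_list_swap sign_swap_id)
qed

text \<open>The same permutation relates the renamed lists. This serves graph isomorphisms and also
  the exchange of an added edge for its partner in the boundary.\<close>

lemma ordering_sign_map:
  assumes "inj_on h (set gs)" "distinct gs" "mset fs = mset gs"
  shows "ordering_sign (map h fs) (map h gs) = ordering_sign fs gs"
proof -
  obtain q where q: "q permutes {..<length gs}" "permute_list q gs = fs"
    using mset_eq_permutation[OF assms(3)] by auto
  have "map h fs = permute_list q (map h gs)"
    using q by (simp add: permute_list_map)
  then have "ordering_sign (map h fs) (map h gs) = of_int (sign q)"
    using q assms by (intro ordering_sign_eqI) (auto simp: distinct_map)
  then show ?thesis using ordering_sign_eqI[OF assms(2) q(1) q(2)[symmetric]] by simp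
qed


section \<open>Classes of oriented odd graphs\<close>

text \<open>The value \<open>0\<close> on data which do not form an oriented odd graph keeps this function alternating
  in the ordering of the half-edges at each vertex without any assumption.\<close>

definition odd_graph_class :: "nat list set \<times> halfedges set \<Rightarrow> odd_space" where
  "odd_graph_class G = (if oriented_odd_graph G
     then odd_class (Poly_Mapping.single (Abs_odd_graph G) 1) else 0)"

lemma odd_class_relation:
  assumes "r \<in> odd_relations"
  shows "odd_class r = 0"
  unfolding zero_odd_space_def odd_space.abs_eq_iff using chain.span_base[OF assms] by simp

lemma odd_class_single:
  "odd_class (Poly_Mapping.single X c) = scale_odd c (odd_class (Poly_Mapping.single X 1))"
proof -
  have "Poly_Mapping.single X c = scale_chain c (Poly_Mapping.single X 1)"
    by (rule poly_mapping_eqI) (simp add: lookup_single when_def)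
  then show ?thesis by (simp add: scale_odd.abs_eq)
qed

lemma odd_class_diff: "odd_class (x - y) = odd_class x - odd_class y"
  by (simp add: minus_odd_space.abs_eq)

lemma Rep_Abs_odd_graph:
  "oriented_odd_graph G \<Longrightarrow> Rep_odd_graph (Abs_odd_graph G) = G"
  by (simp add: Abs_odd_graph_inverse)

lemma odd_graph_class_isomorphic:
  assumes "oriented_odd_graph (L, E)" "oriented_odd_graph (map f ` L, image f ` E)"
    "inj_on f (\<Union>(set ` L))"
  shows "odd_graph_class (map f ` L, image f ` E) = odd_graph_class (L, E)"
proof -
  have "\<Union>(set ` map f ` L) = f ` \<Union>(set ` L)" by auto
  then have "bij_betw f (\<Union>(set ` L)) (\<Union>(set ` map f ` L))"
    using assms(3) by (simp add: bij_betw_def)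
  then have "odd_isomorphic (Abs_odd_graph (L, E)) (Abs_odd_graph (map f ` L, image f ` E))"
    unfolding odd_isomorphic_def using assms(1,2) Rep_Abs_odd_graph by blast
  from odd_class_relation[OF odd_relations.isomorphism[OF this]]
  show ?thesis using assms by (simp add: odd_graph_class_def odd_class_diff)
qed

lemma oriented_odd_graph_replace:
  assumes "oriented_odd_graph (insert l M, E)" "l \<notin> M" "mset l' = mset l"
  shows "oriented_odd_graph (insert l' M, E)"
proof -
  have s: "set l' = set l" "length l' = length l" "distinct l' = distinct l"
    using assms(3) by (auto dest: mset_eq_setD mset_eq_length mset_eq_imp_distinct_iff)
  have i: "set ` insert l' M = set ` insert l M" using s by simp
  have inj: "inj_on set (insert l M)" using assms(1) by (simp add: oriented_odd_graph_def)
  have "set l \<notin> set ` M"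
  proof
    assume "set l \<in> set ` M"
    then obtain m where "m \<in> M" "set m = set l" by auto
    then show False using inj assms(2) by (metis inj_onD insertI1 insertI2)
  qed
  moreover have "inj_on set M" using inj by simp
  ultimately have "inj_on set (insert l' M)" using s by auto
  then show ?thesis using assms(1) unfolding oriented_odd_graph_def prod.case i
    using s by auto
qed

lemma odd_graph_class_permute:
  assumes "oriented_odd_graph (insert l M, E)" "l \<notin> M" "p permutes {..<length l}"
  shows "odd_graph_class (insert (permute_list p l) M, E) =
    scale_odd (of_int (sign p)) (odd_graph_class (insert l M, E))"
proof -
  have o: "oriented_odd_graph (insert (permute_list p l) M, E)"
    by (rule oriented_odd_graph_replace[OF assms(1,2)]) (simp add: assms(3))
  have "Poly_Mapping.single (Abs_odd_graph (insert (permute_list p l) M, E)) 1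
      - Poly_Mapping.single (Abs_odd_graph (insert l M, E)) (of_int (sign p)) \<in> odd_relations"
    by (rule odd_relations.orientation[where l = l and p = p])
      (use assms o in \<open>auto simp: Rep_Abs_odd_graph\<close>)
  from odd_class_relation[OF this] show ?thesis
    using o assms(1) odd_class_single[of _ "of_int (sign p)"]
    by (simp add: odd_graph_class_def odd_class_diff)
qed

text \<open>Both lists are kept out of \<open>M\<close>, so that the exchange affects one vertex and
  \<open>insert\<close> merges nothing. If one side is not an oriented graph, neither is the other,
  and both values are 0.\<close>

lemma odd_graph_class_swap:
  assumes "us @ x # y # ws \<notin> M" "us @ y # x # ws \<notin> M"
  shows "odd_graph_class (insert (us @ y # x # ws) M, E) = - odd_graph_class (insert (us @ x # y # ws) M, E)"
proof (cases "oriented_odd_graph (insert (us @ x # y # ws) M, E)")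
  case True
  let ?p = "transpose (length us) (Suc (length us))"
  have p: "?p permutes {..<length (us @ x # y # ws)}"
    by (rule permutes_swap_id) auto
  have "scale_odd (- 1) z = - z" for z by (simp add: odd.scale_minus_left)
  then show ?thesis using odd_graph_class_permute[OF True assms(1) p]
    by (simp add: permute_list_swap sign_swap_id)
next
  case False
  then have "\<not> oriented_odd_graph (insert (us @ y # x # ws) M, E)"
    using oriented_odd_graph_replace[OF _ assms(2), of E "us @ x # y # ws"] by auto
  then show ?thesis using False by (simp add: odd_graph_class_def)
qed

text \<open>Here 2 is inverted. Orientation-reversing automorphisms and sign-reversing involutions
  both yield 0 through this fact.\<close>

lemma odd_space_eq_uminus_self:
  assumes "(x :: odd_space) = - x"
  shows "x = 0"
proof -
  have "scale_odd 2 x = x + x"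
    using odd.scale_left_distrib[of 1 1 x] by simp
  also have "\<dots> = 0" using assms by (metis add.right_inverse)
  finally show ?thesis by (simp add: odd.scale_eq_0_iff)
qed

lemma multigraph_edge_eq:
  assumes "multigraph V E" "e \<in> E" "e' \<in> E" "x \<in> e" "x \<in> e'"
  shows "e = e'"
proof -
  have "disjoint E" using assms(1) by (simp add: multigraph_def partition_on_def)
  from disjointD[OF this assms(2,3)] show ?thesis using assms(4,5) by auto
qed

lemma multigraph_vertex_eq:
  assumes "multigraph V E" "v \<in> V" "v' \<in> V" "x \<in> v" "x \<in> v'"
  shows "v = v'"
proof -
  have "disjoint V" using assms(1) by (simp add: multigraph_def partition_on_def)
  from disjointD[OF this assms(2,3)] show ?thesis using assms(4,5) by auto
qed

lemma odd_graph_class_loop: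
  assumes "{x, y} \<in> E" "x \<noteq> y" "l \<in> L" "x \<in> set l" "y \<in> set l"
  shows "odd_graph_class (L, E) = 0"
proof (cases "oriented_odd_graph (L, E)")
  case True
  let ?f = "transpose x y"
  define M where "M = L - {l}"
  have L: "L = insert l M" "l \<notin> M" using assms(3) by (auto simp: M_def)
  have mg: "multigraph (set ` L) E" and inj: "inj_on set L" and d: "distinct l"
    using True assms(3) by (auto simp: oriented_odd_graph_def)
  obtain i j where ij: "i < length l" "j < length l" "l ! i = x" "l ! j = y"
    using assms(4,5) by (metis in_set_conv_nth)
  let ?p = "transpose i j"
  have p: "?p permutes {..<length l}"
    by (rule permutes_swap_id) (use ij in auto)
  \<comment> \<open>Exchanging the values \<open>x\<close> and \<open>y\<close> amounts to
    exchanging their positions in \<open>l\<close>, an odd permutation. All other vertices and all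
    edges, including the loop itself, are mapped to themselves.\<close>
  have map_l: "permute_list ?p l = map ?f l"
  proof (rule nth_equalityI)
    fix k assume "k < length (permute_list ?p l)"
    then have k: "k < length l" by simp
    then have "?f (l ! k) = l ! ?p k"
      using ij d by (auto simp: transpose_def nth_eq_iff_index_eq)
    then show "permute_list ?p l ! k = map ?f l ! k" using k p by (simp add: permute_list_nth)
  qed simp
  have "map ?f m = m" if "m \<in> M" for m
  proof -
    have "m \<in> L" "m \<noteq> l" using that L by auto
    then have "set m \<noteq> set l" using inj assms(3) by (meson inj_onD)
    then have "x \<notin> set m" "y \<notin> set m"
      using multigraph_vertex_eq[OF mg, of "set m" "set l"] \<open>m \<in> L\<close> assms(3-5) by blast+
    then have "map ?f m = map id m"
      by (intro map_cong) (auto simp: transpose_def)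
    then show ?thesis by simp
  qed
  then have "map ?f ` M = M" by force
  then have mL: "map ?f ` L = insert (permute_list ?p l) M" by (simp add: L map_l)
  have "?f ` e = e" if "e \<in> E" for e
  proof (cases "e = {x, y}")
    case False
    then have "x \<notin> e" "y \<notin> e"
      using multigraph_edge_eq[OF mg that assms(1)] by blast+
    then have "?f ` e = id ` e" by (intro image_cong) (auto simp: transpose_def)
    then show ?thesis by simp
  qed auto
  then have mE: "image ?f ` E = E" by force
  have T: "oriented_odd_graph (insert l M, E)" using True L by simp
  have o: "oriented_odd_graph (map ?f ` L, image ?f ` E)"
    unfolding mL mE by (rule oriented_odd_graph_replace[OF T L(2)]) (simp add: p)
  have "i \<noteq> j" using ij assms(2) by auto
  then have "odd_graph_class (map ?f ` L, image ?f ` E) = - odd_graph_class (L, E)"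
    unfolding mL mE using odd_graph_class_permute[OF T L(2) p] odd.scale_minus_left[of 1]
    by (simp add: sign_swap_id flip: L(1))
  moreover have "inj_on ?f (\<Union>(set ` L))" by (meson inj_on_subset inj_transpose subset_UNIV)
  ultimately show ?thesis
    using odd_graph_class_isomorphic[OF True o] odd_space_eq_uminus_self by metis
qed (simp add: odd_graph_class_def)

lemma odd_graph_class_separating:
  assumes "separating_edge (set ` L) E e"
  shows "odd_graph_class (L, E) = 0"
proof (cases "oriented_odd_graph (L, E)")
  case True
  have "Poly_Mapping.single (Abs_odd_graph (L, E)) 1 \<in> odd_relations"
    by (rule odd_relations.separating[OF Rep_Abs_odd_graph[OF True] assms])
  from odd_class_relation[OF this] show ?thesis using True by (simp add: odd_graph_class_def)
qed (simp add: odd_graph_class_def)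


section \<open>Linear trees as lists of corners\<close>

text \<open>
  A corner is a vertex of the cycle formed by a tree and its closing edge; \<open>entry\<close> and \<open>exit\<close> are its
  half-edges on the cycle. A tree with a direction and a closing edge becomes a list of corners, which
  also records the ends of the closing edge if it is a loop.
\<close>

datatype corner = Corner (entry: nat) (exit: nat) (leg: nat)

definition corner_list :: "corner \<Rightarrow> nat list" where
  "corner_list k = [entry k, exit k, leg k]"

definition corner_vertex :: "corner \<Rightarrow> halfedges" where
  "corner_vertex k = {entry k, exit k, leg k}"

fun links :: "corner list \<Rightarrow> halfedges list" where
  "links (k # l # n) = {exit k, entry l} # links (l # n)"
| "links _ = []"

definition closing :: "corner list \<Rightarrow> halfedges" where
  "closing n = {exit (last n), entry (hd n)}"

definition tree_of :: "corner list \<Rightarrow> halfedges list \<times> halfedges list \<times> halfedges" where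
  "tree_of n = (map corner_vertex n, links n, closing n)"

text \<open>The single distinctness condition on half-edges says both that the trees are disjoint
  and that the three half-edges of each corner differ. An odd number of corners means an even number
  of edges.\<close>

definition necklaces :: "halfedges set \<Rightarrow> halfedges set \<Rightarrow> halfedges set \<Rightarrow> corner list list \<Rightarrow> bool" where
  "necklaces V E F ns \<longleftrightarrow>
     (\<forall>n\<in>set ns. odd (length n) \<and> closing n \<in> E - F) \<and>
     distinct (concat (map corner_list (concat ns))) \<and>
     corner_vertex ` set (concat ns) = V \<and> (\<Union>n\<in>set ns. set (links n)) = F"

lemma set_corner_list [simp]: "set (corner_list k) = corner_vertex k"
  by (simp add: corner_list_def corner_vertex_def)

lemma length_links [simp]: "length (links n) = length n - 1"
  by (induction n rule: links.induct) auto

lemma links_append: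
  "xs \<noteq> [] \<Longrightarrow> ys \<noteq> [] \<Longrightarrow>
   links (xs @ ys) = links xs @ {exit (last xs), entry (hd ys)} # links ys"
proof (induction xs)
  case (Cons k xs)
  show ?case
  proof (cases xs)
    case Nil
    then show ?thesis using Cons.prems by (cases ys) auto
  next
    case (Cons l zs)
    then show ?thesis using \<open>xs \<noteq> [] \<Longrightarrow> ys \<noteq> [] \<Longrightarrow> _\<close> \<open>ys \<noteq> []\<close> by simp
  qed
qed simp

lemma nth_links: "Suc i < length n \<Longrightarrow> links n ! i = {exit (n ! i), entry (n ! Suc i)}"
proof (induction n arbitrary: i rule: links.induct)
  case (1 k l n) then show ?case by (cases i) auto
qed auto

lemma Union_links:
  "n \<noteq> [] \<Longrightarrow> \<Union>(set (links n)) = entry ` set (tl n) \<union> exit ` set (butlast n)"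
  by (induction n rule: links.induct) auto

text \<open>Going once round the cycle, every corner is entered and left exactly once. The half-edge
  that \<open>collapsed_vertex\<close> retains is therefore the leg.\<close>

lemma Union_links_closing:
  assumes "n \<noteq> []"
  shows "\<Union>(insert (closing n) (set (links n))) = entry ` set n \<union> exit ` set n"
proof -
  have "set n = insert (hd n) (set (tl n))" using assms by (cases n) auto
  then have 1: "entry ` set n = insert (entry (hd n)) (entry ` set (tl n))" by auto
  have "set n = insert (last n) (set (butlast n))"
    using assms by (metis append_butlast_last_id list.simps(15) rotate1.simps(2) set_rotate1)
  then have 2: "exit ` set n = insert (exit (last n)) (exit ` set (butlast n))" by auto
  show ?thesis unfolding 1 2 by (auto simp: Union_links[OF assms] closing_def)
qed

lemma distinct_corners:
  assumes "distinct (concat (map corner_list N))"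
  shows "distinct N" and "\<And>k. k \<in> set N \<Longrightarrow> distinct (corner_list k)"
    and "\<And>k l x. k \<in> set N \<Longrightarrow> l \<in> set N \<Longrightarrow> x \<in> corner_vertex k \<Longrightarrow> x \<in> corner_vertex l \<Longrightarrow> k = l"
proof -
  show "distinct N" using assms
    by (induction N) (force simp: corner_list_def corner_vertex_def)+
  show "\<And>k. k \<in> set N \<Longrightarrow> distinct (corner_list k)" using assms
    by (induction N) auto
  show "\<And>k l x. k \<in> set N \<Longrightarrow> l \<in> set N \<Longrightarrow> x \<in> corner_vertex k \<Longrightarrow> x \<in> corner_vertex l \<Longrightarrow> k = l"
    using assms by (induction N) (auto simp: disjoint_iff)
qed

lemma corner_halfedges:
  assumes "distinct (concat (map corner_list N))" "k \<in> set N" "l \<in> set N"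
  shows "entry k \<noteq> exit l" "entry k \<noteq> leg l" "exit k \<noteq> leg l"
    "exit k \<noteq> entry l" "leg k \<noteq> entry l" "leg k \<noteq> exit l"
    "entry k = entry l \<longleftrightarrow> k = l" "exit k = exit l \<longleftrightarrow> k = l" "leg k = leg l \<longleftrightarrow> k = l"
  using distinct_corners(3)[OF assms, of "entry k"] distinct_corners(3)[OF assms, of "exit k"]
    distinct_corners(3)[OF assms, of "leg k"] distinct_corners(2)[OF assms(1,2)]
  by (auto simp: corner_vertex_def corner_list_def)

lemma corner_vertex_inject:
  assumes "distinct (concat (map corner_list N))" "k \<in> set N" "l \<in> set N"
  shows "corner_vertex k = corner_vertex l \<longleftrightarrow> k = l"
  using distinct_corners(3)[OF assms, of "entry k"] by (auto simp: corner_vertex_def)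

text \<open>Vertices are disjoint sets, and trivalence separates the three half-edges inside each of
  them.\<close>

lemma distinct_corner_listsI:
  assumes "multigraph V E" "distinct (map corner_vertex N)" "corner_vertex ` set N \<subseteq> V"
    "\<And>v. v \<in> V \<Longrightarrow> card v = 3"
  shows "distinct (concat (map corner_list N))"
  using assms(2,3)
proof (induction N)
  case (Cons k N)
  have "card {entry k, exit k, leg k} = 3" using Cons.prems(2) assms(4)
    by (simp add: corner_vertex_def)
  then have "distinct (corner_list k)"
    by (auto simp: corner_list_def card_insert_if split: if_splits)
  moreover have "corner_vertex k \<inter> corner_vertex l = {}" if "l \<in> set N" for l
  proof -
    have "corner_vertex k \<in> V" "corner_vertex l \<in> V" "corner_vertex k \<noteq> corner_vertex l"
      using Cons.prems that by auto
    then show ?thesis using multigraph_vertex_eq[OF assms(1)] by blast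
  qed
  ultimately show ?case using Cons by auto
qed simp

section \<open>Translation between trace data and necklaces\<close>

lemma trace_data_necklaces:
  assumes "multigraph V E" "necklaces V E (set fs) ns"
  shows "trace_data (V, E, fs) (map tree_of ns)"
proof -
  let ?N = "concat ns"
  have d: "distinct (concat (map corner_list ?N))" and V: "corner_vertex ` set ?N = V"
    and F: "(\<Union>n\<in>set ns. set (links n)) = set fs"
    and n: "\<And>n. n \<in> set ns \<Longrightarrow> odd (length n) \<and> closing n \<in> E - set fs"
    using assms(2) by (auto simp: necklaces_def)
  have dv: "distinct (map corner_vertex ?N)"
    using distinct_corners(1)[OF d] corner_vertex_inject[OF d] by (auto simp: distinct_map inj_on_def)
  have "concat (map (\<lambda>(vs, es, c). vs) (map tree_of ns)) = map corner_vertex ?N"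
    by (simp add: tree_of_def comp_def map_concat)
  moreover have "set (concat (map (\<lambda>(vs, es, c). es) (map tree_of ns))) = set fs"
    using F by (simp add: tree_of_def comp_def)
  moreover have "closed_linear_tree V E (set fs) (tree_of n)" if "n \<in> set ns" for n
  proof -
    have ne: "n \<noteq> []" and o: "odd (length n)" and c: "closing n \<in> E - set fs" using n[OF that] by auto
    have sub: "set n \<subseteq> set ?N" using that by auto
    have "distinct n" using distinct_concat_iff[of ns] distinct_corners(1)[OF d] that by blast
    moreover have "inj_on corner_vertex (set n)"
      using corner_vertex_inject[OF d] sub by (auto simp: inj_on_def subset_iff)
    ultimately have "distinct (map corner_vertex n)" by (simp add: distinct_map)
    moreover have "joins (links n ! i) (map corner_vertex n ! i) (map corner_vertex n ! Suc i)"
      if "i < length (links n)" for i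
    proof -
      have i: "Suc i < length n" using that by simp
      then have "n ! i \<in> set ?N" "n ! Suc i \<in> set ?N" using sub nth_mem[of i n] nth_mem[of "Suc i" n] by (auto simp del: nth_mem)
      then have "exit (n ! i) \<noteq> entry (n ! Suc i)" by (rule corner_halfedges[OF d])
      then show ?thesis using i by (auto simp: joins_def nth_links corner_vertex_def)
    qed
    moreover have "joins (closing n) (last (map corner_vertex n)) (hd (map corner_vertex n))"
    proof -
      have "last n \<in> set ?N" "hd n \<in> set ?N" using sub last_in_set[OF ne] hd_in_set[OF ne] by blast+
      then have "exit (last n) \<noteq> entry (hd n)" by (rule corner_halfedges[OF d])
      then show ?thesis using ne
        by (auto simp: joins_def closing_def corner_vertex_def hd_map last_map)
    qed
    moreover have "set (map corner_vertex n) \<subseteq> V" using sub V by auto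
    moreover have "set (links n) \<subseteq> set fs" using F that by auto
    moreover have "length (map corner_vertex n) = Suc (length (links n))" "even (length (links n))" using ne o
      by (cases n; simp)+
    ultimately show ?thesis using c unfolding closed_linear_tree_def tree_of_def prod.case by blast
  qed
  ultimately show ?thesis using dv V unfolding trace_data_def prod.case by auto
qed

text \<open>\<open>joins\<close> provides the half-edges for each edge separately. The point is that
  the cycle arrives at a vertex by another half-edge than the one by which it leaves; then
  trivalence leaves exactly one half-edge for the leg.\<close>

lemma closed_linear_tree_corners:
  assumes mg: "multigraph V E" and tri: "\<And>v. v \<in> V \<Longrightarrow> card v = 3" and "F \<subseteq> E"
    and t: "closed_linear_tree V E F t"
  shows "\<exists>n. t = tree_of n \<and> odd (length n)"
proof -
  obtain vs es c where t_eq: "t = (vs, es, c)" by (cases t)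
  define k where "k = length es"
  have len: "length vs = Suc k" and dvs: "distinct vs" and vsV: "set vs \<subseteq> V" and esF: "set es \<subseteq> F"
    and j: "\<And>i. i < k \<Longrightarrow> joins (es ! i) (vs ! i) (vs ! Suc i)"
    and ev: "even k" and c: "c \<in> E - F" "joins c (last vs) (hd vs)"
    using t by (auto simp: closed_linear_tree_def t_eq k_def)
  \<comment> \<open>The closing edge becomes the edge number \<open>k\<close> of a closed walk,
    leading from vertex \<open>k\<close> back to vertex 0; \<open>nx\<close> and, below,
    \<open>pv\<close> are the cyclic successor and predecessor.\<close>
  define cyc where "cyc i = (if i < k then es ! i else c)" for i
  define nx where "nx i = (if i < k then Suc i else 0)" for i
  have lh: "last vs = vs ! k" "hd vs = vs ! 0"
    using len by (metis diff_Suc_1 last_conv_nth length_0_conv nat.distinct(1))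
      (metis hd_conv_nth len length_0_conv nat.distinct(1))
  have "\<exists>a b. i \<le> k \<longrightarrow> a \<in> vs ! i \<and> b \<in> vs ! nx i \<and> a \<noteq> b \<and> cyc i = {a, b}" for i
    using j[of i] c(2) lh by (cases "i < k") (auto simp: joins_def cyc_def nx_def)
  then obtain a b where ab: "\<And>i. i \<le> k \<Longrightarrow> a i \<in> vs ! i \<and> b i \<in> vs ! nx i \<and> a i \<noteq> b i \<and> cyc i = {a i, b i}"
    by metis
  define pv where "pv i = (if i = 0 then k else i - 1)" for i
  have pv: "pv i \<le> k" "nx (pv i) = i" if "i \<le> k" for i
    using that by (auto simp: pv_def nx_def)
  have vV: "vs ! i \<in> V" if "i \<le> k" for i using that len vsV by (metis less_Suc_eq_le nth_mem subsetD)
  have "es ! i \<in> E" if "i < k" for i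
    using that esF assms(3) nth_mem[of i es] unfolding k_def by blast
  then have cycE: "cyc i \<in> E" for i
    using c by (simp add: cyc_def)
  \<comment> \<open>If arrival and departure used the same half-edge, the two consecutive edges
    would coincide, since edges are disjoint. As \<open>c\<close> is not in the forest, both would
    be edges of the path, and two of its vertices would coincide. For a single vertex the two
    half-edges are the ends of the loop \<open>c\<close>, which differ.\<close>
  have ne: "b (pv i) \<noteq> a i" if i: "i \<le> k" for i
  proof
    assume eq: "b (pv i) = a i"
    have "a i \<in> cyc i" "b (pv i) \<in> cyc (pv i)"
      using ab[OF i] ab[OF pv(1)[OF i]] by blast+
    then have "cyc (pv i) = cyc i"
      using multigraph_edge_eq[OF mg cycE cycE] eq by simp
    moreover have "pv i \<noteq> i" using eq ab[OF i] by auto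
    moreover have "es ! l \<noteq> c" if "l < k" for l using that c(1) esF nth_mem[of l es] unfolding k_def by blast
    ultimately have lt: "i < k" "pv i < k" using i pv(1)[OF i] unfolding cyc_def
      by (auto split: if_splits)
    then have p: "pv i = i - 1" "i \<noteq> 0" by (auto simp: pv_def split: if_splits)
    have "a (pv i) \<in> {a i, b i}" using ab[OF i] ab[OF pv(1)[OF i]] \<open>cyc (pv i) = cyc i\<close> by auto
    then have "vs ! pv i = vs ! i \<or> vs ! pv i = vs ! Suc i"
      using ab[OF i] ab[OF pv(1)[OF i]] multigraph_vertex_eq[OF mg] vV lt
      by (metis Suc_leI insertE less_imp_le_nat nx_def singletonD)
    then show False using dvs len lt p by (auto simp: nth_eq_iff_index_eq)
  qed
  have "\<exists>r. i \<le> k \<longrightarrow> vs ! i = {b (pv i), a i, r}" for i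
  proof (cases "i \<le> k")
    case True
    have "card (vs ! i) = 3" using vV[OF True] tri by simp
    moreover have "{b (pv i), a i} \<subseteq> vs ! i" using ab[OF True] ab[OF pv(1)[OF True]] pv(2)[OF True] by auto
    moreover have "card {b (pv i), a i} = 2" using ne[OF True] by simp
    moreover have "finite (vs ! i)" using \<open>card (vs ! i) = 3\<close> by (metis card.infinite zero_neq_numeral)
    ultimately have "card (vs ! i - {b (pv i), a i}) = 1" by (simp add: card_Diff_subset)
    then obtain r where "vs ! i - {b (pv i), a i} = {r}" by (auto simp: card_1_singleton_iff)
    then have "vs ! i = {b (pv i), a i, r}" using \<open>{b (pv i), a i} \<subseteq> vs ! i\<close> by auto
    then show ?thesis by blast
  qed simp
  then obtain r where r: "\<And>i. i \<le> k \<Longrightarrow> vs ! i = {b (pv i), a i, r i}" by metis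
  define n where "n = map (\<lambda>i. Corner (b (pv i)) (a i) (r i)) [0..<Suc k]"
  have ln: "length n = Suc k" by (simp add: n_def)
  have nn: "n ! i = Corner (b (pv i)) (a i) (r i)" if "i \<le> k" for i
    using that unfolding n_def by (subst nth_map) (auto simp del: upt_Suc)
  have "map corner_vertex n = vs"
    by (rule nth_equalityI) (use ln len nn r in \<open>auto simp: corner_vertex_def\<close>)
  moreover have "links n = es"
  proof (rule nth_equalityI)
    fix i assume "i < length (links n)"
    then have i: "i < k" using ln by simp
    then have "links n ! i = {a i, b i}" using nn[of i] nn[of "Suc i"] ln by (simp add: nth_links pv_def)
    also have "\<dots> = es ! i" using ab[of i] i by (simp add: cyc_def)
    finally show "links n ! i = es ! i" .
  qed (simp add: ln k_def)
  moreover have "closing n = c"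
  proof -
    have "n \<noteq> []" using ln by auto
    then have "last n = n ! k" "hd n = n ! 0" using ln by (simp_all add: last_conv_nth hd_conv_nth)
    then have "closing n = {a k, b k}" using nn[of k] nn[of 0] by (simp add: closing_def pv_def)
    also have "\<dots> = c" using ab[of k] by (simp add: cyc_def)
    finally show ?thesis .
  qed
  ultimately show ?thesis using ln ev by (auto simp: tree_of_def t_eq)
qed

lemma necklaces_of_trace_data:
  assumes mg: "multigraph V E" and tri: "\<And>v. v \<in> V \<Longrightarrow> card v = 3" and sub: "set fs \<subseteq> E"
    and t: "trace_data (V, E, fs) ts"
  shows "\<exists>ns. necklaces V E (set fs) ns \<and> ts = map tree_of ns"
proof -
  have "\<forall>t\<in>set ts. \<exists>n. t = tree_of n \<and> odd (length n)"
    using closed_linear_tree_corners[OF mg tri sub] t by (auto simp: trace_data_def)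
  then obtain g where g: "\<And>t. t \<in> set ts \<Longrightarrow> t = tree_of (g t) \<and> odd (length (g t))" by metis
  define ns where "ns = map g ts"
  have ts: "ts = map tree_of ns" using g by (auto simp: ns_def comp_def intro: map_idI[symmetric])
  have vs: "concat (map (\<lambda>(vs, es, c). vs) ts) = map corner_vertex (concat ns)"
    by (simp add: ts tree_of_def comp_def map_concat)
  have V: "corner_vertex ` set (concat ns) = V"
    using t vs by (metis (mono_tags, lifting) trace_data_def case_prod_conv list.set_map)
  have "distinct (map corner_vertex (concat ns))"
    using t vs by (metis (mono_tags, lifting) trace_data_def case_prod_conv)
  from distinct_corner_listsI[OF mg this _ tri] V
  have d: "distinct (concat (map corner_list (concat ns)))" by simp
  have "(\<Union>n\<in>set ns. set (links n)) = set (concat (map (\<lambda>(vs, es, c). es) ts))"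
    by (auto simp: ts tree_of_def)
  then have F: "(\<Union>n\<in>set ns. set (links n)) = set fs" using t by (simp add: trace_data_def)
  have "odd (length n) \<and> closing n \<in> E - set fs" if "n \<in> set ns" for n
  proof -
    have "closed_linear_tree V E (set fs) (tree_of n)"
      using t that by (auto simp: trace_data_def ts)
    moreover have "odd (length n)" using that g by (auto simp: ns_def)
    ultimately show ?thesis by (simp add: closed_linear_tree_def tree_of_def)
  qed
  then have "necklaces V E (set fs) ns" using d V F by (auto simp: necklaces_def)
  then show ?thesis using ts by blast
qed


section \<open>The value of the trace\<close>

lemma necklacesD:
  assumes "necklaces V E F ns"
  shows "distinct (concat (map corner_list (concat ns)))" and "corner_vertex ` set (concat ns) = V"
    and "(\<Union>n\<in>set ns. set (links n)) = F"
    and "\<And>n. n \<in> set ns \<Longrightarrow> odd (length n)" and "\<And>n. n \<in> set ns \<Longrightarrow> n \<noteq> []"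
    and "\<And>n. n \<in> set ns \<Longrightarrow> closing n \<in> E - F"
  using assms by (auto simp: necklaces_def)

lemma necklaces_same:
  assumes "necklaces V E F ns" "n \<in> set ns" "m \<in> set ns" "k \<in> set n" "l \<in> set m"
    "x \<in> corner_vertex k" "x \<in> corner_vertex l"
  shows "n = m" "k = l"
proof -
  note d = necklacesD(1)[OF assms(1)]
  show "k = l" by (rule distinct_corners(3)[OF d]) (use assms in auto)
  then show "n = m" using distinct_concat_iff[of ns] distinct_corners(1)[OF d] assms(2-5) by blast
qed

lemma links_halfedge:
  assumes "e \<in> set (links n)" "x \<in> e"
  shows "\<exists>k\<in>set n. x = entry k \<or> x = exit k"
  using assms by (induction n rule: links.induct) auto

lemma distinct_links:
  assumes "distinct (concat (map corner_list n))"
  shows "distinct (links n)"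
  using assms
proof (induction n rule: links.induct)
  case (1 k l n)
  have "exit k \<notin> \<Union>(set (links (l # n)))"
  proof
    assume "exit k \<in> \<Union>(set (links (l # n)))"
    then obtain j where j: "j \<in> set (l # n)" "exit k = entry j \<or> exit k = exit j"
      using links_halfedge by blast
    have "k = j" by (rule distinct_corners(3)[OF 1(2), of _ _ "exit k"])
      (use j in \<open>auto simp: corner_vertex_def\<close>)
    then show False using distinct_corners(1)[OF 1(2)] j(1) by auto
  qed
  then show ?case using 1 by auto
qed auto

text \<open>Trace data compare the forest edges only as sets. Because no edge is listed twice, the
  concatenated list is an ordering of the forest and has a sign relative to
  \<open>fs\<close>.\<close>

lemma necklaces_distinct_links:
  assumes "necklaces V E F ns"
  shows "distinct (concat (map links ns))"
proof -
  note d = necklacesD(1)[OF assms]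
  have ne: "\<forall>n\<in>set ns. n \<noteq> []" using necklacesD(5)[OF assms] by blast
  show ?thesis using d ne
  proof (induction ns)
    case (Cons n ns)
    have "set (links n) \<inter> set (concat (map links ns)) = {}"
    proof (rule ccontr)
      assume "set (links n) \<inter> set (concat (map links ns)) \<noteq> {}"
      then obtain e m where e: "e \<in> set (links n)" "m \<in> set ns" "e \<in> set (links m)" by auto
      obtain i where i: "Suc i < length n" "e = {exit (n ! i), entry (n ! Suc i)}"
        using e(1) by (metis in_set_conv_nth length_links less_diff_conv nth_links Suc_eq_plus1)
      then have "exit (n ! i) \<in> \<Union>(set (links m))" using e by auto
      then obtain j where "j \<in> set m" "exit (n ! i) = entry j \<or> exit (n ! i) = exit j"
        using links_halfedge e(3) by blast
      then have "exit (n ! i) \<in> corner_vertex j" by (auto simp: corner_vertex_def)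
      then have "exit (n ! i) \<in> set (concat (map corner_list (concat ns)))"
        using e(2) \<open>j \<in> set m\<close> by auto
      moreover have "n ! i \<in> set n" "exit (n ! i) \<in> corner_vertex (n ! i)"
        using i by (simp_all add: corner_vertex_def)
      then have "exit (n ! i) \<in> set (concat (map corner_list n))" by auto
      ultimately have "exit (n ! i) \<in> set (concat (map corner_list n))"
          "exit (n ! i) \<in> set (concat (map corner_list (concat ns)))" by blast+
      then show False using Cons.prems(1) by auto
    qed
    moreover have "distinct (links n)" by (rule distinct_links) (use Cons.prems in auto)
    ultimately show ?case using Cons by auto
  qed simp
qed

lemma collapsed_vertex_tree_of:
  assumes "distinct (concat (map corner_list n))" "n \<noteq> []"
  shows "collapsed_vertex (tree_of n) = map leg n"
proof -
  have "the_elem (corner_vertex k - (entry ` set n \<union> exit ` set n)) = leg k" if "k \<in> set n" for k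
  proof -
    have "leg k \<notin> entry ` set n \<union> exit ` set n" using corner_halfedges[OF assms(1) that] by blast
    then have "corner_vertex k - (entry ` set n \<union> exit ` set n) = {leg k}"
      using that by (auto simp: corner_vertex_def)
    then show ?thesis by simp
  qed
  then show ?thesis
    using Union_links_closing[OF assms(2)] by (simp add: collapsed_vertex_def tree_of_def)
qed

text \<open>These conditions persist when any further edge of \<open>E\<close> is added to the
  forest, as the boundary requires. Connectedness is assumed explicitly where a collapse must be
  connected.\<close>

locale trivalent =
  fixes V E :: "halfedges set" and fs :: "halfedges list"
  assumes multigraph: "multigraph V E" and card_vertex: "v \<in> V \<Longrightarrow> card v = 3"
    and distinct_forest: "distinct fs" and forest_edges: "set fs \<subseteq> E"

lemma trivalent_Rep:
  assumes "Rep_forested_graph X = (V, E, fs)"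
  shows "trivalent V E fs" "connected_graph V E" "forest V (set fs)"
  using Rep_forested_graph[of X] assms by (auto simp: oriented_forested_graph_def trivalent_def)

section \<open>Independence of the directions and of the order of the trees\<close>

definition trace_value ::
  "halfedges set \<times> halfedges set \<times> halfedges list \<Rightarrow>
   (halfedges list \<times> halfedges list \<times> halfedges) list \<Rightarrow> odd_space" where
  "trace_value = (\<lambda>(V, E, fs) ts.
     scale_odd (ordering_sign fs (concat (map (\<lambda>(vs, es, c). es) ts)) * (-2) ^ length ts)
       (odd_graph_class (collapse (V, E, fs) ts)))"

text \<open>One choice of trace data is fixed by \<open>SOME\<close>; \<open>trace_value_eq\<close>
  shows that every choice gives the same value.\<close>

definition trace_of :: "halfedges set \<times> halfedges set \<times> halfedges list \<Rightarrow> odd_space" where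
  "trace_of X = (if \<exists>ts. trace_data X ts then trace_value X (SOME ts. trace_data X ts) else 0)"

fun reverse_tree ::
  "halfedges list \<times> halfedges list \<times> halfedges \<Rightarrow> halfedges list \<times> halfedges list \<times> halfedges" where
  "reverse_tree (vs, es, c) = (rev vs, rev es, c)"

lemma joins_commute: "joins e v w \<longleftrightarrow> joins e w v"
  unfolding joins_def by (auto simp: insert_commute)

lemma closed_linear_tree_reverse:
  assumes "closed_linear_tree V E F t"
  shows "closed_linear_tree V E F (reverse_tree t)"
proof -
  obtain vs es c where t: "t = (vs, es, c)" by (cases t)
  have a: "length vs = Suc (length es)"
      "\<And>i. i < length es \<Longrightarrow> joins (es ! i) (vs ! i) (vs ! Suc i)"
      "joins c (last vs) (hd vs)"
    using assms by (auto simp: closed_linear_tree_def t)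
  have "joins (rev es ! i) (rev vs ! i) (rev vs ! Suc i)" if "i < length es" for i
  proof -
    have s: "Suc (length es - Suc i) = length es - i" using that by simp
    then have "joins (es ! (length es - Suc i)) (vs ! (length es - Suc i)) (vs ! (length es - i))"
      using a(2)[of "length es - Suc i"] that by simp
    then show ?thesis using that a(1) joins_commute by (simp add: rev_nth)
  qed
  moreover have "joins c (last (rev vs)) (hd (rev vs))"
    using a joins_commute by (auto simp: last_rev hd_rev)
  ultimately show ?thesis using assms by (auto simp: closed_linear_tree_def t)
qed

lemma collapsed_vertex_reverse: "collapsed_vertex (reverse_tree t) = rev (collapsed_vertex t)"
  by (cases t) (simp add: collapsed_vertex_def rev_map)

lemma trace_data_reverse:
  assumes "trace_data (V, E, fs) (us @ t # ws)"
  shows "trace_data (V, E, fs) (us @ reverse_tree t # ws)"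
proof -
  obtain vs es c where t: "t = (vs, es, c)" by (cases t)
  have "closed_linear_tree V E (set fs) (reverse_tree t)"
    using assms closed_linear_tree_reverse by (simp add: trace_data_def)
  then show ?thesis using assms unfolding trace_data_def prod.case t by auto
qed

lemma scale_signed:
  assumes "even a = even b"
  shows "scale_odd (signed a c * d) (signed b x) = scale_odd (c * d) x"
  using assms by (simp add: signed_def odd.scale_minus_left odd.scale_minus_right)

text \<open>The test looks at the set of half-edges of \<open>l\<close>, so it is unaffected by
  reordering; when it succeeds, neither ordering lies in \<open>M\<close>, as
  \<open>odd_graph_class_swap\<close> demands.\<close>

lemma alternating_odd_graph_class:
  "alternating (\<lambda>l :: nat list. if \<forall>m\<in>M. set m \<noteq> set l then odd_graph_class (insert l M, E) else 0)"
  unfolding alternating_def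
proof (intro allI impI)
  fix us ws :: "nat list" and x y
  have s: "set (us @ y # x # ws) = set (us @ x # y # ws)" by auto
  have notin: "us @ x # y # ws \<notin> M" "us @ y # x # ws \<notin> M"
    if "\<forall>m\<in>M. set m \<noteq> set (us @ x # y # ws)"
    using that s by blast+
  show "(if \<forall>m\<in>M. set m \<noteq> set (us @ y # x # ws)
      then odd_graph_class (insert (us @ y # x # ws) M, E) else 0) =
     - (if \<forall>m\<in>M. set m \<noteq> set (us @ x # y # ws)
        then odd_graph_class (insert (us @ x # y # ws) M, E) else 0)"
  proof (cases "\<forall>m\<in>M. set m \<noteq> set (us @ x # y # ws)")
    case True
    from odd_graph_class_swap[OF notin[OF True], of E] show ?thesis
      using True unfolding s by simp
  next
    case False
    then show ?thesis unfolding s by (simp only: if_False minus_zero)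
  qed
qed

text \<open>The inversions in reversing \<open>k\<close> edges and \<open>k + 1\<close> vertices:
  for k = 2j they number j(2j - 1) and (2j + 1)j, both of the parity of j.\<close>

lemma triangular_parity:
  "even k \<Longrightarrow> even (k * (k - 1) div 2) = even (Suc k * (Suc k - 1) div 2)"
proof -
  assume "even k"
  then obtain j where j: "k = 2 * j" by blast
  have "k * (k - 1) div 2 = j * (2 * j - 1)" "Suc k * (Suc k - 1) div 2 = (2 * j + 1) * j"
    by (simp_all add: j mult.assoc)
  then show ?thesis by (cases j) auto
qed

context trivalent
begin

lemma trace_data_corners:
  assumes "trace_data (V, E, fs) ts"
  obtains ns where "necklaces V E (set fs) ns" "ts = map tree_of ns"
  using necklaces_of_trace_data[OF multigraph card_vertex forest_edges assms] by blast

lemma collapsed_vertex_necklace: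
  assumes "necklaces V E F ns" "n \<in> set ns"
  shows "collapsed_vertex (tree_of n) = map leg n"
proof (rule collapsed_vertex_tree_of)
  obtain xs ys where "ns = xs @ n # ys" using assms(2) by (meson split_list)
  then show "distinct (concat (map corner_list n))" using necklacesD(1)[OF assms(1)] by simp
qed (rule necklacesD(5)[OF assms])

lemma necklace_legs:
  assumes "necklaces V E F ns" "n \<in> set ns"
  shows "distinct (map leg n)"
    and "\<And>m. m \<in> set ns \<Longrightarrow> set (map leg m) = set (map leg n) \<Longrightarrow> m = n"
proof -
  note d = necklacesD(1)[OF assms(1)]
  have n: "set n \<subseteq> set (concat ns)" using assms(2) by auto
  have "distinct n" using distinct_concat_iff[of ns] distinct_corners(1)[OF d] assms(2) by blast
  then show "distinct (map leg n)" using corner_halfedges(9)[OF d] n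
    by (auto simp: distinct_map inj_on_def subset_iff)
  fix m assume m: "m \<in> set ns" "set (map leg m) = set (map leg n)"
  have "hd m \<in> set m" using necklacesD(5)[OF assms(1) m(1)] by simp
  then obtain k where "k \<in> set n" "leg k = leg (hd m)" using m(2) by (metis imageE imageI list.set_map)
  then show "m = n"
    using necklaces_same(1)[OF assms(1) m(1) assms(2) \<open>hd m \<in> set m\<close>, of k "leg k"]
    by (simp add: corner_vertex_def)
qed

lemma trace_data_distinct:
  assumes "trace_data (V, E, fs) ts"
  shows "distinct (concat (map (\<lambda>(vs, es, c). es) ts))"
    and "mset fs = mset (concat (map (\<lambda>(vs, es, c). es) ts))"
    and "distinct ts"
    and "t \<in> set ts \<Longrightarrow> distinct (collapsed_vertex t)"
    and "t \<in> set ts \<Longrightarrow> t' \<in> set ts \<Longrightarrow> set (collapsed_vertex t) = set (collapsed_vertex t') \<Longrightarrow> t = t'"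
proof -
  obtain ns where ns: "necklaces V E (set fs) ns" "ts = map tree_of ns"
    using assms by (rule trace_data_corners)
  have es: "map (\<lambda>(vs, es, c). es) ts = map links ns" by (simp add: ns tree_of_def comp_def)
  show 1: "distinct (concat (map (\<lambda>(vs, es, c). es) ts))"
    unfolding es by (rule necklaces_distinct_links[OF ns(1)])
  moreover have "set fs = set (concat (map (\<lambda>(vs, es, c). es) ts))"
    using assms by (simp add: trace_data_def)
  ultimately show "mset fs = mset (concat (map (\<lambda>(vs, es, c). es) ts))"
    using distinct_forest by (simp only: set_eq_iff_mset_eq_distinct)
  have "distinct ns" using distinct_corners(1)[OF necklacesD(1)[OF ns(1)]] necklacesD(5)[OF ns(1)]
    by (metis distinct_concat_iff removeAll_id)
  moreover have "inj_on tree_of (set ns)"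
  proof (rule inj_onI)
    fix n m assume nm: "n \<in> set ns" "m \<in> set ns" "tree_of n = tree_of m"
    then have "map leg n = map leg m" using collapsed_vertex_necklace[OF ns(1)] by metis
    then show "n = m" using necklace_legs(2)[OF ns(1) nm(2,1)] by simp
  qed
  ultimately show "distinct ts" by (simp add: ns distinct_map)
  show "t \<in> set ts \<Longrightarrow> distinct (collapsed_vertex t)"
    using necklace_legs(1)[OF ns(1)] collapsed_vertex_necklace[OF ns(1)] by (auto simp: ns(2))
  show "t \<in> set ts \<Longrightarrow> t' \<in> set ts \<Longrightarrow> set (collapsed_vertex t) = set (collapsed_vertex t') \<Longrightarrow> t = t'"
  proof -
    assume "t \<in> set ts" "t' \<in> set ts" and eq: "set (collapsed_vertex t) = set (collapsed_vertex t')"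
    then obtain n m where "n \<in> set ns" "m \<in> set ns" "t = tree_of n" "t' = tree_of m"
      by (auto simp: ns(2))
    then show "t = t'"
      using necklace_legs(2)[OF ns(1), of m n] collapsed_vertex_necklace[OF ns(1)] eq by simp
  qed
qed

lemma trace_value_reverse:
  assumes td: "trace_data (V, E, fs) (us @ t # ws)"
  shows "trace_value (V, E, fs) (us @ reverse_tree t # ws) = trace_value (V, E, fs) (us @ t # ws)"
proof -
  obtain vs es c where t: "t = (vs, es, c)" by (cases t)
  let ?es = "\<lambda>ts. concat (map (\<lambda>(vs, es, c). es) ts)"
  define M where "M = collapsed_vertex ` set (us @ ws)"
  define E' where "E' = E - set fs - (\<lambda>(vs, es, c). c) ` set (us @ t # ws)"
  note d = trace_data_distinct[OF td]
  have len: "length vs = Suc (length es)" "even (length es)"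
    using td by (auto simp: trace_data_def closed_linear_tree_def t)
  have 1: "ordering_sign fs (?es us @ rev es @ ?es ws) =
      signed (length es * (length es - 1) div 2) (ordering_sign fs (?es us @ es @ ?es ws))"
    by (rule alternating_rev_block[OF alternating_ordering_sign]) (use d(1) in \<open>simp add: t\<close>)
  have M: "\<forall>m\<in>M. set m \<noteq> set (collapsed_vertex t)"
  proof
    fix m assume "m \<in> M"
    then obtain t' where t': "t' \<in> set (us @ ws)" "m = collapsed_vertex t'" by (auto simp: M_def)
    then have "t' \<noteq> t" "t' \<in> set (us @ t # ws)" using d(3) by auto
    then show "set m \<noteq> set (collapsed_vertex t)" using d(5)[of t' t] t'(2) by auto
  qed
  have "odd_graph_class (insert (rev (collapsed_vertex t)) M, E') =
      signed (length vs * (length vs - 1) div 2) (odd_graph_class (insert (collapsed_vertex t) M, E'))"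
    using alternating_rev_block[OF alternating_odd_graph_class[of M E'], of "[]" "collapsed_vertex t" "[]"]
      d(4)[of t] M by (simp add: t collapsed_vertex_def)
  moreover have "collapse (V, E, fs) (us @ t # ws) = (insert (collapsed_vertex t) M, E')"
    by (simp add: collapse_def M_def E'_def image_Un)
  moreover have "collapse (V, E, fs) (us @ reverse_tree t # ws) = (insert (rev (collapsed_vertex t)) M, E')"
    using collapsed_vertex_reverse[of t] by (simp add: collapse_def M_def E'_def image_Un t)
  ultimately show ?thesis using 1 scale_signed[OF triangular_parity[OF len(2)]]
    unfolding trace_value_def prod.case by (simp add: t len(1) del: collapse_def)
qed

lemma trace_value_permute:
  assumes td: "trace_data (V, E, fs) ts" and "mset ts' = mset ts"
  shows "trace_value (V, E, fs) ts' = trace_value (V, E, fs) ts"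
proof -
  let ?es = "\<lambda>ts. map (\<lambda>(vs, es, c). es) ts"
  have "\<forall>b\<in>set (?es ts). even (length b)"
    using td by (auto simp: trace_data_def closed_linear_tree_def)
  from alternating_permute_even_blocks[OF alternating_ordering_sign, of "[]", OF _ this, of "?es ts'" fs]
  have "ordering_sign fs (concat (?es ts)) = ordering_sign fs (concat (?es ts'))"
    using trace_data_distinct(1)[OF td] assms(2) by simp
  moreover have "set ts' = set ts" "length ts' = length ts"
    using assms(2) by (auto dest: mset_eq_setD mset_eq_length)
  ultimately show ?thesis by (simp add: trace_value_def collapse_def)
qed

text \<open>Trees are reversed one at a time; \<open>us\<close> holds those already treated.\<close>

lemma trace_value_reverse_some:
  assumes "trace_data (V, E, fs) (us @ ws)" "\<And>t. t \<in> set ws \<Longrightarrow> g t = t \<or> g t = reverse_tree t"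
  shows "trace_data (V, E, fs) (us @ map g ws) \<and>
    trace_value (V, E, fs) (us @ map g ws) = trace_value (V, E, fs) (us @ ws)"
  using assms
proof (induction ws arbitrary: us)
  case (Cons t ws)
  have "trace_data (V, E, fs) (us @ g t # ws) \<and>
      trace_value (V, E, fs) (us @ g t # ws) = trace_value (V, E, fs) (us @ t # ws)"
    using Cons.prems(2)[of t] trace_data_reverse[OF Cons.prems(1)] trace_value_reverse[OF Cons.prems(1)]
      Cons.prems(1) by auto
  then show ?case using Cons.IH[of "us @ [g t]"] Cons.prems(2) by simp
qed simp

end

section \<open>Uniqueness of the paths that make up a linear forest\<close>

definition reverse_corner :: "corner \<Rightarrow> corner" where
  "reverse_corner k = Corner (exit k) (entry k) (leg k)"

definition reverse_necklace :: "corner list \<Rightarrow> corner list" where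
  "reverse_necklace n = rev (map reverse_corner n)"

lemma corner_vertex_reverse_corner [simp]: "corner_vertex (reverse_corner k) = corner_vertex k"
  by (auto simp: reverse_corner_def corner_vertex_def)

lemma links_reverse_necklace: "links (reverse_necklace n) = rev (links n)"
proof (induction n rule: links.induct)
  case (1 k l n)
  let ?r = "reverse_necklace (l # n)"
  have "reverse_necklace (k # l # n) = ?r @ [reverse_corner k]" by (simp add: reverse_necklace_def)
  moreover have "?r \<noteq> []" "last ?r = reverse_corner l" by (simp_all add: reverse_necklace_def)
  ultimately have "links (reverse_necklace (k # l # n)) = links ?r @ [{entry l, exit k}]"
    by (simp add: links_append reverse_corner_def)
  then show ?case using 1 by (simp add: insert_commute)
qed (auto simp: reverse_necklace_def)

text \<open>The local description of a path in the forest: legs and the last exit are off the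
  forest, so the path cannot branch or go on. The first entry may lie on the forest, so that tails
  of paths are again paths.\<close>

definition corner_path :: "halfedges set \<Rightarrow> halfedges set \<Rightarrow> corner list \<Rightarrow> bool" where
  "corner_path V F n \<longleftrightarrow> n \<noteq> [] \<and> corner_vertex ` set n \<subseteq> V \<and> set (links n) \<subseteq> F \<and>
     (\<forall>k\<in>set n. entry k \<noteq> exit k \<and> leg k \<notin> \<Union>F) \<and> exit (last n) \<notin> \<Union>F"

lemma corner_path_exit:
  assumes "corner_path V F (k # l # n)"
  shows "{exit k, entry l} \<in> F" "corner_path V F (l # n)"
  using assms by (auto simp: corner_path_def)

text \<open>At a vertex entered by a known half-edge the leg is off the forest, so only the exit can
  lead on. Both lists advance in step and stop together.\<close>

lemma corner_path_unique:
  assumes mg: "multigraph V E" and "F \<subseteq> E"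
    and "corner_path V F n" "corner_path V F m"
    and "entry (hd n) = entry (hd m)" "corner_vertex (hd n) = corner_vertex (hd m)"
  shows "map corner_vertex n = map corner_vertex m \<and> links n = links m"
  using assms(3-)
proof (induction n arbitrary: m rule: links.induct)
  case (1 k l n)
  then obtain y m' where m: "m = y # m'" by (cases m) (auto simp: corner_path_def)
  have kl: "{exit k, entry l} \<in> F" "corner_path V F (l # n)" using corner_path_exit[OF 1(2)] by auto
  have ne: "leg y \<notin> \<Union>F" "entry k \<noteq> exit k" using 1(2,3) by (auto simp: m corner_path_def)
  have k: "exit k \<in> \<Union>F" using kl by blast
  have "exit k \<in> corner_vertex y" using 1(5) by (auto simp: m corner_vertex_def)
  then have e: "exit k = exit y" using ne k 1(4) by (auto simp: m corner_vertex_def)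
  have "m' \<noteq> []" using 1(3) e k by (auto simp: m corner_path_def)
  then obtain z m'' where m': "m' = z # m''" by (cases m') auto
  have yz: "{exit y, entry z} \<in> F" "corner_path V F (z # m'')" using corner_path_exit 1(3) by (auto simp: m m')
  have "{exit k, entry l} = {exit y, entry z}"
    by (rule multigraph_edge_eq[OF mg, of _ _ "exit k"]) (use kl yz e assms(2) in auto)
  then have el: "entry l = entry z" using e by (auto simp: doubleton_eq_iff)
  have "corner_vertex l = corner_vertex z"
    by (rule multigraph_vertex_eq[OF mg, of _ _ "entry l"])
      (use kl(2) yz(2) el in \<open>auto simp: corner_path_def corner_vertex_def\<close>)
  with 1(1)[OF kl(2) yz(2)] el have "map corner_vertex (l # n) = map corner_vertex (z # m'')"
    "links (l # n) = links (z # m'')" by auto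
  then show ?case using 1(5) e el by (simp add: m m')
next
  case ("2_2" k)
  then obtain y m' where m: "m = y # m'" by (cases m) (auto simp: corner_path_def)
  have "m' = []"
  proof (rule ccontr)
    assume "m' \<noteq> []"
    then obtain z m'' where m': "m' = z # m''" by (cases m') auto
    have "exit y \<in> \<Union>F" using corner_path_exit(1)[of V F y z m''] "2_2"(2) by (auto simp: m m')
    moreover have "exit y \<in> corner_vertex k" using "2_2"(4) by (auto simp: m corner_vertex_def)
    moreover have "entry y \<noteq> exit y" using "2_2"(2) by (auto simp: m corner_path_def)
    ultimately show False using "2_2"(1,3) by (auto simp: m corner_path_def corner_vertex_def)
  qed
  then show ?case using "2_2" by (simp add: m)
qed (simp add: corner_path_def)

text \<open>Links consist of entries and exits, so legs are off the forest. The two outer half-edges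
  belong to the closing edge, which is disjoint from every forest edge.\<close>

lemma necklace_corner_path:
  assumes "multigraph V E" "F \<subseteq> E" "necklaces V E F ns" "n \<in> set ns"
  shows "corner_path V F n" "entry (hd n) \<notin> \<Union>F"
proof -
  note nD = necklacesD[OF assms(3)]
  have sub: "set n \<subseteq> set (concat ns)" using assms(4) by auto
  have cl: "closing n \<in> E - F" by (rule nD(6)[OF assms(4)])
  have no: "x \<notin> \<Union>F" if "x \<in> closing n" for x
    using multigraph_edge_eq[OF assms(1), of "closing n" _ x] cl that assms(2) by blast
  have "leg k \<notin> \<Union>F" if "k \<in> set n" for k
  proof
    assume "leg k \<in> \<Union>F"
    then obtain e m where "m \<in> set ns" "e \<in> set (links m)" "leg k \<in> e" using nD(3) by auto
    then obtain l where "l \<in> set (concat ns)" "leg k = entry l \<or> leg k = exit l"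
      using links_halfedge by fastforce
    moreover have "k \<in> set (concat ns)" using that sub by blast
    ultimately show False using corner_halfedges(5,6)[OF nD(1)] by metis
  qed
  moreover have "entry k \<noteq> exit k" if "k \<in> set n" for k
    using corner_halfedges(1)[OF nD(1), of k k] that sub by auto
  moreover have "corner_vertex ` set n \<subseteq> V" using nD(2) sub by auto
  moreover have "set (links n) \<subseteq> F" using nD(3) assms(4) by auto
  ultimately show "corner_path V F n" "entry (hd n) \<notin> \<Union>F"
    using no nD(5)[OF assms(4)] by (auto simp: corner_path_def closing_def)
qed

lemma reverse_corner_path:
  assumes "corner_path V F n" "entry (hd n) \<notin> \<Union>F"
  shows "corner_path V F (reverse_necklace n)" "entry (hd (reverse_necklace n)) \<notin> \<Union>F"
proof -
  have "corner_vertex ` set (reverse_necklace n) = corner_vertex ` set n"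
    by (simp add: reverse_necklace_def image_image)
  moreover have "\<forall>k\<in>set (reverse_necklace n). entry k \<noteq> exit k \<and> leg k \<notin> \<Union>F"
    using assms(1) by (auto simp: corner_path_def reverse_necklace_def reverse_corner_def)
  moreover have "exit (last (reverse_necklace n)) = entry (hd n)"
    "entry (hd (reverse_necklace n)) = exit (last n)" "reverse_necklace n \<noteq> []"
    using assms(1) by (auto simp: corner_path_def reverse_necklace_def reverse_corner_def last_rev hd_rev
        hd_map last_map)
  ultimately show "corner_path V F (reverse_necklace n)" "entry (hd (reverse_necklace n)) \<notin> \<Union>F"
    using assms by (simp_all add: corner_path_def links_reverse_necklace)
qed

text \<open>At the first vertex, \<open>entry\<close> and \<open>leg\<close> may be interchanged
  between the two lists, because the closing edges may differ. Both are off the forest, so the exits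
  still agree, and from the second corner on the entries agree too.\<close>

lemma corner_path_unique':
  assumes mg: "multigraph V E" and "F \<subseteq> E"
    and n: "corner_path V F n" "entry (hd n) \<notin> \<Union>F" and m: "corner_path V F m" "entry (hd m) \<notin> \<Union>F"
    and v: "corner_vertex (hd n) = corner_vertex (hd m)"
  shows "map corner_vertex n = map corner_vertex m \<and> links n = links m"
proof (cases n rule: links.cases)
  case (1 k l n')
  have kl: "{exit k, entry l} \<in> F" "corner_path V F (l # n')" using corner_path_exit n(1) by (auto simp: 1)
  obtain y m' where m_eq: "m = y # m'" using m(1) by (cases m) (auto simp: corner_path_def)
  have k: "exit k \<in> \<Union>F" using kl by blast
  moreover have "exit k \<in> corner_vertex y" using v by (auto simp: 1 m_eq corner_vertex_def)
  ultimately have e: "exit k = exit y" using m by (auto simp: m_eq corner_path_def corner_vertex_def)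
  have "m' \<noteq> []" using m(1) e k by (auto simp: m_eq corner_path_def)
  then obtain z m'' where m': "m' = z # m''" by (cases m') auto
  have yz: "{exit y, entry z} \<in> F" "corner_path V F (z # m'')" using corner_path_exit m(1) by (auto simp: m_eq m')
  have "{exit k, entry l} = {exit y, entry z}"
    by (rule multigraph_edge_eq[OF mg, of _ _ "exit k"]) (use kl yz e assms(2) in auto)
  then have el: "entry l = entry z" using e by (auto simp: doubleton_eq_iff)
  have "corner_vertex l = corner_vertex z"
    by (rule multigraph_vertex_eq[OF mg, of _ _ "entry l"])
      (use kl(2) yz(2) el in \<open>auto simp: corner_path_def corner_vertex_def\<close>)
  with corner_path_unique[OF mg assms(2) kl(2) yz(2)] el
  show ?thesis using v e by (simp add: 1 m_eq m')
next
  case "2_1" then show ?thesis using n(1) by (simp add: corner_path_def)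
next
  case ("2_2" k)
  obtain y m' where m_eq: "m = y # m'" using m(1) by (cases m) (auto simp: corner_path_def)
  have "m' = []"
  proof (rule ccontr)
    assume "m' \<noteq> []"
    then obtain z m'' where m': "m' = z # m''" by (cases m') auto
    have "exit y \<in> \<Union>F" using corner_path_exit(1)[of V F y z m''] m(1) by (auto simp: m_eq m')
    moreover have "exit y \<in> corner_vertex k" using v by (auto simp: "2_2" m_eq corner_vertex_def)
    ultimately show False using n by (auto simp: "2_2" corner_path_def corner_vertex_def)
  qed
  then show ?thesis using v by (simp add: "2_2" m_eq)
qed

text \<open>At most one half-edge of the first vertex of \<open>n\<close> lies on the forest,
  whereas an inner corner of a path has two. So this vertex is an end of the path \<open>m\<close>
  through it, and either \<open>m\<close> or its reversal runs in step with
  \<open>n\<close>.\<close>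

lemma necklaces_paths_unique:
  assumes mg: "multigraph V E" and F: "F \<subseteq> E"
    and ns: "necklaces V E F ns" and ms: "necklaces V E F ms" and n: "n \<in> set ns"
  shows "\<exists>m\<in>set ms. map corner_vertex n = map corner_vertex m \<and> links n = links m \<or>
    map corner_vertex n = rev (map corner_vertex m) \<and> links n = rev (links m)"
proof -
  note np = necklace_corner_path[OF mg F ns n]
  have "hd n \<in> set n" using necklacesD(5)[OF ns n] by simp
  then have "corner_vertex (hd n) \<in> V" using np(1) by (auto simp: corner_path_def)
  then obtain y m where m: "m \<in> set ms" "y \<in> set m" "corner_vertex y = corner_vertex (hd n)"
    using necklacesD(2)[OF ms] by (metis UN_E imageE set_concat)
  note mp = necklace_corner_path[OF mg F ms m(1)]
  obtain m1 m2 where m_eq: "m = m1 @ y # m2" using m(2) by (meson split_list)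
  have "entry y \<in> \<Union>F" if "m1 \<noteq> []"
    using mp(1) links_append[OF that, of "y # m2"] by (auto simp: m_eq corner_path_def)
  moreover have "exit y \<in> \<Union>F" if "m2 \<noteq> []"
  proof -
    obtain z m3 where "m2 = z # m3" using \<open>m2 \<noteq> []\<close> by (cases m2) auto
    then have "{exit y, entry z} \<in> set (links m)" by (cases "m1 = []") (auto simp: m_eq links_append)
    then show ?thesis using mp(1) by (auto simp: corner_path_def)
  qed
  moreover have "entry y \<noteq> exit y" using mp(1) m(2) by (auto simp: corner_path_def)
  moreover have "x = exit (hd n)" if "x \<in> corner_vertex y" "x \<in> \<Union>F" for x
  proof -
    have "x \<in> {entry (hd n), exit (hd n), leg (hd n)}"
      using that(1) m(3) unfolding corner_vertex_def by blast
    moreover have "leg (hd n) \<notin> \<Union>F" using np(1) \<open>hd n \<in> set n\<close> by (simp add: corner_path_def)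
    ultimately show ?thesis using np(2) that(2) by auto
  qed
  moreover have "entry y \<in> corner_vertex y" "exit y \<in> corner_vertex y" by (simp_all add: corner_vertex_def)
  ultimately have "m1 = [] \<or> m2 = []" by metis
  then show ?thesis
  proof
    assume "m1 = []"
    then have "corner_vertex (hd n) = corner_vertex (hd m)" using m(3) by (simp add: m_eq)
    from corner_path_unique'[OF mg F np mp this] show ?thesis using m(1) by blast
  next
    assume "m2 = []"
    then have "corner_vertex (hd n) = corner_vertex (hd (reverse_necklace m))"
      using m(3) by (simp add: m_eq reverse_necklace_def)
    from corner_path_unique'[OF mg F np reverse_corner_path[OF mp] this]
    have "map corner_vertex n = rev (map corner_vertex m) \<and> links n = rev (links m)"
      by (simp add: links_reverse_necklace) (simp add: reverse_necklace_def rev_map comp_def)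
    then show ?thesis using m(1) by blast
  qed
qed

section \<open>Independence of the closing edges\<close>

context trivalent
begin

text \<open>An edge that is neither in the forest nor a closing edge shares no half-edge with the
  cycle. Its ends \<open>x\<close> and \<open>y\<close> are therefore legs of the same tree, and
  collapsing makes it a loop.\<close>

lemma trace_value_loop:
  assumes ns: "necklaces V E (set fs) ns" and n: "n \<in> set ns"
    and c: "{x, y} \<in> E - set fs" "{x, y} \<notin> closing ` set ns" "x \<noteq> y"
    and k: "k \<in> set n" "x \<in> corner_vertex k" and l: "l \<in> set n" "y \<in> corner_vertex l"
  shows "trace_value (V, E, fs) (map tree_of ns) = 0"
proof -
  have ne: "n \<noteq> []" by (rule necklacesD(5)[OF ns n])
  have "z \<notin> \<Union>(insert (closing n) (set (links n)))" if "z \<in> {x, y}" for z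
  proof
    assume "z \<in> \<Union>(insert (closing n) (set (links n)))"
    then obtain e where e: "z \<in> e" "e = closing n \<or> e \<in> set (links n)" by auto
    then have "e \<in> E" using necklacesD(3,6)[OF ns] n forest_edges by blast
    then have "e = {x, y}" using multigraph_edge_eq[OF multigraph _ _ e(1) that] c(1) by blast
    then show False using e(2) c necklacesD(3)[OF ns] n by blast
  qed
  then have "x \<in> set (map leg n)" "y \<in> set (map leg n)"
    using k l unfolding Union_links_closing[OF ne] by (auto simp: corner_vertex_def)
  then have "x \<in> set (collapsed_vertex (tree_of n))" "y \<in> set (collapsed_vertex (tree_of n))"
    using collapsed_vertex_necklace[OF ns n] by auto
  moreover have "{x, y} \<in> E - set fs - (\<lambda>(vs, es, c). c) ` set (map tree_of ns)"
    using c by (auto simp: tree_of_def)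
  ultimately show ?thesis
    using odd_graph_class_loop[OF _ c(3), of _ "collapsed_vertex (tree_of n)"] n
    by (simp add: trace_value_def collapse_def)
qed

lemma trace_value_eq:
  assumes "trace_data (V, E, fs) ts" "trace_data (V, E, fs) ts'"
  shows "trace_value (V, E, fs) ts = trace_value (V, E, fs) ts'"
proof -
  obtain ns where ns: "necklaces V E (set fs) ns" "ts = map tree_of ns"
    using assms(1) by (rule trace_data_corners)
  obtain ms where ms: "necklaces V E (set fs) ms" "ts' = map tree_of ms"
    using assms(2) by (rule trace_data_corners)
  show ?thesis
  proof (cases "\<forall>t\<in>set ts. t \<in> set ts' \<or> reverse_tree t \<in> set ts'")
    case True
    \<comment> \<open>Directs every tree of \<open>ts\<close> as it appears in \<open>ts'\<close>.
      The resulting list then differs from \<open>ts'\<close> only in its order.\<close>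
    define g where "g t = (if t \<in> set ts' then t else reverse_tree t)" for t
    have g: "trace_data (V, E, fs) (map g ts)" "trace_value (V, E, fs) (map g ts) = trace_value (V, E, fs) ts"
      using trace_value_reverse_some[of "[]" ts g] assms(1) by (auto simp: g_def)
    have sub: "set (map g ts) \<subseteq> set ts'" using True by (auto simp: g_def)
    \<comment> \<open>The trees of either list cover all vertices, and distinct trees of
      \<open>ts'\<close> are disjoint; hence the inclusion just shown is an equality.\<close>
    moreover have "t \<in> set (map g ts)" if "t \<in> set ts'" for t
    proof -
      obtain vs es c where t: "t = (vs, es, c)" by (cases t)
      have "vs \<noteq> []" "set vs \<subseteq> V"
        using assms(2) that by (auto simp: trace_data_def closed_linear_tree_def t)
      then obtain v where v: "v \<in> set vs" "v \<in> V" by (cases vs) auto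
      then obtain t' where t': "t' \<in> set (map g ts)" "v \<in> set (fst t')"
        using g(1) by (fastforce simp: trace_data_def)
      then have "t' \<in> set ts'" using sub by blast
      obtain m where m: "m \<in> set ms" "t = tree_of m" using \<open>t \<in> set ts'\<close> ms(2) by auto
      obtain m' where m': "m' \<in> set ms" "t' = tree_of m'" using \<open>t' \<in> set ts'\<close> ms(2) by auto
      obtain k where k: "k \<in> set m" "corner_vertex k = v" using v(1) t m by (auto simp: tree_of_def)
      obtain l where l: "l \<in> set m'" "corner_vertex l = v" using t' m' by (auto simp: tree_of_def)
      have "entry k \<in> corner_vertex k" by (simp add: corner_vertex_def)
      then have "m = m'" using necklaces_same(1)[OF ms(1) m(1) m'(1) k(1) l(1)] k(2) l(2) by blast
      then show ?thesis using t' m m' by simp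
    qed
    ultimately have "set (map g ts) = set ts'" by blast
    then have "mset (map g ts) = mset ts'"
      using trace_data_distinct(3)[OF g(1)] trace_data_distinct(3)[OF assms(2)]
      by (metis set_eq_iff_mset_eq_distinct)
    from trace_value_permute[OF assms(2) this] show ?thesis using g(2) by simp
  next
    case False
    then obtain n where n: "n \<in> set ns" and nn: "tree_of n \<notin> set ts'" "reverse_tree (tree_of n) \<notin> set ts'"
      by (auto simp: ns(2))
    obtain m where m: "m \<in> set ms" and nm: "map corner_vertex n = map corner_vertex m \<and> links n = links m \<or>
        map corner_vertex n = rev (map corner_vertex m) \<and> links n = rev (links m)"
      using necklaces_paths_unique[OF multigraph forest_edges ns(1) ms(1) n] by blast
    have "tree_of m \<in> set ts'" using m ms(2) by auto
    then have ne: "closing n \<noteq> closing m" using nm nn by (auto simp: tree_of_def)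
    have set_eq: "set (map corner_vertex n) = set (map corner_vertex m)" using nm by (metis set_rev)
    \<comment> \<open>The closing edge of one choice joins two vertices of the same tree for the
      other choice, without being a closing edge there. The claim is stated for general
      \<open>ps\<close>, \<open>qs\<close> because it is used in both directions.\<close>
    have loop: "trace_value (V, E, fs) (map tree_of ps) = 0"
      if p: "necklaces V E (set fs) ps" "p \<in> set ps" and q: "necklaces V E (set fs) qs" "q \<in> set qs"
        and eq: "set (map corner_vertex p) = set (map corner_vertex q)" and cl: "closing p \<noteq> closing q"
      for ps p qs q
    proof -
      have q0: "q \<noteq> []" "closing q \<in> E - set fs" using necklacesD(5,6)[OF q(1)] q(2) by auto
      have h: "last q \<in> set q" "hd q \<in> set q" using q0 by auto
      obtain k where k: "k \<in> set p" "corner_vertex k = corner_vertex (last q)"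
        using eq h by (metis (no_types, lifting) imageE imageI list.set_map)
      obtain l where l: "l \<in> set p" "corner_vertex l = corner_vertex (hd q)"
        using eq h by (metis (no_types, lifting) imageE imageI list.set_map)
      have "closing q \<notin> closing ` set ps"
      proof
        assume "closing q \<in> closing ` set ps"
        then obtain r where r: "r \<in> set ps" "closing r = closing q" by auto
        have "r \<noteq> []" by (rule necklacesD(5)[OF p(1) r(1)])
        have "exit (last q) \<in> closing q" by (simp add: closing_def)
        then have "exit (last q) \<in> closing r" by (simp only: r)
        then obtain j where j: "j \<in> set r" "exit (last q) \<in> corner_vertex j"
          using last_in_set[OF \<open>r \<noteq> []\<close>] hd_in_set[OF \<open>r \<noteq> []\<close>]
          unfolding closing_def corner_vertex_def by blast
        have "r = p" by (rule necklaces_same(1)[OF p(1) r(1) p(2) j(1) k(1) j(2)])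
          (unfold k(2), simp add: corner_vertex_def)
        then show False using r cl by simp
      qed
      moreover have "exit (last q) \<noteq> entry (hd q)"
        using corner_halfedges(4)[OF necklacesD(1)[OF q(1)], of "last q" "hd q"] h q(2) by auto
      moreover have "exit (last q) \<in> corner_vertex k"
        unfolding k(2) by (simp add: corner_vertex_def)
      moreover have "entry (hd q) \<in> corner_vertex l"
        unfolding l(2) by (simp add: corner_vertex_def)
      ultimately show ?thesis
        using trace_value_loop[OF p(1,2) _ _ _ k(1) _ l(1)] q0(2) unfolding closing_def by blast
    qed
    have "trace_value (V, E, fs) ts = 0"
      unfolding ns(2) by (rule loop[OF ns(1) n ms(1) m set_eq ne])
    moreover have "trace_value (V, E, fs) ts' = 0"
      unfolding ms(2) by (rule loop[OF ms(1) m ns(1) n set_eq[symmetric] ne[symmetric]])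
    ultimately show ?thesis by simp
  qed
qed

lemma trace_of_eq:
  assumes "trace_data (V, E, fs) ts"
  shows "trace_of (V, E, fs) = trace_value (V, E, fs) ts"
proof -
  have "trace_data (V, E, fs) (SOME ts. trace_data (V, E, fs) ts)" using assms by (rule someI)
  from trace_value_eq[OF this assms] show ?thesis using assms by (auto simp: trace_of_def)
qed

end


section \<open>Collapsing preserves connectivity and separating edges\<close>

definition adjacent :: "halfedges set \<Rightarrow> halfedges set \<Rightarrow> (halfedges \<times> halfedges) set" where
  "adjacent V D = {(x, y). x \<in> V \<and> y \<in> V \<and> (\<exists>e\<in>D. joins e x y)}"

lemma connected_graph_adjacent:
  "connected_graph V D \<longleftrightarrow> V \<noteq> {} \<and> (\<forall>v\<in>V. \<forall>w\<in>V. (v, w) \<in> (adjacent V D)\<^sup>*)"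
  by (simp add: connected_graph_def adjacent_def)

lemma sym_adjacent: "(v, w) \<in> (adjacent V D)\<^sup>* \<Longrightarrow> (w, v) \<in> (adjacent V D)\<^sup>*"
proof -
  have "sym (adjacent V D)" unfolding sym_def adjacent_def using joins_commute by blast
  then show "(v, w) \<in> (adjacent V D)\<^sup>* \<Longrightarrow> (w, v) \<in> (adjacent V D)\<^sup>*"
    by (meson sym_rtrancl symD)
qed

text \<open>A step may go to no step at all; this happens to edges of a cycle that is
  collapsed.\<close>

lemma rtrancl_lift:
  assumes "(x, y) \<in> R\<^sup>*" "\<And>x y. (x, y) \<in> R \<Longrightarrow> (f x, f y) \<in> S\<^sup>*"
  shows "(f x, f y) \<in> S\<^sup>*"
  using assms(1) by induction (auto intro: rtrancl_trans assms(2))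

lemma links_split:
  assumes "e \<in> set (links n)"
  shows "\<exists>l r. n = l @ r \<and> l \<noteq> [] \<and> r \<noteq> [] \<and> e = {exit (last l), entry (hd r)}"
  using assms
proof (induction n rule: links.induct)
  case (1 k j n)
  show ?case
  proof (cases "e = {exit k, entry j}")
    case True
    then show ?thesis by (intro exI[of _ "[k]"] exI[of _ "j # n"]) auto
  next
    case False
    then obtain l r where "j # n = l @ r" "l \<noteq> []" "r \<noteq> []" "e = {exit (last l), entry (hd r)}"
      using 1 by auto
    then show ?thesis by (intro exI[of _ "k # l"] exI[of _ r]) auto
  qed
qed auto

lemma links_connected:
  assumes "distinct (concat (map corner_list n))" "corner_vertex ` set n \<subseteq> V" "set (links n) \<subseteq> D"
    "k \<in> set n" "l \<in> set n"
  shows "(corner_vertex k, corner_vertex l) \<in> (adjacent V D)\<^sup>*"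
proof -
  have hd: "(corner_vertex (hd n), corner_vertex k) \<in> (adjacent V D)\<^sup>*" if "k \<in> set n" for k
    using assms(1-3) that
  proof (induction n rule: links.induct)
    case (1 i j n)
    have "exit i \<noteq> entry j" using corner_halfedges(4)[OF 1(2), of i j] by simp
    then have "joins {exit i, entry j} (corner_vertex i) (corner_vertex j)"
      unfolding joins_def corner_vertex_def by blast
    then have "(corner_vertex i, corner_vertex j) \<in> adjacent V D"
      using 1(3,4) by (auto simp: adjacent_def)
    moreover have "(corner_vertex j, corner_vertex k) \<in> (adjacent V D)\<^sup>*" if "k \<in> set (j # n)"
      using 1(1)[OF _ _ _ that] 1(2-4) by auto
    ultimately show ?case using 1(5) by (auto intro: converse_rtrancl_into_rtrancl)
  qed auto
  show ?thesis using sym_adjacent[OF hd[OF assms(4)]] hd[OF assms(5)] by (rule rtrancl_trans)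
qed

lemma connected_graph_remove_edge:
  assumes "connected_graph V E"
    and "\<And>v w. joins e v w \<Longrightarrow> v \<in> V \<Longrightarrow> w \<in> V \<Longrightarrow> (v, w) \<in> (adjacent V (E - {e}))\<^sup>*"
  shows "connected_graph V (E - {e})"
proof -
  have "(x, y) \<in> (adjacent V (E - {e}))\<^sup>*" if "(x, y) \<in> adjacent V E" for x y
    using that assms(2) by (cases "joins e x y") (auto simp: adjacent_def)
  then show ?thesis using assms(1) rtrancl_lift[of _ _ "adjacent V E" "\<lambda>x. x"]
    unfolding connected_graph_adjacent by blast
qed

context trivalent
begin

lemma necklace_distinct:
  assumes "necklaces V E F ns" "n \<in> set ns"
  shows "distinct (concat (map corner_list n))"
proof -
  obtain xs ys where "ns = xs @ n # ys" using assms(2) by (meson split_list)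
  then show ?thesis using necklacesD(1)[OF assms(1)] by simp
qed

lemma necklace_links:
  assumes "necklaces V E F ns" "n \<in> set ns"
  shows "set (links n) \<subseteq> F" "corner_vertex ` set n \<subseteq> V" "closing n \<notin> set (links n)"
  using necklacesD(2,3,6)[OF assms(1)] assms(2) by (blast, force, blast)

text \<open>The cycle is rotated so that \<open>e\<close> becomes its closing edge; the remaining
  path then connects the ends of \<open>e\<close> without using \<open>e\<close>.\<close>

lemma necklace_cycle_edge:
  assumes ns: "necklaces V E (set fs) ns" and e: "e \<in> set fs \<union> closing ` set ns"
    and conn: "connected_graph V E"
  shows "connected_graph V (E - {e})"
proof -
  obtain n m where n: "n \<in> set ns" and m: "m \<noteq> []" "set m = set n" "closing m = e"
      "set (links m) \<subseteq> E - {e}" "distinct (concat (map corner_list m))"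
  proof (cases "e \<in> closing ` set ns")
    case True
    then obtain n where n: "n \<in> set ns" "closing n = e" by auto
    show ?thesis
      by (rule that[OF n(1) _ _ n(2)])
        (use necklacesD(5)[OF ns n(1)] necklace_links[OF ns n(1)] necklace_distinct[OF ns n(1)] n forest_edges in auto)
  next
    case False
    then obtain n where n: "n \<in> set ns" "e \<in> set (links n)" using e necklacesD(3)[OF ns] by blast
    obtain l r where lr: "n = l @ r" "l \<noteq> []" "r \<noteq> []" "e = {exit (last l), entry (hd r)}"
      using links_split[OF n(2)] by blast
    have ln: "links n = links l @ e # links r" using lr by (simp add: links_append)
    have c: "closing n = {exit (last r), entry (hd l)}" using lr by (simp add: closing_def)
    have lm: "links (r @ l) = links r @ closing n # links l"
      using lr(2,3) c by (simp add: links_append)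
    have "distinct (links n)" by (rule distinct_links[OF necklace_distinct[OF ns n(1)]])
    moreover have "e \<noteq> closing n" using n(2) necklace_links(3)[OF ns n(1)] by auto
    moreover have "closing n \<in> E" using necklacesD(6)[OF ns n(1)] by simp
    moreover have "set (links n) \<subseteq> E" using necklace_links(1)[OF ns n(1)] forest_edges by blast
    ultimately have "set (links (r @ l)) \<subseteq> E - {e}" unfolding lm ln by auto
    moreover have "closing (r @ l) = e" using lr by (simp add: closing_def)
    moreover have "distinct (concat (map corner_list (r @ l)))"
      using necklace_distinct[OF ns n(1)] by (auto simp: lr)
    ultimately show ?thesis using that[OF n(1), of "r @ l"] lr by auto
  qed
  have "(v, w) \<in> (adjacent V (E - {e}))\<^sup>*" if j: "joins e v w" "v \<in> V" "w \<in> V" for v w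
  proof -
    have "\<exists>k\<in>set m. v = corner_vertex k" if v: "v \<in> V" "v \<inter> e \<noteq> {}" for v
    proof -
      obtain k where k: "k \<in> set m" "corner_vertex k \<inter> v \<noteq> {}"
        using v(2) last_in_set[OF m(1)] hd_in_set[OF m(1)]
        unfolding m(3)[symmetric] closing_def corner_vertex_def by blast
      moreover have "corner_vertex k \<in> V" using k(1) m(2) necklace_links(2)[OF ns n] by auto
      ultimately show ?thesis using multigraph_vertex_eq[OF multigraph, of "corner_vertex k" v] v(1) by blast
    qed
    then obtain k l where "k \<in> set m" "v = corner_vertex k" "l \<in> set m" "w = corner_vertex l"
      using j unfolding joins_def by blast
    then show ?thesis using links_connected[OF m(5) _ m(4), of V k l] m(2) necklace_links(2)[OF ns n] by simp
  qed
  then show ?thesis by (rule connected_graph_remove_edge[OF conn])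
qed

lemma core_halfedges:
  assumes "necklaces V E (set fs) ns" "k \<in> set (concat ns)"
  shows "entry k \<in> \<Union>(set fs \<union> closing ` set ns)" "exit k \<in> \<Union>(set fs \<union> closing ` set ns)"
    "leg k \<notin> \<Union>(set fs \<union> closing ` set ns)"
proof -
  obtain n where n: "n \<in> set ns" "k \<in> set n" using assms(2) by auto
  have "{entry k, exit k} \<subseteq> \<Union>(insert (closing n) (set (links n)))"
    using Union_links_closing[OF necklacesD(5)[OF assms(1) n(1)]] n(2) by auto
  also have "\<dots> \<subseteq> \<Union>(set fs \<union> closing ` set ns)"
    using necklace_links(1)[OF assms(1) n(1)] n(1) by auto
  finally show "entry k \<in> \<Union>(set fs \<union> closing ` set ns)" "exit k \<in> \<Union>(set fs \<union> closing ` set ns)" by auto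
  show "leg k \<notin> \<Union>(set fs \<union> closing ` set ns)"
  proof
    assume "leg k \<in> \<Union>(set fs \<union> closing ` set ns)"
    then obtain m where m: "m \<in> set ns" "leg k \<in> \<Union>(insert (closing m) (set (links m)))"
      using necklacesD(3)[OF assms(1)] by blast
    then have "leg k \<in> entry ` set m \<union> exit ` set m"
      by (simp only: Union_links_closing[OF necklacesD(5)[OF assms(1) m(1)]])
    then obtain l where "l \<in> set m" "leg k = entry l \<or> leg k = exit l" by auto
    then show False using corner_halfedges(5,6)[OF necklacesD(1)[OF assms(1)] assms(2), of l] m(1) by auto
  qed
qed

lemma collapse_necklaces:
  assumes "necklaces V E (set fs) ns"
  shows "collapse (V, E, fs) (map tree_of ns) = (map leg ` set ns, E - (set fs \<union> closing ` set ns))"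
proof -
  have "collapsed_vertex ` tree_of ` set ns = map leg ` set ns"
    unfolding image_image using collapsed_vertex_necklace[OF assms] by (rule image_cong[OF refl])
  moreover have "(\<lambda>(vs, es, c). c) ` tree_of ` set ns = closing ` set ns"
    by (simp add: image_image tree_of_def)
  ultimately show ?thesis by (simp add: collapse_def Diff_eq inf_assoc)
qed

lemma collapsed_edge:
  assumes "necklaces V E (set fs) ns" "e \<in> E - (set fs \<union> closing ` set ns)" "x \<in> e"
  shows "\<exists>n\<in>set ns. \<exists>k\<in>set n. x = leg k"
proof -
  have "x \<in> \<Union>V" using multigraph assms(2,3) unfolding multigraph_def partition_on_def by blast
  then obtain k where k: "k \<in> set (concat ns)" "x \<in> corner_vertex k"
    using necklacesD(2)[OF assms(1)] by auto
  have "x \<notin> \<Union>(set fs \<union> closing ` set ns)"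
  proof
    assume "x \<in> \<Union>(set fs \<union> closing ` set ns)"
    then obtain e' where "x \<in> e'" "e' \<in> set fs \<union> closing ` set ns" by blast
    moreover have "e' \<in> E" using calculation(2) forest_edges necklacesD(6)[OF assms(1)] by blast
    ultimately show False using multigraph_edge_eq[OF multigraph, of e e' x] assms(2,3) by blast
  qed
  then have "x = leg k" using core_halfedges[OF assms(1) k(1)] k(2) by (auto simp: corner_vertex_def)
  then show ?thesis using k(1) by auto
qed

lemma collapsed_multigraph:
  assumes ns: "necklaces V E (set fs) ns"
  shows "multigraph (set ` map leg ` set ns) (E - (set fs \<union> closing ` set ns))"
proof -
  let ?L = "set ` map leg ` set ns" and ?E = "E - (set fs \<union> closing ` set ns)"
  have finite: "finite (\<Union>?L)" by auto
  have "\<Union>?E = \<Union>?L"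
  proof
    show "\<Union>?E \<subseteq> \<Union>?L" using collapsed_edge[OF ns] by fastforce
    show "\<Union>?L \<subseteq> \<Union>?E"
    proof
      fix x assume "x \<in> \<Union>?L"
      then obtain n k where k: "n \<in> set ns" "k \<in> set n" "x = leg k" by auto
      then have "corner_vertex k \<in> V" "x \<in> corner_vertex k"
        using necklace_links(2)[OF ns k(1)] by (auto simp: corner_vertex_def[of k])
      then have "x \<in> \<Union>V" by blast
      then obtain e where e: "e \<in> E" "x \<in> e"
        using multigraph unfolding multigraph_def partition_on_def by blast
      moreover have "e \<notin> set fs \<union> closing ` set ns"
        using core_halfedges(3)[OF ns, of k] k e(2) by auto
      ultimately show "x \<in> \<Union>?E" by blast
    qed
  qed
  moreover have "disjoint E" "{} \<notin> E" using multigraph unfolding multigraph_def partition_on_def by auto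
  then have "disjoint ?E" "{} \<notin> ?E" by (auto simp: disjoint_def)
  ultimately have "partition_on (\<Union>?L) ?E" by (simp add: partition_on_def)
  moreover have "partition_on (\<Union>?L) ?L"
  proof (rule partition_onI)
    show "{} \<notin> ?L" using necklacesD(5)[OF ns] by auto
    fix a b assume ab: "a \<in> ?L" "b \<in> ?L" "a \<noteq> b"
    obtain n where n: "n \<in> set ns" "a = leg ` set n" using ab(1) by auto
    obtain m where m: "m \<in> set ns" "b = leg ` set m" using ab(2) by auto
    have nm: "n \<in> set ns" "m \<in> set ns" "a = leg ` set n" "b = leg ` set m" "n \<noteq> m"
      using n m ab(3) by auto
    show "disjnt a b" unfolding disjnt_iff nm(3,4)
    proof (intro allI notI)
      fix x assume "x \<in> leg ` set n \<and> x \<in> leg ` set m"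
      then obtain k l where "k \<in> set n" "l \<in> set m" "x = leg k" "x = leg l" by auto
      then show False using necklaces_same(1)[OF ns nm(1,2), of k l x] nm(5) by (simp add: corner_vertex_def)
    qed
  qed simp
  ultimately show ?thesis using multigraph finite by (simp add: multigraph_def)
qed

text \<open>The function \<open>\<tau>\<close> is the quotient map that sends each vertex to its
  tree.\<close>

lemma necklace_of_vertex:
  assumes "necklaces V E (set fs) ns"
  obtains \<tau> where "\<And>v. v \<in> V \<Longrightarrow> \<tau> v \<in> set ns \<and> v \<in> corner_vertex ` set (\<tau> v)"
    "\<And>n k. n \<in> set ns \<Longrightarrow> k \<in> set n \<Longrightarrow> \<tau> (corner_vertex k) = n"
proof -
  have "\<forall>v\<in>V. \<exists>n. n \<in> set ns \<and> v \<in> corner_vertex ` set n"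
    using necklacesD(2)[OF assms] by fastforce
  then obtain \<tau> where \<tau>: "\<And>v. v \<in> V \<Longrightarrow> \<tau> v \<in> set ns \<and> v \<in> corner_vertex ` set (\<tau> v)" by metis
  moreover have "\<tau> (corner_vertex k) = n" if "n \<in> set ns" "k \<in> set n" for n k
  proof -
    have "corner_vertex k \<in> V" using necklace_links(2)[OF assms that(1)] that(2) by auto
    from \<tau>[OF this] obtain l where l: "\<tau> (corner_vertex k) \<in> set ns" "l \<in> set (\<tau> (corner_vertex k))"
        "corner_vertex k = corner_vertex l" by auto
    have "entry k \<in> corner_vertex k" by (simp add: corner_vertex_def)
    then show ?thesis using necklaces_same(1)[OF assms l(1) that(1) l(2) that(2)] l(3) by metis
  qed
  ultimately show ?thesis by (rule that)
qed

lemma links_same_necklace: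
  assumes ns: "necklaces V E (set fs) ns" and e: "e \<in> set fs \<union> closing ` set ns" "joins e v w"
    and vw: "v \<in> V" "w \<in> V" and n: "n \<in> set ns" "v \<in> corner_vertex ` set n"
  shows "w \<in> corner_vertex ` set n"
proof -
  obtain m where m: "m \<in> set ns" "e \<in> insert (closing m) (set (links m))"
    using e(1) necklacesD(3)[OF ns] by blast
  have *: "x \<in> corner_vertex ` set m" if x: "x \<in> V" "h \<in> x" "h \<in> e" for x h
  proof -
    have "h \<in> entry ` set m \<union> exit ` set m"
      using x(3) m(2) Union_links_closing[OF necklacesD(5)[OF ns m(1)]] by blast
    then obtain k where k: "k \<in> set m" "h \<in> corner_vertex k" by (auto simp: corner_vertex_def)
    then have "x = corner_vertex k"
      using multigraph_vertex_eq[OF multigraph x(1) _ x(2)] necklace_links(2)[OF ns m(1)] by blast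
    then show ?thesis using k(1) by blast
  qed
  have v: "v \<in> corner_vertex ` set m" and w: "w \<in> corner_vertex ` set m"
    using * vw e(2) unfolding joins_def by blast+
  obtain k l where kl: "k \<in> set n" "l \<in> set m" "corner_vertex k = v" "corner_vertex l = v"
    using v n(2) by auto
  have "entry k \<in> corner_vertex k" by (simp add: corner_vertex_def)
  then have "n = m" using necklaces_same(1)[OF ns n(1) m(1) kl(1,2)] kl(3,4) by metis
  then show ?thesis using w by simp
qed

text \<open>The quotient map carries walks to walks: edges of the cycles become stationary, and
  every other edge survives between the images of its ends.\<close>

lemma collapsed_connected:
  assumes ns: "necklaces V E (set fs) ns" and conn: "connected_graph V E"
  shows "connected_graph (set ` map leg ` set ns) (E - (set fs \<union> closing ` set ns))"
proof -
  let ?L = "set ` map leg ` set ns" and ?E = "E - (set fs \<union> closing ` set ns)"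
  obtain \<tau> where \<tau>: "\<And>v. v \<in> V \<Longrightarrow> \<tau> v \<in> set ns \<and> v \<in> corner_vertex ` set (\<tau> v)"
    "\<And>n k. n \<in> set ns \<Longrightarrow> k \<in> set n \<Longrightarrow> \<tau> (corner_vertex k) = n"
    by (rule necklace_of_vertex[OF ns]) (rule that, blast+)
  let ?f = "\<lambda>v. set (map leg (\<tau> v))"
  have "(?f x, ?f y) \<in> (adjacent ?L ?E)\<^sup>*" if xy: "(x, y) \<in> adjacent V E" for x y
  proof -
    obtain e where e: "x \<in> V" "y \<in> V" "e \<in> E" "joins e x y" using xy by (auto simp: adjacent_def)
    show ?thesis
    proof (cases "e \<in> set fs \<union> closing ` set ns")
      case True
      have "y \<in> corner_vertex ` set (\<tau> x)"
        by (rule links_same_necklace[OF ns True e(4,1,2)]) (use \<tau>(1)[OF e(1)] in auto)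
      then have "\<tau> y = \<tau> x" using \<tau>(2) \<tau>(1)[OF e(1)] by auto
      then show ?thesis by simp
    next
      case False
      then have e': "e \<in> ?E" using e(3) by simp
      have *: "h \<in> ?f v" if h: "v \<in> V" "h \<in> v" "h \<in> e" for v h
      proof -
        obtain n k where k: "n \<in> set ns" "k \<in> set n" "h = leg k" using collapsed_edge[OF ns e' h(3)] by auto
        have "corner_vertex k \<in> V" using necklace_links(2)[OF ns k(1)] k(2) by auto
        then have "v = corner_vertex k" using multigraph_vertex_eq[OF multigraph h(1) _ h(2)] k(3)
          by (simp add: corner_vertex_def)
        then have "\<tau> v = n" using \<tau>(2) k by simp
        then show ?thesis using k by simp
      qed
      obtain a b where "a \<in> x" "b \<in> y" "a \<noteq> b" "e = {a, b}" using e(4) by (auto simp: joins_def)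
      then have "joins e (?f x) (?f y)" using * e(1,2) unfolding joins_def by blast
      moreover have "?f x \<in> ?L" "?f y \<in> ?L" using \<tau>(1)[OF e(1)] \<tau>(1)[OF e(2)] by blast+
      ultimately show ?thesis using e' unfolding adjacent_def by blast
    qed
  qed
  note lift = rtrancl_lift[where f = ?f and R = "adjacent V E", OF _ this]
  have surj: "\<exists>v\<in>V. a = ?f v" if a: "a \<in> ?L" for a
  proof -
    obtain n where n: "n \<in> set ns" "a = set (map leg n)" using a by auto
    have "hd n \<in> set n" using necklacesD(5)[OF ns n(1)] by simp
    then have "corner_vertex (hd n) \<in> V" "\<tau> (corner_vertex (hd n)) = n"
      using \<tau>(2) n(1) necklace_links(2)[OF ns n(1)] by auto
    then show ?thesis using n(2) by metis
  qed
  have "(a, b) \<in> (adjacent ?L ?E)\<^sup>*" if ab: "a \<in> ?L" "b \<in> ?L" for a b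
  proof -
    obtain v w where "v \<in> V" "w \<in> V" "a = ?f v" "b = ?f w" using surj ab by meson
    then show ?thesis using lift conn unfolding connected_graph_adjacent by blast
  qed
  moreover have "?L \<noteq> {}"
  proof -
    obtain v where "v \<in> V" using conn unfolding connected_graph_adjacent by blast
    then have "\<tau> v \<in> set ns" using \<tau>(1) by blast
    then show ?thesis by auto
  qed
  ultimately show ?thesis unfolding connected_graph_adjacent by blast
qed

text \<open>This provides the graph \<open>Y\<close> demanded by the rule \<open>collapsing\<close>,
  so that the prescription has a value whenever trace data exist.\<close>

lemma oriented_collapse:
  assumes td: "trace_data (V, E, fs) ts" and conn: "connected_graph V E"
  shows "oriented_odd_graph (collapse (V, E, fs) ts)"
proof -
  obtain ns where ns: "necklaces V E (set fs) ns" "ts = map tree_of ns"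
    using td by (rule trace_data_corners)
  have "inj_on set (map leg ` set ns)"
    using necklace_legs(2)[OF ns(1)] by (fastforce simp: inj_on_def)
  moreover have "\<forall>l\<in>map leg ` set ns. distinct l \<and> odd (length l)"
    using necklace_legs(1)[OF ns(1)] necklacesD(4)[OF ns(1)] by auto
  ultimately show ?thesis
    using collapsed_multigraph[OF ns(1)] collapsed_connected[OF ns(1) conn]
    unfolding ns(2) collapse_necklaces[OF ns(1)] oriented_odd_graph_def by simp
qed

text \<open>A separating edge lies on no cycle, so it is an edge of the collapsed graph. It
  separates there too: a walk avoiding it in the collapsed graph lifts to the original one, with
  detours along the trees.\<close>

lemma trace_of_separating:
  assumes sep: "separating_edge V E e" and conn: "connected_graph V E"
  shows "trace_of (V, E, fs) = 0"
proof (cases "\<exists>ts. trace_data (V, E, fs) ts")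
  case True
  then obtain ts where td: "trace_data (V, E, fs) ts" by blast
  obtain ns where ns: "necklaces V E (set fs) ns" "ts = map tree_of ns"
    using td by (rule trace_data_corners)
  let ?L = "set ` map leg ` set ns" and ?E = "E - (set fs \<union> closing ` set ns)"
  have e: "e \<in> ?E" "\<not> connected_graph V (E - {e})"
    using sep necklace_cycle_edge[OF ns(1) _ conn] unfolding separating_edge_def by blast+
  have "\<not> connected_graph ?L (?E - {e})"
  proof
    assume conn': "connected_graph ?L (?E - {e})"
    let ?A = "(adjacent V (E - {e}))\<^sup>*"
    have inner: "(corner_vertex k, corner_vertex l) \<in> ?A" if "n \<in> set ns" "k \<in> set n" "l \<in> set n" for n k l
      by (rule links_connected[OF necklace_distinct[OF ns(1) that(1)] _ _ that(2,3)])
        (use necklace_links[OF ns(1) that(1)] forest_edges e(1) in auto)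
    \<comment> \<open>A vertex of the collapsed graph stands for a whole tree, so the lifted
      statement has to hold for all corners \<open>k\<close>, \<open>l\<close> of the two
      trees.\<close>
    have outer: "\<forall>n\<in>set ns. \<forall>m\<in>set ns. \<forall>k\<in>set n. \<forall>l\<in>set m.
        a = set (map leg n) \<longrightarrow> b = set (map leg m) \<longrightarrow> (corner_vertex k, corner_vertex l) \<in> ?A"
      if "(a, b) \<in> (adjacent ?L (?E - {e}))\<^sup>*" for a b
      using that
    proof induction
      case base
      show ?case
      proof (intro ballI impI)
        fix n m k l assume *: "n \<in> set ns" "m \<in> set ns" "k \<in> set n" "l \<in> set m"
          "a = set (map leg n)" "a = set (map leg m)"
        then have "m = n" using necklace_legs(2)[OF ns(1), of n m] by metis
        then show "(corner_vertex k, corner_vertex l) \<in> ?A" using inner * by metis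
      qed
    next
      case (step b c)
      show ?case
      proof (intro ballI impI)
        fix n m k l assume *: "n \<in> set ns" "m \<in> set ns" "k \<in> set n" "l \<in> set m"
          "a = set (map leg n)" "c = set (map leg m)"
        obtain e' x y where e': "e' \<in> ?E - {e}" "b \<in> ?L" "x \<in> b" "y \<in> c" "x \<noteq> y" "e' = {x, y}"
          using step(2) by (auto simp: adjacent_def joins_def)
        obtain p where p: "p \<in> set ns" "b = set (map leg p)" using e'(2) by auto
        obtain i j where i: "i \<in> set p" "x = leg i" and j: "j \<in> set m" "y = leg j"
          using e'(3,4) p(2) *(6) by auto
        have "joins e' (corner_vertex i) (corner_vertex j)"
          using e'(5,6) i(2) j(2) unfolding joins_def corner_vertex_def by blast
        moreover have "corner_vertex i \<in> V" "corner_vertex j \<in> V"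
          using necklace_links(2)[OF ns(1)] p(1) i(1) *(2) j(1) by blast+
        ultimately have "(corner_vertex i, corner_vertex j) \<in> adjacent V (E - {e})"
          using e'(1) unfolding adjacent_def by blast
        moreover have "(corner_vertex k, corner_vertex i) \<in> ?A"
          using step(3) *(1,3,5) p i(1) by blast
        moreover have "(corner_vertex j, corner_vertex l) \<in> ?A" using inner *(2,4) j(1) by blast
        ultimately show "(corner_vertex k, corner_vertex l) \<in> ?A" by (meson rtrancl.rtrancl_into_rtrancl rtrancl_trans)
      qed
    qed
    have "(v, w) \<in> ?A" if vw: "v \<in> V" "w \<in> V" for v w
    proof -
      obtain n k where k: "n \<in> set ns" "k \<in> set n" "v = corner_vertex k"
        using vw(1) necklacesD(2)[OF ns(1)] by auto
      obtain m l where l: "m \<in> set ns" "l \<in> set m" "w = corner_vertex l"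
        using vw(2) necklacesD(2)[OF ns(1)] by auto
      have "(set (map leg n), set (map leg m)) \<in> (adjacent ?L (?E - {e}))\<^sup>*"
        using conn' k(1) l(1) unfolding connected_graph_adjacent by blast
      from outer[OF this] show ?thesis using k l by blast
    qed
    then have "connected_graph V (E - {e})" using conn unfolding connected_graph_adjacent by blast
    then show False using e(2) by simp
  qed
  then have "separating_edge ?L ?E e" using e(1) by (simp add: separating_edge_def)
  from odd_graph_class_separating[OF this] show ?thesis
    unfolding trace_of_eq[OF td] trace_value_def prod.case ns(2) collapse_necklaces[OF ns(1)] by simp
qed (simp add: trace_of_def)

text \<open>Trace data and collapse see only the set of forest edges; the order enters through
  \<open>ordering_sign\<close> alone.\<close>

lemma trace_of_permute:
  assumes "p permutes {..<length fs}"
  shows "trace_of (V, E, permute_list p fs) = scale_odd (of_int (sign p)) (trace_of (V, E, fs))"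
proof -
  have s: "set (permute_list p fs) = set fs" using assms by simp
  have td: "trace_data (V, E, permute_list p fs) = trace_data (V, E, fs)"
    unfolding trace_data_def prod.case s ..
  interpret p: trivalent V E "permute_list p fs"
    using multigraph card_vertex distinct_forest forest_edges assms by unfold_locales simp_all
  show ?thesis
  proof (cases "\<exists>ts. trace_data (V, E, fs) ts")
    case True
    then obtain ts where ts: "trace_data (V, E, fs) ts" by blast
    have "collapse (V, E, permute_list p fs) ts = collapse (V, E, fs) ts" by (simp only: collapse_def prod.case s)
    then show ?thesis
      using p.trace_of_eq[of ts] trace_of_eq[OF ts] ts td
        ordering_sign_permute_left[OF trace_data_distinct(1)[OF ts] assms trace_data_distinct(2)[OF ts]]
      by (simp add: trace_value_def mult.assoc)
  qed (simp add: trace_of_def td)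
qed

end


section \<open>Isomorphisms\<close>

definition map_corner :: "(nat \<Rightarrow> nat) \<Rightarrow> corner \<Rightarrow> corner" where
  "map_corner f k = Corner (f (entry k)) (f (exit k)) (f (leg k))"

lemma map_corner_simps [simp]:
  "entry (map_corner f k) = f (entry k)" "exit (map_corner f k) = f (exit k)"
  "leg (map_corner f k) = f (leg k)" "corner_vertex (map_corner f k) = f ` corner_vertex k"
  "corner_list (map_corner f k) = map f (corner_list k)"
  by (auto simp: map_corner_def corner_vertex_def corner_list_def)

lemma links_map_corner: "links (map (map_corner f) n) = map (image f) (links n)"
  by (induction n rule: links.induct) auto

lemma closing_map_corner: "n \<noteq> [] \<Longrightarrow> closing (map (map_corner f) n) = f ` closing n"
  by (simp add: closing_def last_map hd_map)

lemma inj_on_image_edges: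
  assumes "multigraph V E" "inj_on f (\<Union>V)"
  shows "inj_on (image f) E"
proof (rule inj_onI)
  fix a b assume ab: "a \<in> E" "b \<in> E" "f ` a = f ` b"
  then have "a \<subseteq> \<Union>V" "b \<subseteq> \<Union>V"
    using assms(1) unfolding multigraph_def partition_on_def by auto
  then show "a = b" using inj_on_image_eq_iff[OF assms(2)] ab(3) by blast
qed

lemma necklaces_map:
  assumes mg: "multigraph V E" and "F \<subseteq> E" and inj: "inj_on f (\<Union>V)" and ns: "necklaces V E F ns"
  shows "necklaces (image f ` V) (image f ` E) (image f ` F) (map (map (map_corner f)) ns)"
proof -
  let ?g = "map (map_corner f)"
  have "concat (map corner_list (concat (map ?g ns))) = map f (concat (map corner_list (concat ns)))"
    by (simp add: map_concat comp_def)
  moreover have "set (concat (map corner_list (concat ns))) = \<Union>V"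
    using necklacesD(2)[OF ns] by auto
  ultimately have "distinct (concat (map corner_list (concat (map ?g ns))))"
    using necklacesD(1)[OF ns] inj by (simp only: distinct_map)
  moreover have "corner_vertex ` set (concat (map ?g ns)) = image f ` V"
  proof -
    have "corner_vertex ` set (concat (map ?g ns)) = image f ` corner_vertex ` set (concat ns)"
      by (force simp: image_iff)
    then show ?thesis using necklacesD(2)[OF ns] by simp
  qed
  moreover have "(\<Union>n\<in>set (map ?g ns). set (links n)) = image f ` F"
    unfolding necklacesD(3)[OF ns, symmetric] by (simp add: links_map_corner image_UN)
  moreover have "odd (length (?g n)) \<and> closing (?g n) \<in> image f ` E - image f ` F" if "n \<in> set ns" for n
  proof -
    have "closing n \<in> E - F" by (rule necklacesD(6)[OF ns that])
    then have "f ` closing n \<in> image f ` E - image f ` F"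
      using inj_on_image_edges[OF mg inj] \<open>F \<subseteq> E\<close> by (auto dest: inj_onD)
    then show ?thesis using necklacesD(4,5)[OF ns that] by (simp add: closing_map_corner)
  qed
  ultimately show ?thesis unfolding necklaces_def by auto
qed

lemma trace_data_map:
  assumes X: "trivalent V E fs" "connected_graph V E"
    and Y: "trivalent (image f ` V) (image f ` E) (map (image f) fs)"
      "connected_graph (image f ` V) (image f ` E)"
    and inj: "inj_on f (\<Union>V)" and td: "trace_data (V, E, fs) ts"
  shows "\<exists>us. trace_data (image f ` V, image f ` E, map (image f) fs) us \<and>
    trace_value (image f ` V, image f ` E, map (image f) fs) us = trace_value (V, E, fs) ts"
proof -
  interpret X: trivalent V E fs by (rule X)
  interpret Y: trivalent "image f ` V" "image f ` E" "map (image f) fs" by (rule Y)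
  obtain ns where ns: "necklaces V E (set fs) ns" "ts = map tree_of ns"
    using td by (rule X.trace_data_corners)
  let ?ms = "map (map (map_corner f)) ns"
  let ?F = "set fs \<union> closing ` set ns"
  have ms: "necklaces (image f ` V) (image f ` E) (set (map (image f) fs)) ?ms"
    using necklaces_map[OF X.multigraph X.forest_edges inj ns(1)] by simp
  note tdm = trace_data_necklaces[OF Y.multigraph ms]
  have injE: "inj_on (image f) E" by (rule inj_on_image_edges[OF X.multigraph inj])
  have F: "?F \<subseteq> E" using X.forest_edges necklacesD(6)[OF ns(1)] by auto
  have "(closing \<circ> map (map_corner f)) ` set ns = (image f \<circ> closing) ` set ns"
    using closing_map_corner necklacesD(5)[OF ns(1)] by (auto intro!: image_cong)
  then have "set (map (image f) fs) \<union> closing ` set ?ms = image f ` ?F"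
    by (simp add: image_Un image_comp)
  then have E: "image f ` E - (set (map (image f) fs) \<union> closing ` set ?ms) = image f ` (E - ?F)"
    using inj_on_image_set_diff[OF injE, of E ?F] F by simp
  have L: "map leg ` set ?ms = map f ` map leg ` set ns" by (simp add: image_image comp_def)
  have oX: "oriented_odd_graph (map leg ` set ns, E - ?F)"
    using X.oriented_collapse[OF td X(2)] by (simp add: ns(2) X.collapse_necklaces[OF ns(1)])
  have oY: "oriented_odd_graph (map f ` map leg ` set ns, image f ` (E - ?F))"
    using Y.oriented_collapse[OF tdm Y(2)] unfolding Y.collapse_necklaces[OF ms] E L .
  have "\<Union>(set ` map leg ` set ns) \<subseteq> \<Union>V"
    using necklacesD(2)[OF ns(1)] by (auto simp: corner_vertex_def)
  then have "inj_on f (\<Union>(set ` map leg ` set ns))" using inj by (rule inj_on_subset[rotated])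
  from odd_graph_class_isomorphic[OF oX oY this]
  have "odd_graph_class (collapse (image f ` V, image f ` E, map (image f) fs) (map tree_of ?ms)) =
      odd_graph_class (collapse (V, E, fs) ts)"
    unfolding Y.collapse_necklaces[OF ms] E L by (simp add: ns(2) X.collapse_necklaces[OF ns(1)])
  moreover have "concat (map (\<lambda>(vs, es, c). es) (map tree_of ?ms)) =
      map (image f) (concat (map (\<lambda>(vs, es, c). es) ts))"
    by (simp add: ns(2) tree_of_def links_map_corner map_concat comp_def)
  moreover have "ordering_sign (map (image f) fs) (map (image f) (concat (map (\<lambda>(vs, es, c). es) ts))) =
      ordering_sign fs (concat (map (\<lambda>(vs, es, c). es) ts))"
  proof (rule ordering_sign_map)
    have "set (concat (map (\<lambda>(vs, es, c). es) ts)) = set fs" using td by (simp add: trace_data_def)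
    then show "inj_on (image f) (set (concat (map (\<lambda>(vs, es, c). es) ts)))"
      using injE X.forest_edges by (metis inj_on_subset)
  qed (rule X.trace_data_distinct[OF td])+
  ultimately have "trace_value (image f ` V, image f ` E, map (image f) fs) (map tree_of ?ms) =
      trace_value (V, E, fs) ts"
    unfolding trace_value_def prod.case by (simp only: length_map ns(2))
  then show ?thesis using tdm by blast
qed

lemma trace_of_map:
  assumes X: "trivalent V E fs" "connected_graph V E"
    and Y: "trivalent (image f ` V) (image f ` E) (map (image f) fs)"
      "connected_graph (image f ` V) (image f ` E)"
    and inj: "inj_on f (\<Union>V)"
  shows "trace_of (image f ` V, image f ` E, map (image f) fs) = trace_of (V, E, fs)"
proof (cases "\<exists>ts. trace_data (V, E, fs) ts")
  case True
  then obtain ts where ts: "trace_data (V, E, fs) ts" by blast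
  from trace_data_map[OF X Y inj ts] show ?thesis
    using trivalent.trace_of_eq[OF X(1)] trivalent.trace_of_eq[OF Y(1)] ts by metis
next
  case False
  \<comment> \<open>The absence of trace data must be transported as well; this is the preceding
    lemma applied to the inverse isomorphism.\<close>
  let ?g = "the_inv_into (\<Union>V) f"
  have gf: "?g ` f ` v = v" if "v \<subseteq> \<Union>V" for v
  proof -
    have "?g ` f ` v = id ` v"
      unfolding image_image by (rule image_cong) (use that the_inv_into_f_f[OF inj] in auto)
    then show ?thesis by simp
  qed
  have "e \<subseteq> \<Union>V" if "e \<in> E" for e
    using trivalent.multigraph[OF X(1)] that unfolding multigraph_def partition_on_def by auto
  then have E: "?g ` f ` e = e" if "e \<in> E" for e using gf that by simp
  have im: "image ?g ` image f ` A = A" if A: "\<And>v. v \<in> A \<Longrightarrow> ?g ` f ` v = v" for A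
  proof -
    have "(\<lambda>v. ?g ` f ` v) ` A = (\<lambda>v. v) ` A" by (rule image_cong[OF refl]) (rule A)
    then show ?thesis by (simp only: image_image[of "image ?g" "image f"] image_ident)
  qed
  have gV: "image ?g ` image f ` V = V" by (rule im) (rule gf, blast)
  have gE: "image ?g ` image f ` E = E" by (rule im) (rule E)
  have gfs: "map (image ?g) (map (image f) fs) = fs"
    unfolding list.map_comp
  proof (rule map_idI)
    fix e assume "e \<in> set fs"
    then have "e \<in> E" using trivalent.forest_edges[OF X(1)] by blast
    then show "(image ?g \<circ> image f) e = e" unfolding comp_apply by (rule E)
  qed
  have "inj_on ?g (\<Union>(image f ` V))"
    using inj_on_the_inv_into[OF inj] by (simp add: image_Union)
  from trace_data_map[OF Y, of ?g, unfolded gV gE gfs, OF X this] False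
  have "\<nexists>ts. trace_data (image f ` V, image f ` E, map (image f) fs) ts" by blast
  then show ?thesis using False by (simp add: trace_of_def)
qed

lemma trace_of_isomorphic:
  assumes "forested_isomorphic X Y"
  shows "trace_of (Rep_forested_graph X) = trace_of (Rep_forested_graph Y)"
proof -
  obtain V E fs V' E' fs' f where X: "Rep_forested_graph X = (V, E, fs)"
    and Y: "Rep_forested_graph Y = (V', E', fs')" and f: "bij_betw f (\<Union>V) (\<Union>V')"
      "(image f) ` V = V'" "(image f) ` E = E'" "map (image f) fs = fs'"
    using assms unfolding forested_isomorphic_def by blast
  have Y': "Rep_forested_graph Y = (image f ` V, image f ` E, map (image f) fs)" by (simp add: Y f)
  from trace_of_map[OF trivalent_Rep(1,2)[OF X] trivalent_Rep(1,2)[OF Y']] f(1)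
  show ?thesis unfolding X Y' by (simp add: bij_betw_def)
qed

lemma trace_of_orientation:
  assumes "Rep_forested_graph X = (V, E, fs)" "p permutes {..<length fs}"
  shows "trace_of (V, E, permute_list p fs) = scale_odd (of_int (sign p)) (trace_of (V, E, fs))"
  by (rule trivalent.trace_of_permute[OF trivalent_Rep(1)[OF assms(1)] assms(2)])


section \<open>The IHX relation\<close>

lemma necklaces_move_front:
  "necklaces V E F (us @ n # ws) \<Longrightarrow> necklaces V E F (n # us @ ws)"
proof -
  assume ns: "necklaces V E F (us @ n # ws)"
  let ?h = "\<lambda>ns. concat (map corner_list (concat ns))"
  have "mset (?h (n # us @ ws)) = mset (?h (us @ n # ws))" by simp
  then have d: "distinct (?h (n # us @ ws)) = distinct (?h (us @ n # ws))"
    by (rule mset_eq_imp_distinct_iff)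
  have s: "set (n # us @ ws) = set (us @ n # ws)" by simp
  show ?thesis using ns d unfolding necklaces_def set_concat s by blast
qed

lemma links_replace:
  assumes "entry k' = entry k" "exit l' = exit l" "{exit k', entry l'} = {exit k, entry l}"
  shows "links (us @ k' # l' # ws) = links (us @ k # l # ws)"
proof -
  have "links (k' # l' # ws) = links (k # l # ws)" using assms by (cases ws) auto
  then show ?thesis using assms(1) by (cases "us = []") (simp_all add: links_append)
qed

lemma insert_insert_cancel:
  assumes "insert a (insert b A) = insert a (insert b B)" "a \<notin> A" "b \<notin> A" "a \<notin> B" "b \<notin> B"
  shows "A = B"
proof -
  have "A = insert a (insert b A) - {a, b}" using assms(2,3) by auto
  moreover have "B = insert a (insert b B) - {a, b}" using assms(4,5) by auto
  ultimately show ?thesis using assms(1) by simp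
qed

lemma triple_cancel:
  assumes "{a, p, r} = {a, y, z}" "a \<notin> {p, r}" "a \<notin> {y, z}"
  shows "p = y \<and> r = z \<or> p = z \<and> r = y"
proof -
  have "{p, r} = {y, z}" using assms insert_ident by metis
  then show ?thesis by (auto simp: doubleton_eq_iff)
qed

context trivalent
begin

lemma connected_same_necklace:
  assumes ns: "necklaces V E (set fs) ns" and n: "n \<in> set ns" "v \<in> corner_vertex ` set n"
    and "(v, w) \<in> (adjacent V (set fs))\<^sup>*"
  shows "w \<in> corner_vertex ` set n"
  using assms(4)
proof induction
  case base
  then show ?case using n(2) .
next
  case (step u w)
  then obtain e where "e \<in> set fs" "joins e u w" "u \<in> V" "w \<in> V" by (auto simp: adjacent_def)
  then show ?case using links_same_necklace[OF ns, of e u w n] n(1) step.IH by blast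
qed

text \<open>The forest connects \<open>v\<close> to \<open>w\<close>, so both lie on one tree and
  \<open>{x, y}\<close> becomes a loop.\<close>

lemma trace_of_extra_edge:
  assumes ns: "necklaces V E (set fs) ns"
    and c: "{x, y} \<in> E - set fs" "{x, y} \<notin> closing ` set ns" "x \<noteq> y"
    and v: "v \<in> V" "x \<in> v" "y \<in> w" "(v, w) \<in> (adjacent V (set fs))\<^sup>*"
  shows "trace_of (V, E, fs) = 0"
proof -
  obtain n k where n: "n \<in> set ns" and k: "k \<in> set n" "v = corner_vertex k"
    using necklacesD(2)[OF ns] v(1) by auto
  then have "w \<in> corner_vertex ` set n" using connected_same_necklace[OF ns n _ v(4)] by blast
  then obtain l where "l \<in> set n" "w = corner_vertex l" by blast
  then have "trace_value (V, E, fs) (map tree_of ns) = 0"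
    using trace_value_loop[OF ns n c k(1)] k(2) v by blast
  then show ?thesis using trace_of_eq[OF trace_data_necklaces[OF multigraph ns]] by simp
qed

text \<open>Trace data would provide a leg off the forest at every vertex.\<close>

lemma trace_of_branch:
  assumes "v \<in> V" "v \<subseteq> \<Union>(set fs)"
  shows "trace_of (V, E, fs) = 0"
proof -
  have False if "trace_data (V, E, fs) ts" for ts
  proof -
    obtain ns where ns: "necklaces V E (set fs) ns" using \<open>trace_data (V, E, fs) ts\<close>
      by (rule trace_data_corners)
    obtain k where "k \<in> set (concat ns)" "v = corner_vertex k"
      using necklacesD(2)[OF ns] assms(1) by auto
    then show False using core_halfedges(3)[OF ns, of k] assms(2) by (auto simp: corner_vertex_def)
  qed
  then show ?thesis by (auto simp: trace_of_def)
qed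

text \<open>A closing edge cannot be attached to an inner vertex of a path of the forest, so here \<open>{x, y}\<close>
  is never a closing edge.\<close>

lemma trace_of_branch_loop:
  assumes v: "{a, u, x} \<in> V" "a \<in> \<Union>(set fs)" "u \<in> \<Union>(set fs)"
    and c: "{x, y} \<in> E - set fs" "x \<noteq> y"
    and w: "y \<in> w" "({a, u, x}, w) \<in> (adjacent V (set fs))\<^sup>*"
  shows "trace_of (V, E, fs) = 0"
proof (cases "\<exists>ts. trace_data (V, E, fs) ts")
  case True
  then obtain ns where ns: "necklaces V E (set fs) ns" using trace_data_corners by metis
  have "{x, y} \<notin> closing ` set ns"
  proof
    assume "{x, y} \<in> closing ` set ns"
    then have x: "x \<in> \<Union>(set fs \<union> closing ` set ns)" by blast
    obtain k where k: "k \<in> set (concat ns)" "{a, u, x} = corner_vertex k"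
      using necklacesD(2)[OF ns] v(1) by auto
    have "leg k \<in> {a, u, x}" unfolding k(2) by (simp add: corner_vertex_def)
    then show False using core_halfedges(3)[OF ns k(1)] v(2,3) x by blast
  qed
  then show ?thesis using trace_of_extra_edge[OF ns c(1) _ c(2) v(1) _ w] by blast
qed (simp add: trace_of_def)

end

text \<open>The cycle passes through \<open>k\<close>, the contracted edge and \<open>l\<close>. In
  \<open>V'\<close> it still runs from \<open>entry k\<close> to \<open>exit l\<close> across that
  edge, but the legs have changed places, which gives a sign. In \<open>V''\<close> both cycle
  half-edges sit at one vertex and both legs at the other, and the trace vanishes. Either end of the
  edge may go to either new vertex, which is why \<open>a'\<close>, \<open>b'\<close> and
  \<open>a''\<close>, \<open>b''\<close> are fixed only as unordered pairs.\<close>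

lemma IHX_core:
  assumes T: "trivalent V E fs" "trivalent V' E fs" "trivalent V'' E fs"
    and ns: "necklaces V E (set fs) ((us @ k # l # ws) # ns)"
    and V: "V = insert (corner_vertex k) (insert (corner_vertex l) U)"
      "corner_vertex k \<notin> U" "corner_vertex l \<notin> U"
    and ab: "{a', b'} = {exit k, entry l}" "{a'', b''} = {exit k, entry l}"
    and V': "V' = insert {a', entry k, leg l} (insert {b', exit l, leg k} U)"
    and V'': "V'' = insert {a'', entry k, exit l} (insert {b'', leg k, leg l} U)"
  shows "trace_of (V, E, fs) + trace_of (V', E, fs) + trace_of (V'', E, fs) = 0"
proof -
  interpret trivalent V E fs by (rule T)
  interpret T': trivalent V' E fs by (rule T)
  interpret T'': trivalent V'' E fs by (rule T)
  let ?n = "us @ k # l # ws"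
  define k' where "k' = Corner (entry k) a' (leg l)"
  define l' where "l' = Corner b' (exit l) (leg k)"
  let ?m = "us @ k' # l' # ws"
  define K where "K = set us \<union> set ws \<union> set (concat ns)"
  note d = necklacesD(1)[OF ns]
  have kl: "k \<in> set (concat (?n # ns))" "l \<in> set (concat (?n # ns))" by simp_all
  have K: "corner_vertex ` K = U"
  proof -
    have "k \<notin> K" "l \<notin> K" "K \<subseteq> set (concat (?n # ns))"
      using distinct_corners(1)[OF d] by (auto simp: K_def)
    then have "corner_vertex k \<notin> corner_vertex ` K" "corner_vertex l \<notin> corner_vertex ` K"
      using corner_vertex_inject[OF d kl(1)] corner_vertex_inject[OF d kl(2)] by blast+
    moreover have "insert (corner_vertex k) (insert (corner_vertex l) (corner_vertex ` K)) =
        insert (corner_vertex k) (insert (corner_vertex l) U)"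
      using necklacesD(2)[OF ns] unfolding V(1) by (auto simp: K_def)
    ultimately show ?thesis using V(2,3) by (metis insert_insert_cancel)
  qed
  have e: "{exit k, entry l} \<in> set fs"
  proof -
    have "{exit k, entry l} \<in> set (links ?n)" by (cases "us = []") (auto simp: links_append)
    then show ?thesis using necklacesD(3)[OF ns] by auto
  qed
  have links: "links ?m = links ?n"
    by (rule links_replace) (use ab in \<open>auto simp: k'_def l'_def\<close>)
  have closing: "closing ?m = closing ?n"
    by (cases us; cases ws rule: rev_cases) (auto simp: closing_def k'_def l'_def)
  have ms: "necklaces V' E (set fs) (?m # ns)"
  proof -
    have "mset [a', b'] = mset [exit k, entry l]"
      using ab(1) by (auto simp: doubleton_eq_iff)
    then have "mset (corner_list k' @ corner_list l') = mset (corner_list k @ corner_list l)"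
      by (simp add: corner_list_def k'_def l'_def)
    then have "mset (concat (map corner_list (concat (?m # ns)))) =
        mset (concat (map corner_list (concat (?n # ns))))" by simp
    then have "distinct (concat (map corner_list (concat (?m # ns))))"
      using d by (metis mset_eq_imp_distinct_iff)
    moreover have "corner_vertex ` set (concat (?m # ns)) = V'"
    proof -
      have *: "set (concat (?m # ns)) = insert k' (insert l' K)" by (auto simp: K_def)
      have "corner_vertex k' = {a', entry k, leg l}" "corner_vertex l' = {b', exit l, leg k}"
        by (auto simp: corner_vertex_def k'_def l'_def)
      then show ?thesis unfolding V' * by (simp only: image_insert K)
    qed
    moreover have "(\<Union>n\<in>set (?m # ns). set (links n)) = set fs"
      using necklacesD(3)[OF ns] links by simp
    moreover have "odd (length n) \<and> closing n \<in> E - set fs" if "n \<in> set (?m # ns)" for n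
    proof (cases "n = ?m")
      case True
      then show ?thesis using closing necklacesD(4,6)[OF ns, of ?n] by simp
    next
      case False
      then show ?thesis using that necklacesD(4,6)[OF ns] by simp
    qed
    ultimately show ?thesis unfolding necklaces_def by blast
  qed
  \<comment> \<open>The lists of legs of \<open>?m\<close> and \<open>?n\<close> differ by
    exchanging the neighbours \<open>leg k\<close> and \<open>leg l\<close>; links and closing edges
    are the same, so nothing else contributes a sign.\<close>
  have "odd_graph_class (insert (map leg ?m) (map leg ` set ns), D) =
      - odd_graph_class (insert (map leg ?n) (map leg ` set ns), D)" for D
  proof -
    have "distinct (?n # ns)"
      using distinct_corners(1)[OF d] necklacesD(5)[OF ns] by (metis distinct_concat_iff removeAll_id)
    then have n: "?n \<notin> set ns" by simp
    have "set (map leg m) \<noteq> set (map leg ?n)" if "m \<in> set ns" for m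
      using necklace_legs(2)[OF ns, of ?n m] that n by auto
    moreover have "set (map leg us @ leg l # leg k # map leg ws) = set (map leg ?n)" by auto
    moreover have "set (map leg us @ leg k # leg l # map leg ws) = set (map leg ?n)" by auto
    ultimately have "map leg us @ leg k # leg l # map leg ws \<notin> map leg ` set ns"
      "map leg us @ leg l # leg k # map leg ws \<notin> map leg ` set ns" by (metis imageE)+
    from odd_graph_class_swap[OF this] show ?thesis by (simp add: k'_def l'_def)
  qed
  then have "trace_value (V', E, fs) (map tree_of (?m # ns)) = - trace_value (V, E, fs) (map tree_of (?n # ns))"
    unfolding trace_value_def prod.case T'.collapse_necklaces[OF ms] collapse_necklaces[OF ns]
    using links closing by (simp add: tree_of_def comp_def odd.scale_minus_right)
  then have 1: "trace_of (V', E, fs) = - trace_of (V, E, fs)"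
    using trace_of_eq[OF trace_data_necklaces[OF multigraph ns]]
      T'.trace_of_eq[OF trace_data_necklaces[OF T'.multigraph ms]] by simp
  have cl: "closing ?n \<in> E - set fs" using necklacesD(6)[OF ns] by simp
  have v: "{a'', entry k, exit l} \<in> V''" by (simp add: V'')
  have a: "a'' \<in> \<Union>(set fs)" using e ab(2) by blast
  have dn: "distinct (concat (map corner_list ?n))" by (rule necklace_distinct[OF ns]) simp
  have Fn: "set (links ?n) \<subseteq> set fs" by (rule necklace_links(1)[OF ns]) simp
  have UV: "corner_vertex ` set us \<subseteq> V''" "corner_vertex ` set ws \<subseteq> V''"
    using K by (auto simp: K_def V'')
  have us: "links ?n = links us @ {exit (last us), entry k} # links (k # l # ws)" if "us \<noteq> []"
    using that by (simp add: links_append)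
  have ws: "links ?n = links (us @ [k, l]) @ {exit l, entry (hd ws)} # links ws" if "ws \<noteq> []"
    using links_append[of "us @ [k, l]" ws] that by simp
  \<comment> \<open>If the tree continues on both sides, the vertex
    \<open>{a'', entry k, exit l}\<close> is a branching point of the forest. If it stops on one
    side, the old closing edge joins this vertex to the far end of the same forest component, so it
    becomes a loop whenever trace data exist. The tree has an odd number of corners, hence not only
    \<open>k\<close> and \<open>l\<close>.\<close>
  have "trace_of (V'', E, fs) = 0"
  proof (cases "us = [] \<or> ws = []")
    case False
    then have "{exit (last us), entry k} \<in> set (links ?n)" "{exit l, entry (hd ws)} \<in> set (links ?n)"
      by (simp add: us, simp add: ws)
    then have "entry k \<in> \<Union>(set fs)" "exit l \<in> \<Union>(set fs)" using Fn by blast+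
    then show ?thesis using T''.trace_of_branch[OF v] a by simp
  next
    case True
    moreover have "\<not> (us = [] \<and> ws = [])" using necklacesD(4)[OF ns, of ?n] by auto
    ultimately consider "us \<noteq> []" "ws = []" | "us = []" "ws \<noteq> []" by blast
    then show ?thesis
    proof cases
      case 1
      have F: "{exit (last us), entry k} \<in> set fs" "set (links us) \<subseteq> set fs" using Fn us 1 by auto
      have c: "{exit l, entry (hd us)} \<in> E - set fs" using cl 1 by (simp add: closing_def)
      have h: "hd us \<in> set us" "last us \<in> set us" using 1 by auto
      have "exit l \<noteq> entry (hd us)" "exit (last us) \<noteq> entry k"
        using corner_halfedges(4)[OF dn] h by auto
      moreover have "joins {exit (last us), entry k} {a'', entry k, exit l} (corner_vertex (last us))"
        using \<open>exit (last us) \<noteq> entry k\<close> unfolding joins_def corner_vertex_def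
        by (intro exI[of _ "entry k"] exI[of _ "exit (last us)"]) auto
      then have "({a'', entry k, exit l}, corner_vertex (last us)) \<in> adjacent V'' (set fs)"
        using F(1) v UV(1) h unfolding adjacent_def by blast
      moreover have "(corner_vertex (last us), corner_vertex (hd us)) \<in> (adjacent V'' (set fs))\<^sup>*"
        by (rule links_connected[OF _ UV(1) F(2) h(2,1)]) (use dn in simp)
      moreover have "entry k \<in> \<Union>(set fs)" using F(1) by blast
      moreover have "entry (hd us) \<in> corner_vertex (hd us)" by (simp add: corner_vertex_def)
      ultimately show ?thesis
        using T''.trace_of_branch_loop[OF v a _ c] by (meson converse_rtrancl_into_rtrancl)
    next
      case 2
      have F: "{exit l, entry (hd ws)} \<in> set fs" "set (links ws) \<subseteq> set fs" using Fn ws 2 by auto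
      have c: "{entry k, exit (last ws)} \<in> E - set fs" using cl 2 by (simp add: closing_def insert_commute)
      have h: "hd ws \<in> set ws" "last ws \<in> set ws" using 2 by auto
      have "entry k \<noteq> exit (last ws)" "exit l \<noteq> entry (hd ws)"
        using corner_halfedges(1,4)[OF dn] h by auto
      moreover have v': "{a'', exit l, entry k} \<in> V''" using v by (simp add: insert_commute)
      have "joins {exit l, entry (hd ws)} {a'', exit l, entry k} (corner_vertex (hd ws))"
        using \<open>exit l \<noteq> entry (hd ws)\<close> unfolding joins_def corner_vertex_def
        by (intro exI[of _ "exit l"] exI[of _ "entry (hd ws)"]) auto
      then have "({a'', exit l, entry k}, corner_vertex (hd ws)) \<in> adjacent V'' (set fs)"
        using F(1) v' UV(2) h unfolding adjacent_def by blast
      moreover have "(corner_vertex (hd ws), corner_vertex (last ws)) \<in> (adjacent V'' (set fs))\<^sup>*"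
        by (rule links_connected[OF _ UV(2) F(2) h]) (use dn in simp)
      moreover have "exit l \<in> \<Union>(set fs)" using F(1) by blast
      moreover have "exit (last ws) \<in> corner_vertex (last ws)" by (simp add: corner_vertex_def)
      ultimately show ?thesis
        using T''.trace_of_branch_loop[OF v' a _ c] by (meson converse_rtrancl_into_rtrancl)
    qed
  qed
  then show ?thesis using 1 by simp
qed

text \<open>The cases say in which direction the cycle crosses the edge and which
  \<open>x\<^sub>i\<close> it uses; this decides whether the second or the third term is the one
  with exchanged legs. As the relation always keeps \<open>x\<^sub>1\<close> at \<open>a\<close>,
  the two ends must sometimes be interchanged, which explains the instances chosen for
  \<open>core\<close>.\<close>

lemma IHX_with_data:
  assumes ab: "{a, b} \<in> set fs" and x: "distinct [a, b, x\<^sub>1, x\<^sub>2, x\<^sub>3, x\<^sub>4]"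
    and U: "{a, x\<^sub>1, x\<^sub>2} \<notin> U" "{b, x\<^sub>3, x\<^sub>4} \<notin> U"
    and T: "trivalent (U \<union> {{a, x\<^sub>1, x\<^sub>2}, {b, x\<^sub>3, x\<^sub>4}}) E fs"
      "trivalent (U \<union> {{a, x\<^sub>1, x\<^sub>3}, {b, x\<^sub>2, x\<^sub>4}}) E fs"
      "trivalent (U \<union> {{a, x\<^sub>1, x\<^sub>4}, {b, x\<^sub>2, x\<^sub>3}}) E fs"
    and td: "trace_data (U \<union> {{a, x\<^sub>1, x\<^sub>2}, {b, x\<^sub>3, x\<^sub>4}}, E, fs) ts"
  shows "trace_of (U \<union> {{a, x\<^sub>1, x\<^sub>2}, {b, x\<^sub>3, x\<^sub>4}}, E, fs) +
    trace_of (U \<union> {{a, x\<^sub>1, x\<^sub>3}, {b, x\<^sub>2, x\<^sub>4}}, E, fs) +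
    trace_of (U \<union> {{a, x\<^sub>1, x\<^sub>4}, {b, x\<^sub>2, x\<^sub>3}}, E, fs) = 0"
proof -
  let ?V = "U \<union> {{a, x\<^sub>1, x\<^sub>2}, {b, x\<^sub>3, x\<^sub>4}}"
  let ?V2 = "U \<union> {{a, x\<^sub>1, x\<^sub>3}, {b, x\<^sub>2, x\<^sub>4}}"
  let ?V3 = "U \<union> {{a, x\<^sub>1, x\<^sub>4}, {b, x\<^sub>2, x\<^sub>3}}"
  interpret trivalent ?V E fs by (rule T)
  obtain ns where ns: "necklaces ?V E (set fs) ns" using td by (rule trace_data_corners)
  obtain n where n: "n \<in> set ns" "{a, b} \<in> set (links n)" using ab necklacesD(3)[OF ns] by blast
  obtain l r where lr: "n = l @ r" "l \<noteq> []" "r \<noteq> []" "{a, b} = {exit (last l), entry (hd r)}"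
    using links_split[OF n(2)] by blast
  obtain us k where us: "l = us @ [k]" using lr(2) by (metis append_butlast_last_id)
  obtain j ws where ws: "r = j # ws" using lr(3) by (cases r) auto
  have kj: "{exit k, entry j} = {a, b}" using lr(4) by (simp add: us ws)
  obtain ps qs where "ns = ps @ n # qs" using n(1) by (meson split_list)
  then have ns': "necklaces ?V E (set fs) ((us @ k # j # ws) # ps @ qs)"
    using necklaces_move_front ns by (simp add: lr(1) us ws)
  have V: "corner_vertex k \<in> ?V" "corner_vertex j \<in> ?V"
    using necklace_links(2)[OF ns n(1)] by (auto simp: lr(1) us ws)
  have kd: "distinct (corner_list k)" "distinct (corner_list j)"
    using necklace_distinct[OF ns n(1)] by (auto simp: lr(1) us ws)
  have *: "corner_vertex i = {a, x\<^sub>1, x\<^sub>2}" if "corner_vertex i \<in> ?V" "a \<in> corner_vertex i" for i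
    using multigraph_vertex_eq[OF multigraph that(1) _ that(2)] by simp
  have **: "corner_vertex i = {b, x\<^sub>3, x\<^sub>4}" if "corner_vertex i \<in> ?V" "b \<in> corner_vertex i" for i
    using multigraph_vertex_eq[OF multigraph that(1) _ that(2)] by simp
  have VU: "?V = insert (corner_vertex k) (insert (corner_vertex j) U) \<and>
      corner_vertex k \<notin> U \<and> corner_vertex j \<notin> U"
    if "corner_vertex k = {a, x\<^sub>1, x\<^sub>2} \<and> corner_vertex j = {b, x\<^sub>3, x\<^sub>4} \<or>
      corner_vertex k = {b, x\<^sub>3, x\<^sub>4} \<and> corner_vertex j = {a, x\<^sub>1, x\<^sub>2}"
    using that U by auto
  note core = IHX_core[OF T(1) _ _ ns', where U = U]
  have "exit k = a \<and> entry j = b \<or> exit k = b \<and> entry j = a" using kj by (auto simp: doubleton_eq_iff)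
  then show ?thesis
  proof
    assume e: "exit k = a \<and> entry j = b"
    have k: "corner_vertex k = {a, x\<^sub>1, x\<^sub>2}" by (rule *[OF V(1)]) (simp add: corner_vertex_def e)
    have j: "corner_vertex j = {b, x\<^sub>3, x\<^sub>4}" by (rule **[OF V(2)]) (simp add: corner_vertex_def e)
    have V': "?V = insert (corner_vertex k) (insert (corner_vertex j) U)"
        "corner_vertex k \<notin> U" "corner_vertex j \<notin> U"
      using VU k j by blast+
    have "entry k = x\<^sub>1 \<and> leg k = x\<^sub>2 \<or> entry k = x\<^sub>2 \<and> leg k = x\<^sub>1"
      by (rule triple_cancel[of a]) (use k e kd(1) x in \<open>auto simp: corner_vertex_def corner_list_def insert_commute\<close>)
    moreover have "exit j = x\<^sub>3 \<and> leg j = x\<^sub>4 \<or> exit j = x\<^sub>4 \<and> leg j = x\<^sub>3"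
      by (rule triple_cancel[of b]) (use j e kd(2) x in \<open>auto simp: corner_vertex_def corner_list_def\<close>)
    ultimately consider
      "entry k = x\<^sub>1" "leg k = x\<^sub>2" "exit j = x\<^sub>3" "leg j = x\<^sub>4"
    | "entry k = x\<^sub>1" "leg k = x\<^sub>2" "exit j = x\<^sub>4" "leg j = x\<^sub>3"
    | "entry k = x\<^sub>2" "leg k = x\<^sub>1" "exit j = x\<^sub>3" "leg j = x\<^sub>4"
    | "entry k = x\<^sub>2" "leg k = x\<^sub>1" "exit j = x\<^sub>4" "leg j = x\<^sub>3" by blast
    then show ?thesis
    proof cases
      case 1
      have "trace_of (?V, E, fs) + trace_of (?V3, E, fs) + trace_of (?V2, E, fs) = 0"
        by (rule core[OF T(3,2) V', of a b a b]) (simp_all add: e 1 insert_commute)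
      then show ?thesis by (simp only: add_ac)
    next
      case 2
      have "trace_of (?V, E, fs) + trace_of (?V2, E, fs) + trace_of (?V3, E, fs) = 0"
        by (rule core[OF T(2,3) V', of a b a b]) (simp_all add: e 2 insert_commute)
      then show ?thesis by (simp only: add_ac)
    next
      case 3
      have "trace_of (?V, E, fs) + trace_of (?V2, E, fs) + trace_of (?V3, E, fs) = 0"
        by (rule core[OF T(2,3) V', of b a b a]) (simp_all add: e 3 insert_commute)
      then show ?thesis by (simp only: add_ac)
    next
      case 4
      have "trace_of (?V, E, fs) + trace_of (?V3, E, fs) + trace_of (?V2, E, fs) = 0"
        by (rule core[OF T(3,2) V', of b a b a]) (simp_all add: e 4 insert_commute)
      then show ?thesis by (simp only: add_ac)
    qed
  next
    assume e: "exit k = b \<and> entry j = a"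
    have k: "corner_vertex k = {b, x\<^sub>3, x\<^sub>4}" by (rule **[OF V(1)]) (simp add: corner_vertex_def e)
    have j: "corner_vertex j = {a, x\<^sub>1, x\<^sub>2}" by (rule *[OF V(2)]) (simp add: corner_vertex_def e)
    have V': "?V = insert (corner_vertex k) (insert (corner_vertex j) U)"
        "corner_vertex k \<notin> U" "corner_vertex j \<notin> U"
      using VU k j by blast+
    have "entry k = x\<^sub>3 \<and> leg k = x\<^sub>4 \<or> entry k = x\<^sub>4 \<and> leg k = x\<^sub>3"
      by (rule triple_cancel[of b]) (use k e kd(1) x in \<open>auto simp: corner_vertex_def corner_list_def insert_commute\<close>)
    moreover have "exit j = x\<^sub>1 \<and> leg j = x\<^sub>2 \<or> exit j = x\<^sub>2 \<and> leg j = x\<^sub>1"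
      by (rule triple_cancel[of a]) (use j e kd(2) x in \<open>auto simp: corner_vertex_def corner_list_def\<close>)
    ultimately consider
      "entry k = x\<^sub>3" "leg k = x\<^sub>4" "exit j = x\<^sub>1" "leg j = x\<^sub>2"
    | "entry k = x\<^sub>3" "leg k = x\<^sub>4" "exit j = x\<^sub>2" "leg j = x\<^sub>1"
    | "entry k = x\<^sub>4" "leg k = x\<^sub>3" "exit j = x\<^sub>1" "leg j = x\<^sub>2"
    | "entry k = x\<^sub>4" "leg k = x\<^sub>3" "exit j = x\<^sub>2" "leg j = x\<^sub>1" by blast
    then show ?thesis
    proof cases
      case 1
      have "trace_of (?V, E, fs) + trace_of (?V3, E, fs) + trace_of (?V2, E, fs) = 0"
        by (rule core[OF T(3,2) V', of b a a b]) (simp_all add: e 1 insert_commute)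
      then show ?thesis by (simp only: add_ac)
    next
      case 2
      have "trace_of (?V, E, fs) + trace_of (?V2, E, fs) + trace_of (?V3, E, fs) = 0"
        by (rule core[OF T(2,3) V', of a b b a]) (simp_all add: e 2 insert_commute)
      then show ?thesis by (simp only: add_ac)
    next
      case 3
      have "trace_of (?V, E, fs) + trace_of (?V2, E, fs) + trace_of (?V3, E, fs) = 0"
        by (rule core[OF T(2,3) V', of b a a b]) (simp_all add: e 3 insert_commute)
      then show ?thesis by (simp only: add_ac)
    next
      case 4
      have "trace_of (?V, E, fs) + trace_of (?V3, E, fs) + trace_of (?V2, E, fs) = 0"
        by (rule core[OF T(3,2) V', of a b b a]) (simp_all add: e 4 insert_commute)
      then show ?thesis by (simp only: add_ac)
    qed
  qed
qed


section \<open>The boundary\<close>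

lemma link_nth:
  assumes "necklaces V E F ns" "e \<in> F"
  shows "\<exists>j. Suc j < length (concat ns) \<and> e = {exit (concat ns ! j), entry (concat ns ! Suc j)}"
proof -
  obtain n where n: "n \<in> set ns" "e \<in> set (links n)" using necklacesD(3)[OF assms(1)] assms(2) by blast
  obtain i where i: "Suc i < length n" "e = {exit (n ! i), entry (n ! Suc i)}"
    using n(2) by (metis in_set_conv_nth length_links less_diff_conv nth_links Suc_eq_plus1)
  obtain ps qs where ns: "ns = ps @ n # qs" using n(1) by (meson split_list)
  show ?thesis
    by (rule exI[of _ "length (concat ps) + i"])
      (use i in \<open>simp add: ns nth_append flip: add_Suc_right\<close>)
qed

text \<open>The order of the vertices along the trees has a maximum on the vertices of a cycle; both
  edges of the cycle at this vertex would have to be the one leading to its predecessor.\<close>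

lemma necklaces_forest:
  assumes mg: "multigraph V E" and ns: "necklaces V E F ns"
  shows "forest V F"
proof -
  let ?N = "concat ns"
  note d = necklacesD(1)[OF ns]
  define \<rho> where "\<rho> = the_inv_into {..<length ?N} (\<lambda>j. corner_vertex (?N ! j))"
  have inj: "inj_on (\<lambda>j. corner_vertex (?N ! j)) {..<length ?N}"
    using corner_vertex_inject[OF d] distinct_corners(1)[OF d] nth_eq_iff_index_eq[of ?N]
    unfolding inj_on_def by (metis lessThan_iff nth_mem)
  have \<rho>: "\<rho> (corner_vertex (?N ! j)) = j" if "j < length ?N" for j
    unfolding \<rho>_def using the_inv_into_f_f[OF inj, of j] that by simp
  have NV: "corner_vertex (?N ! j) \<in> V" if "j < length ?N" for j
    using necklacesD(2)[OF ns] that by (metis imageI nth_mem)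
  have edge: "\<exists>j. e = {exit (?N ! j), entry (?N ! Suc j)} \<and>
      (\<rho> v = j \<and> \<rho> w = Suc j \<or> \<rho> v = Suc j \<and> \<rho> w = j)"
    if e: "e \<in> F" "joins e v w" "v \<in> V" "w \<in> V" for e v w
  proof -
    obtain j where j: "Suc j < length ?N" "e = {exit (?N ! j), entry (?N ! Suc j)}"
      using link_nth[OF ns e(1)] by blast
    have x: "x = corner_vertex (?N ! j)" if "x \<in> V" "exit (?N ! j) \<in> x" for x
      using multigraph_vertex_eq[OF mg that(1) NV that(2)] j(1) by (simp add: corner_vertex_def)
    have y: "x = corner_vertex (?N ! Suc j)" if "x \<in> V" "entry (?N ! Suc j) \<in> x" for x
      using multigraph_vertex_eq[OF mg that(1) NV[OF j(1)] that(2)] by (simp add: corner_vertex_def)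
    obtain a b where "a \<in> v" "b \<in> w" "a \<noteq> b" "e = {a, b}" using e(2) by (auto simp: joins_def)
    then have "v = corner_vertex (?N ! j) \<and> w = corner_vertex (?N ! Suc j) \<or>
        v = corner_vertex (?N ! Suc j) \<and> w = corner_vertex (?N ! j)"
      using x[OF e(3)] x[OF e(4)] y[OF e(3)] y[OF e(4)] unfolding j(2) by (auto simp: doubleton_eq_iff)
    then show ?thesis using \<rho>[of j] \<rho>[of "Suc j"] j by auto
  qed
  have "\<not> is_cycle V F vs es" for vs es
  proof
    assume "is_cycle V F vs es"
    then have c: "es \<noteq> []" "length vs = length es" "distinct es" "set vs \<subseteq> V" "set es \<subseteq> F"
      "\<And>i. i < length es \<Longrightarrow> joins (es ! i) (vs ! i) (vs ! (Suc i mod length es))"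
      by (auto simp: is_cycle_def)
    let ?m = "length es"
    have "?m > 0" using c(1) by simp
    define i where "i = (ARG_MAX (\<lambda>i. \<rho> (vs ! i)) i. i < ?m)"
    have i: "i < ?m" "\<And>k. k < ?m \<Longrightarrow> \<rho> (vs ! k) \<le> \<rho> (vs ! i)"
    proof -
      have *: "finite ((\<lambda>i. \<rho> (vs ! i)) ` {..<?m})" by simp
      define b where "b = Max ((\<lambda>i. \<rho> (vs ! i)) ` {..<?m}) + 1"
      have b: "\<forall>y. y < ?m \<longrightarrow> \<rho> (vs ! y) < b" unfolding b_def using * by (auto simp: less_Suc_eq_le)
      from arg_max_natI[of "\<lambda>i. i < ?m" 0 "\<lambda>i. \<rho> (vs ! i)" b] \<open>?m > 0\<close> b
      show "i < ?m" by (simp add: i_def)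
      from arg_max_nat_le[of "\<lambda>i. i < ?m" _ "\<lambda>i. \<rho> (vs ! i)" b] b
      show "\<And>k. k < ?m \<Longrightarrow> \<rho> (vs ! k) \<le> \<rho> (vs ! i)" by (simp add: i_def)
    qed
    define p where "p = (if i = 0 then ?m - 1 else i - 1)"
    have p: "p < ?m" "Suc p mod ?m = i" using i(1) \<open>?m > 0\<close> by (auto simp: p_def)
    define q where "q = Suc i mod ?m"
    have q: "q < ?m" using \<open>?m > 0\<close> by (simp add: q_def)
    have vV: "vs ! k \<in> V" "es ! k \<in> F" if "k < ?m" for k using that c(2,4,5) by (auto simp: subset_iff)
    obtain j where j: "es ! i = {exit (?N ! j), entry (?N ! Suc j)}"
      "\<rho> (vs ! i) = j \<and> \<rho> (vs ! q) = Suc j \<or> \<rho> (vs ! i) = Suc j \<and> \<rho> (vs ! q) = j"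
      using edge[OF vV(2)[OF i(1)] c(6)[OF i(1)] vV(1)[OF i(1)]] vV(1)[OF q] unfolding q_def by blast
    obtain j' where j': "es ! p = {exit (?N ! j'), entry (?N ! Suc j')}"
      "\<rho> (vs ! p) = j' \<and> \<rho> (vs ! i) = Suc j' \<or> \<rho> (vs ! p) = Suc j' \<and> \<rho> (vs ! i) = j'"
      using edge[OF vV(2)[OF p(1)] c(6)[OF p(1)] vV(1)[OF p(1)]] vV(1)[OF i(1)] unfolding p(2) by blast
    have "\<rho> (vs ! i) = Suc j" "\<rho> (vs ! q) = j" using j(2) i(2)[OF q] by auto
    moreover have "\<rho> (vs ! i) = Suc j'" "\<rho> (vs ! p) = j'" using j'(2) i(2)[OF p(1)] by auto
    ultimately have "es ! i = es ! p" "i \<noteq> p" using j(1) j'(1) by auto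
    then show False using c(3) i(1) p(1) by (simp add: nth_eq_iff_index_eq)
  qed
  then show ?thesis by (simp add: forest_def)
qed

section \<open>Cancelling pairs of added edges\<close>

lemma closing_inject:
  assumes ns: "necklaces V E F ns" and n: "n \<in> set ns" and m: "m \<in> set ns" and "closing n = closing m"
  shows "n = m"
proof -
  note ne = necklacesD(5)[OF ns n] necklacesD(5)[OF ns m]
  have "exit (last n) \<in> closing m" using assms(4) by (auto simp: closing_def)
  then obtain k where k: "k \<in> set m" "exit (last n) \<in> corner_vertex k"
    using last_in_set[OF ne(2)] hd_in_set[OF ne(2)] unfolding closing_def corner_vertex_def by blast
  show ?thesis
    by (rule necklaces_same(1)[OF ns n m last_in_set[OF ne(1)] k(1) _ k(2)]) (simp add: corner_vertex_def)
qed

text \<open>The edge \<open>e\<close> joins the two linear trees \<open>l\<close> and \<open>r\<close>, and \<open>c\<close> closes the tree obtained.\<close>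

definition partner_edges ::
  "halfedges set \<Rightarrow> halfedges set \<Rightarrow> halfedges set \<Rightarrow> halfedges \<Rightarrow> halfedges \<Rightarrow> bool" where
  "partner_edges V E F e c \<longleftrightarrow> (\<exists>l r ns. necklaces V E (insert e F) ((l @ r) # ns) \<and>
     l \<noteq> [] \<and> r \<noteq> [] \<and> e = {exit (last l), entry (hd r)} \<and> c = closing (l @ r))"

lemma distinct_necklaces:
  assumes "necklaces V E F ns"
  shows "distinct ns"
  using distinct_corners(1)[OF necklacesD(1)[OF assms]] necklacesD(5)[OF assms]
  by (metis distinct_concat_iff removeAll_id)

context trivalent
begin

lemma add_edge: "e \<in> E - set fs \<Longrightarrow> trivalent V E (e # fs)"
  using multigraph card_vertex distinct_forest forest_edges by unfold_locales auto

lemma partner_edges_exist: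
  assumes e: "e \<in> E - set fs" and "trace_of (V, E, e # fs) \<noteq> 0"
  shows "\<exists>c. partner_edges V E (set fs) e c"
proof -
  interpret e: trivalent V E "e # fs" by (rule add_edge[OF e])
  obtain ts where "trace_data (V, E, e # fs) ts" using assms(2) by (auto simp: trace_of_def split: if_splits)
  then obtain ns where ns: "necklaces V E (insert e (set fs)) ns"
    by (rule e.trace_data_corners) simp
  obtain n where n: "n \<in> set ns" "e \<in> set (links n)" using necklacesD(3)[OF ns] by blast
  obtain l r where lr: "n = l @ r" "l \<noteq> []" "r \<noteq> []" "e = {exit (last l), entry (hd r)}"
    using links_split[OF n(2)] by blast
  obtain ps qs where "ns = ps @ n # qs" using n(1) by (meson split_list)
  then have "necklaces V E (insert e (set fs)) ((l @ r) # ps @ qs)"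
    using necklaces_move_front ns by (simp add: lr(1))
  then show ?thesis using lr unfolding partner_edges_def by blast
qed

text \<open>The cycle runs through \<open>l\<close>, \<open>e\<close>, \<open>r\<close>,
  \<open>c\<close>. Opening it at \<open>c\<close> or at \<open>e\<close> gives the two trees, with
  the roles of link and closing edge exchanged.\<close>

lemma partner_necklaces:
  assumes e: "e \<in> E - set fs" and ns: "necklaces V E (insert e (set fs)) ((l @ r) # ns)"
    and lr: "l \<noteq> []" "r \<noteq> []" "e = {exit (last l), entry (hd r)}" "c = closing (l @ r)"
  shows "c \<in> E - set fs" "c \<noteq> e" "necklaces V E (insert c (set fs)) ((r @ l) # ns)"
    "closing (r @ l) = e" "c = {exit (last r), entry (hd l)}"
    "links (l @ r) = links l @ e # links r" "links (r @ l) = links r @ c # links l"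
proof -
  show c: "c \<in> E - set fs" "c \<noteq> e" using necklacesD(6)[OF ns, of "l @ r"] lr(4) by auto
  show cl: "closing (r @ l) = e" "c = {exit (last r), entry (hd l)}" using lr by (simp_all add: closing_def)
  show links: "links (l @ r) = links l @ e # links r" "links (r @ l) = links r @ c # links l"
    using lr(1-3) cl(2) by (simp_all add: links_append)
  let ?R = "\<Union>n\<in>set ns. set (links n)"
  have F: "set (links l) \<union> {e} \<union> set (links r) \<union> ?R = insert e (set fs)"
    using necklacesD(3)[OF ns] links(1) by auto
  \<comment> \<open>Since \<open>e\<close> occurs only once among the links, deleting it leaves
    exactly the edges of the original forest.\<close>
  have "distinct (concat (map links ((l @ r) # ns)))" by (rule necklaces_distinct_links[OF ns])
  then have "e \<notin> set (links l) \<union> set (links r) \<union> ?R" by (auto simp: links(1))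
  then have F': "set (links l) \<union> set (links r) \<union> ?R = set fs" using F e by auto
  have "mset (concat (map corner_list (concat ((r @ l) # ns)))) =
      mset (concat (map corner_list (concat ((l @ r) # ns))))" by simp
  then have "distinct (concat (map corner_list (concat ((r @ l) # ns))))"
    using necklacesD(1)[OF ns] by (metis mset_eq_imp_distinct_iff)
  moreover have "set (concat ((r @ l) # ns)) = set (concat ((l @ r) # ns))" by auto
  then have "corner_vertex ` set (concat ((r @ l) # ns)) = V" using necklacesD(2)[OF ns] by (simp only:)
  moreover have "(\<Union>n\<in>set ((r @ l) # ns). set (links n)) = insert c (set fs)"
    using F' links(2) by auto
  moreover have "odd (length n) \<and> closing n \<in> E - insert c (set fs)" if n: "n \<in> set ((r @ l) # ns)" for n
  proof (cases "n \<in> set ns")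
    case True
    then have "n \<noteq> l @ r" using distinct_necklaces[OF ns] by auto
    then have "closing n \<noteq> c" using closing_inject[OF ns, of n "l @ r"] True lr(4) by auto
    then show ?thesis using necklacesD(4,6)[OF ns, of n] True by auto
  next
    case False
    then have "n = r @ l" using n by simp
    then show ?thesis using cl(1) e c(2) necklacesD(4)[OF ns, of "l @ r"] by auto
  qed
  ultimately show "necklaces V E (insert c (set fs)) ((r @ l) # ns)" unfolding necklaces_def by blast
qed

text \<open>Besides symmetry, the partner must be an admissible summand of the boundary; the
  acyclicity needed for this comes from the rotated necklaces.\<close>

lemma partner_edges_sym:
  assumes "e \<in> E - set fs" "partner_edges V E (set fs) e c"
  shows "c \<in> E - set fs" "c \<noteq> e" "partner_edges V E (set fs) c e" "forest V (insert c (set fs))"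
proof -
  obtain l r ns where ns: "necklaces V E (insert e (set fs)) ((l @ r) # ns)"
    and lr: "l \<noteq> []" "r \<noteq> []" "e = {exit (last l), entry (hd r)}" "c = closing (l @ r)"
    using assms(2) unfolding partner_edges_def by blast
  note p = partner_necklaces[OF assms(1) ns lr]
  show "c \<in> E - set fs" "c \<noteq> e" by (rule p)+
  show "partner_edges V E (set fs) c e" unfolding partner_edges_def using p lr by metis
  show "forest V (insert c (set fs))" by (rule necklaces_forest[OF multigraph p(3)])
qed

text \<open>Renaming \<open>e\<close> to \<open>c\<close> is injective here and fixes
  \<open>fs\<close> and \<open>gs\<close>.\<close>

lemma ordering_sign_replace:
  assumes "distinct (e # gs)" "mset fs = mset gs" "c \<notin> set gs" 
  shows "ordering_sign (c # fs) (c # gs) = ordering_sign (e # fs) (e # gs)"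
proof -
  let ?h = "\<lambda>x. if x = e then c else x"
  have "set fs = set gs" using assms(2) by (rule mset_eq_setD)
  then have "e \<notin> set fs" "e \<notin> set gs" using assms(1) by simp_all
  moreover have "map ?h xs = xs" if "e \<notin> set xs" for xs using that by (induction xs) auto
  ultimately have "map ?h fs = fs" "map ?h gs = gs" by blast+
  then have "map ?h (e # fs) = c # fs" "map ?h (e # gs) = c # gs" by simp_all
  moreover have "inj_on ?h (set (e # gs))" using assms(1,3) by (auto simp: inj_on_def)
  ultimately show ?thesis using ordering_sign_map[of ?h "e # gs" "e # fs"] assms(1,2)
    by (simp only: mset.simps)
qed

text \<open>With a edges in \<open>l\<close> and b edges in \<open>r\<close>, bringing the new edge
  to the front costs (-1)^a for \<open>e\<close> and (-1)^b for \<open>c\<close>. Rotation further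
  costs (-1)^(ab) on the edges and (-1)^((a+1)(b+1)) on the legs. As a + b is odd, the last two
  signs are 1 and the first two are opposite.\<close>

lemma trace_of_partner:
  assumes e: "e \<in> E - set fs" and "partner_edges V E (set fs) e c"
  shows "trace_of (V, E, c # fs) = - trace_of (V, E, e # fs)"
proof -
  obtain l r ns where ns: "necklaces V E (insert e (set fs)) ((l @ r) # ns)"
    and lr: "l \<noteq> []" "r \<noteq> []" "e = {exit (last l), entry (hd r)}" "c = closing (l @ r)"
    using assms(2) unfolding partner_edges_def by blast
  note p = partner_necklaces[OF e ns lr]
  interpret e: trivalent V E "e # fs" by (rule add_edge[OF e])
  interpret c: trivalent V E "c # fs" by (rule add_edge[OF p(1)])
  have ns: "necklaces V E (set (e # fs)) ((l @ r) # ns)" using ns by simp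
  have ms: "necklaces V E (set (c # fs)) ((r @ l) # ns)" using p(3) by simp
  define a where "a = length (links l)"
  define b where "b = length (links r)"
  have len: "length l = Suc a" "length r = Suc b" using lr(1,2) by (simp_all add: a_def b_def)
  have odd: "odd (a + b)" using necklacesD(4)[OF ns, of "l @ r"] len by simp
  let ?R = "concat (map links ns)"
  let ?gs = "links l @ links r @ ?R"
  let ?M = "map leg ` set ns"
  \<comment> \<open>Both collapses remove \<open>e\<close> and \<open>c\<close>, one as a forest
    edge and the other as a closing edge, so they have the same edges.\<close>
  define D where "D = E - (insert e (insert c (set fs)) \<union> closing ` set ns)"
  have dn: "distinct (links l @ e # links r @ ?R)"
    using necklaces_distinct_links[OF ns] by (simp add: p(6))
  have dm: "distinct (links r @ c # links l @ ?R)"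
    using necklaces_distinct_links[OF ms] by (simp add: p(7))
  have "set (e # ?gs) = insert e (set fs)"
    using necklacesD(3)[OF ns] by (auto simp: p(6))
  then have "set ?gs = set fs" using dn e by auto
  moreover have "distinct ?gs" using dn by auto
  ultimately have mset: "mset fs = mset ?gs" using distinct_forest by (simp only: set_eq_iff_mset_eq_distinct)
  have "ordering_sign (e # fs) ([] @ links l @ e # links r @ ?R) =
      signed a (ordering_sign (e # fs) ([] @ e # links l @ links r @ ?R))"
    unfolding a_def by (rule alternating_move_element[OF alternating_ordering_sign]) (use dn in simp)
  then have se: "ordering_sign (e # fs) (links l @ e # links r @ ?R) =
      signed a (ordering_sign (e # fs) (e # ?gs))" by simp
  have "ordering_sign (c # fs) ([] @ links r @ c # links l @ ?R) =
      signed b (ordering_sign (c # fs) ([] @ c # links r @ links l @ ?R))"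
    unfolding b_def by (rule alternating_move_element[OF alternating_ordering_sign]) (use dm in simp)
  moreover have "ordering_sign (c # fs) ([c] @ links r @ links l @ ?R) =
      signed (b * a) (ordering_sign (c # fs) ([c] @ links l @ links r @ ?R))"
    unfolding a_def b_def by (rule alternating_move_block[OF alternating_ordering_sign]) (use dm in auto)
  ultimately have "ordering_sign (c # fs) (links r @ c # links l @ ?R) =
      signed (b + b * a) (ordering_sign (c # fs) (c # ?gs))" by (simp add: signed_def)
  also have "ordering_sign (c # fs) (c # ?gs) = ordering_sign (e # fs) (e # ?gs)"
    by (rule ordering_sign_replace[OF _ mset]) (use dn dm in auto)
  finally have sc: "ordering_sign (c # fs) (links r @ c # links l @ ?R) =
      signed (b + b * a) (ordering_sign (e # fs) (e # ?gs))" .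
  have M: "\<forall>m\<in>?M. set m \<noteq> set (map leg (l @ r))"
  proof (intro ballI notI)
    fix m assume "m \<in> ?M" and eq: "set m = set (map leg (l @ r))"
    then obtain n where n: "n \<in> set ns" "m = map leg n" by auto
    have "n = l @ r" by (rule e.necklace_legs(2)[OF ns]) (use n eq in auto)
    then show False using distinct_necklaces[OF ns] n(1) by simp
  qed
  then have M': "\<forall>m\<in>?M. set m \<noteq> set (map leg (r @ l))" by (simp add: Un_commute)
  have "distinct (map leg (r @ l))" by (rule c.necklace_legs(1)[OF ms]) simp
  then have oc: "odd_graph_class (insert (map leg (r @ l)) ?M, D) =
      signed (Suc b * Suc a) (odd_graph_class (insert (map leg (l @ r)) ?M, D))"
    using alternating_move_block[OF alternating_odd_graph_class[of ?M D], of "[]" "map leg r" "map leg l" "[]"]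
      M M' len by simp
  have Te: "trace_of (V, E, e # fs) =
      scale_odd (signed a (ordering_sign (e # fs) (e # ?gs)) * (- 2) ^ Suc (length ns))
        (odd_graph_class (insert (map leg (l @ r)) ?M, D))"
  proof -
    have "E - (set (e # fs) \<union> closing ` set ((l @ r) # ns)) = D" using lr(4) by (auto simp: D_def)
    then show ?thesis
      unfolding e.trace_of_eq[OF trace_data_necklaces[OF multigraph ns]] trace_value_def prod.case
        e.collapse_necklaces[OF ns] using se by (simp add: tree_of_def comp_def p(6))
  qed
  have Tc: "trace_of (V, E, c # fs) =
      scale_odd (signed (b + b * a) (ordering_sign (e # fs) (e # ?gs)) * (- 2) ^ Suc (length ns))
        (signed (Suc b * Suc a) (odd_graph_class (insert (map leg (l @ r)) ?M, D)))"
  proof -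
    have "E - (set (c # fs) \<union> closing ` set ((r @ l) # ns)) = D" using p(4) by (auto simp: D_def)
    then show ?thesis
      unfolding c.trace_of_eq[OF trace_data_necklaces[OF multigraph ms]] trace_value_def prod.case
        c.collapse_necklaces[OF ms] using sc oc by (simp add: tree_of_def comp_def p(7))
  qed
  show ?thesis unfolding Te Tc using odd
    by (cases "even a") (simp_all add: signed_def odd.scale_minus_left odd.scale_minus_right)
qed

text \<open>Both trees contain \<open>e\<close> and hence lie in the same component of the enlarged
  forest. So \<open>d\<close> joins two vertices of the tree closed by \<open>c\<close> and becomes
  a loop.\<close>

lemma partner_edges_unique:
  assumes e: "e \<in> E - set fs" and "partner_edges V E (set fs) e c" "partner_edges V E (set fs) e d"
    and "c \<noteq> d"
  shows "trace_of (V, E, e # fs) = 0"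
proof -
  interpret e: trivalent V E "e # fs" by (rule add_edge[OF e])
  obtain l r ns where ns: "necklaces V E (set (e # fs)) ((l @ r) # ns)"
    and lr: "l \<noteq> []" "r \<noteq> []" "e = {exit (last l), entry (hd r)}" "c = closing (l @ r)"
    using assms(2) unfolding partner_edges_def by auto
  obtain l' r' ms where ms: "necklaces V E (set (e # fs)) ((l' @ r') # ms)"
    and lr': "l' \<noteq> []" "r' \<noteq> []" "e = {exit (last l'), entry (hd r')}" "d = closing (l' @ r')"
    using assms(3) unfolding partner_edges_def by auto
  let ?n = "l @ r" and ?m = "l' @ r'"
  have h: "hd r' \<in> set ?m" "last r' \<in> set ?m" "hd l' \<in> set ?m" "last l \<in> set ?n" "hd r \<in> set ?n"
    using lr(1,2) lr'(1,2) by simp_all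
  have "entry (hd r') = exit (last l) \<or> entry (hd r') = entry (hd r)"
    using lr(3) lr'(3) by auto
  then obtain k where k: "k \<in> set ?n" "entry (hd r') \<in> corner_vertex k"
    using h(4,5) by (metis corner_vertex_def insertI1 insertI2)
  have sub: "corner_vertex ` set ?m \<subseteq> V" "corner_vertex ` set ?n \<subseteq> V"
    using e.necklace_links(2)[OF ms, of ?m] e.necklace_links(2)[OF ns, of ?n] by auto
  have "entry (hd r') \<in> corner_vertex (hd r')" by (simp add: corner_vertex_def)
  then have "corner_vertex (hd r') = corner_vertex k"
    using multigraph_vertex_eq[OF multigraph _ _ _ k(2)] sub h(1) k(1) by blast
  then have hd: "corner_vertex (hd r') \<in> corner_vertex ` set ?n" using k(1) by blast
  have conn: "corner_vertex j \<in> corner_vertex ` set ?n" if "j \<in> set ?m" for j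
  proof (rule e.connected_same_necklace[OF ns _ hd])
    show "(corner_vertex (hd r'), corner_vertex j) \<in> (adjacent V (set (e # fs)))\<^sup>*"
      by (rule links_connected[OF e.necklace_distinct[OF ms] sub(1) e.necklace_links(1)[OF ms] h(1) that]) simp_all
  qed simp
  obtain i where i: "i \<in> set ?n" "corner_vertex (last r') = corner_vertex i" using conn[OF h(2)] by blast
  obtain j where j: "j \<in> set ?n" "corner_vertex (hd l') = corner_vertex j" using conn[OF h(3)] by blast
  have d_eq: "d = {exit (last r'), entry (hd l')}" using lr'(1,2,4) by (simp add: closing_def)
  have d: "d \<in> E - set (e # fs)" using necklacesD(6)[OF ms, of ?m] lr'(4) by simp
  have x: "exit (last r') \<in> corner_vertex i" unfolding i(2)[symmetric] by (simp add: corner_vertex_def)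
  have y: "entry (hd l') \<in> corner_vertex j" unfolding j(2)[symmetric] by (simp add: corner_vertex_def)
  have "d \<notin> closing ` set (?n # ns)"
  proof
    assume "d \<in> closing ` set (?n # ns)"
    then obtain n where n: "n \<in> set (?n # ns)" "d = closing n" by blast
    have ne: "n \<noteq> []" by (rule necklacesD(5)[OF ns n(1)])
    have "exit (last r') \<in> closing n" using d_eq n(2) by auto
    then obtain k where k: "k \<in> set n" "exit (last r') \<in> corner_vertex k"
      using last_in_set[OF ne] hd_in_set[OF ne] unfolding closing_def corner_vertex_def by blast
    have "n = ?n" by (rule necklaces_same(1)[OF ns n(1) _ k(1) i(1) k(2) x]) simp
    then show False using n(2) lr(4) assms(4) by simp
  qed
  moreover have "exit (last r') \<noteq> entry (hd l')"
    by (rule corner_halfedges(4)[OF e.necklace_distinct[OF ms, of ?m] h(2,3)]) simp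
  ultimately have "trace_value (V, E, e # fs) (map tree_of (?n # ns)) = 0"
    using e.trace_value_loop[OF ns _ _ _ _ i(1) x j(1) y] d unfolding d_eq by simp
  then show ?thesis using e.trace_of_eq[OF trace_data_necklaces[OF multigraph ns]] by simp
qed

text \<open>Passing from an edge to its partner is an involution that reverses the sign of each
  term.\<close>

lemma sum_trace_of_add_edge:
  "(\<Sum>e \<in> {e \<in> E - set fs. forest V (insert e (set fs))}. trace_of (V, E, e # fs)) = 0"
proof -
  let ?T = "\<lambda>e. trace_of (V, E, e # fs)"
  \<comment> \<open>Only for nonzero terms does a partner exist and is it unique, so the involution
    lives on this set.\<close>
  define S where "S = {e \<in> E - set fs. forest V (insert e (set fs)) \<and> ?T e \<noteq> 0}"
  have "finite E"
    using multigraph finite_elements[of "\<Union>V" E] unfolding multigraph_def by blast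
  then have "(\<Sum>e \<in> {e \<in> E - set fs. forest V (insert e (set fs))}. ?T e) = sum ?T S"
    by (intro sum.mono_neutral_right) (auto simp: S_def)
  also have "sum ?T S = - sum ?T S"
  proof -
    define g where "g e = (SOME c. partner_edges V E (set fs) e c)" for e
    have P: "partner_edges V E (set fs) e (g e)" if "e \<in> S" for e
      unfolding g_def by (rule someI_ex) (use that partner_edges_exist in \<open>auto simp: S_def\<close>)
    have uniq: "c = g e" if "e \<in> S" "partner_edges V E (set fs) e c" for e c
      using partner_edges_unique[OF _ that(2) P[OF that(1)]] that(1) by (auto simp: S_def)
    have T: "?T (g e) = - ?T e" if "e \<in> S" for e
      using trace_of_partner[OF _ P[OF that]] that by (simp add: S_def)
    have gS: "g e \<in> S" if "e \<in> S" for e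
      using partner_edges_sym[OF _ P[OF that]] T[OF that] that by (simp add: S_def)
    have gg: "g (g e) = e" if "e \<in> S" for e
    proof -
      have "partner_edges V E (set fs) (g e) e"
        by (rule partner_edges_sym(3)[OF _ P[OF that]]) (use that in \<open>simp add: S_def\<close>)
      then show ?thesis using uniq[OF gS[OF that]] by simp
    qed
    have "sum ?T S = sum (\<lambda>e. ?T (g e)) S"
      by (rule sum.reindex_bij_witness[of _ g g]) (use gS gg in auto)
    also have "\<dots> = sum (\<lambda>e. - ?T e) S" by (rule sum.cong) (use T in auto)
    finally show ?thesis by (simp add: sum_negf)
  qed
  then have "sum ?T S = 0" by (rule odd_space_eq_uminus_self)
  finally show ?thesis .
qed

end


section \<open>The trace on the quotient\<close>

text \<open>Permuting \<open>x\<^sub>2\<close>, \<open>x\<^sub>3\<close>, \<open>x\<^sub>4\<close>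
  permutes the three terms, so any term with trace data can be moved to the front. If there is none,
  all three terms are 0.\<close>

lemma sum_trace_IHX:
  assumes ab: "{a, b} \<in> set fs" "distinct [a, b, x\<^sub>1, x\<^sub>2, x\<^sub>3, x\<^sub>4]"
    and U: "{a, x\<^sub>1, x\<^sub>2} \<notin> U" "{b, x\<^sub>3, x\<^sub>4} \<notin> U"
    and T: "trivalent (U \<union> {{a, x\<^sub>1, x\<^sub>2}, {b, x\<^sub>3, x\<^sub>4}}) E fs"
      "trivalent (U \<union> {{a, x\<^sub>1, x\<^sub>3}, {b, x\<^sub>2, x\<^sub>4}}) E fs"
      "trivalent (U \<union> {{a, x\<^sub>1, x\<^sub>4}, {b, x\<^sub>2, x\<^sub>3}}) E fs"
  shows "trace_of (U \<union> {{a, x\<^sub>1, x\<^sub>2}, {b, x\<^sub>3, x\<^sub>4}}, E, fs) +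
    trace_of (U \<union> {{a, x\<^sub>1, x\<^sub>3}, {b, x\<^sub>2, x\<^sub>4}}, E, fs) +
    trace_of (U \<union> {{a, x\<^sub>1, x\<^sub>4}, {b, x\<^sub>2, x\<^sub>3}}, E, fs) = 0"
    (is "?X + ?Y + ?Z = 0")
proof -
  \<comment> \<open>The assumptions exclude only the two special vertices of the first term from
    \<open>U\<close>; those of the other two terms also contain \<open>a\<close> or
    \<open>b\<close>, and these half-edges lie at one vertex each.\<close>
  have notU: "v \<notin> U" if "a \<in> v \<or> b \<in> v" for v
  proof
    assume v: "v \<in> U"
    have "v = {a, x\<^sub>1, x\<^sub>2} \<or> v = {b, x\<^sub>3, x\<^sub>4}"
      using that multigraph_vertex_eq[OF trivalent.multigraph[OF T(1)], of v _ a]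
        multigraph_vertex_eq[OF trivalent.multigraph[OF T(1)], of v _ b] v by blast
    then show False using U v by blast
  qed
  have flip: "{x\<^sub>4, x\<^sub>3} = {x\<^sub>3, x\<^sub>4}" "{x\<^sub>4, x\<^sub>2} = {x\<^sub>2, x\<^sub>4}" "{x\<^sub>3, x\<^sub>2} = {x\<^sub>2, x\<^sub>3}" by auto
  consider ts where "trace_data (U \<union> {{a, x\<^sub>1, x\<^sub>2}, {b, x\<^sub>3, x\<^sub>4}}, E, fs) ts"
    | ts where "trace_data (U \<union> {{a, x\<^sub>1, x\<^sub>3}, {b, x\<^sub>2, x\<^sub>4}}, E, fs) ts"
    | ts where "trace_data (U \<union> {{a, x\<^sub>1, x\<^sub>4}, {b, x\<^sub>2, x\<^sub>3}}, E, fs) ts"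
    | "?X = 0" "?Y = 0" "?Z = 0" unfolding trace_of_def by meson
  then show ?thesis
  proof cases
    case 1
    show ?thesis by (rule IHX_with_data[OF ab U T 1])
  next
    case 2
    have "?Y + ?X + ?Z = 0"
      by (rule IHX_with_data[of a b fs x\<^sub>1 x\<^sub>3 x\<^sub>2 x\<^sub>4 U E ts, unfolded flip])
        (use ab notU T 2 in auto)
    then show ?thesis by (simp only: add_ac)
  next
    case 3
    have "?Z + ?X + ?Y = 0"
      by (rule IHX_with_data[of a b fs x\<^sub>1 x\<^sub>4 x\<^sub>2 x\<^sub>3 U E ts, unfolded flip])
        (use ab notU T 3 in auto)
    then show ?thesis by (simp only: add_ac)
  qed simp
qed

section \<open>Linear extension and descent to the quotient\<close>

definition trace_chain :: "(forested_graph \<Rightarrow>\<^sub>0 rat) \<Rightarrow> odd_space" where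
  "trace_chain x = (\<Sum>X\<in>Poly_Mapping.keys x.
     scale_odd (Poly_Mapping.lookup x X) (trace_of (Rep_forested_graph X)))"

lemma trace_chain_eq:
  assumes "finite A" "Poly_Mapping.keys x \<subseteq> A"
  shows "trace_chain x = (\<Sum>X\<in>A. scale_odd (Poly_Mapping.lookup x X) (trace_of (Rep_forested_graph X)))"
  unfolding trace_chain_def using assms
  by (intro sum.mono_neutral_left) (auto simp: in_keys_iff)

lemma trace_chain_add: "trace_chain (x + y) = trace_chain x + trace_chain y"
proof -
  let ?A = "Poly_Mapping.keys x \<union> Poly_Mapping.keys y"
  have "Poly_Mapping.keys (x + y) \<subseteq> ?A" by (rule Poly_Mapping.keys_add)
  then show ?thesis
    by (simp add: trace_chain_eq[of ?A] lookup_add odd.scale_left_distrib sum.distrib)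
qed

lemma trace_chain_scale: "trace_chain (scale_chain c x) = scale_odd c (trace_chain x)"
proof -
  have "Poly_Mapping.keys (scale_chain c x) \<subseteq> Poly_Mapping.keys x"
    by (auto simp: in_keys_iff)
  then show ?thesis
    by (simp add: trace_chain_eq[of "Poly_Mapping.keys x"] odd.scale_sum_right)
qed

lemma trace_chain_single [simp]:
  "trace_chain (Poly_Mapping.single X c) = scale_odd c (trace_of (Rep_forested_graph X))"
  by (simp add: trace_chain_eq[of "{X}"])

lemma trace_chain_zero [simp]: "trace_chain 0 = 0"
  by (simp add: trace_chain_def)

lemma trace_chain_diff: "trace_chain (x - y) = trace_chain x - trace_chain y"
  using trace_chain_add[of "x - y" y] by (simp add: algebra_simps)

lemma trace_chain_sum: "trace_chain (sum f A) = (\<Sum>a\<in>A. trace_chain (f a))"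
  by (induction A rule: infinite_finite_induct) (simp_all add: trace_chain_add)

lemma trace_chain_relation:
  assumes "r \<in> forested_relations"
  shows "trace_chain r = 0"
  using assms
proof cases
  case (isomorphism X Y)
  then show ?thesis by (simp add: trace_chain_diff trace_of_isomorphic)
next
  case (orientation X V E fs Y p)
  then show ?thesis using trace_of_orientation by (simp add: trace_chain_diff)
next
  case (separating X V E fs e)
  then show ?thesis using trivalent.trace_of_separating[OF trivalent_Rep(1)] trivalent_Rep(2) by simp
next
  case (IHX a b fs x\<^sub>1 x\<^sub>2 x\<^sub>3 x\<^sub>4 U X E Y Z)
  show ?thesis
    using sum_trace_IHX[OF IHX(2-5) trivalent_Rep(1)[OF IHX(6)] trivalent_Rep(1)[OF IHX(7)]
        trivalent_Rep(1)[OF IHX(8)]] IHX(6-8)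
    unfolding IHX(1) by (simp only: trace_chain_add trace_chain_single odd.scale_one)
qed

lemma trace_chain_span:
  assumes "x \<in> chain.span forested_relations"
  shows "trace_chain x = 0"
  using assms
proof (induction rule: chain.span_induct_alt)
  case (step c r x)
  then show ?case by (simp add: trace_chain_add trace_chain_scale trace_chain_relation)
qed simp

definition graphical_trace_map :: "forested_space \<Rightarrow> odd_space" where
  "graphical_trace_map q = trace_chain (rep_forested_space q)"

lemma graphical_trace_map_class: "graphical_trace_map (forested_class x) = trace_chain x"
proof -
  have "forested_class (rep_forested_space (forested_class x)) = forested_class x"
    by (rule Quotient3_abs_rep[OF Quotient3_forested_space])
  then have "rep_forested_space (forested_class x) - x \<in> chain.span forested_relations"
    by (simp only: forested_space.abs_eq_iff)
  from trace_chain_span[OF this] show ?thesis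
    by (simp add: graphical_trace_map_def trace_chain_diff)
qed

lemma linear_graphical_trace_map: "Vector_Spaces.linear scale_forested scale_odd graphical_trace_map"
proof -
  have rep: "\<exists>x. q = forested_class x" for q
    by (metis Quotient3_abs_rep[OF Quotient3_forested_space])
  have "graphical_trace_map (p + q) = graphical_trace_map p + graphical_trace_map q" for p q
  proof -
    obtain x y where "p = forested_class x" "q = forested_class y" using rep by metis
    then show ?thesis
      by (simp add: plus_forested_space.abs_eq graphical_trace_map_class trace_chain_add)
  qed
  moreover have "graphical_trace_map (scale_forested c q) = scale_odd c (graphical_trace_map q)" for c q
  proof -
    obtain x where "q = forested_class x" using rep by metis
    then show ?thesis
      by (simp add: scale_forested.abs_eq graphical_trace_map_class trace_chain_scale)
  qed
  ultimately show ?thesis by unfold_locales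
qed

text \<open>The prescription is single-valued because \<open>trace_of\<close> is independent of the
  trace data, and it has a value because the required permutation and collapsed graph exist.\<close>

lemma graphical_trace_iff:
  "graphical_trace X y \<longleftrightarrow> y = trace_of (Rep_forested_graph X)"
proof -
  obtain V E fs where X: "Rep_forested_graph X = (V, E, fs)" by (cases "Rep_forested_graph X")
  interpret trivalent V E fs by (rule trivalent_Rep(1)[OF X])
  have tr: "trace_of (V, E, fs) = scale_odd (of_int (sign p) * (-2) ^ length ts)
      (odd_class (Poly_Mapping.single Y 1))"
    if td: "trace_data (V, E, fs) ts" and p: "p permutes {..<length fs}"
      "fs = permute_list p (concat (map (\<lambda>(vs, es, c). es) ts))"
      and Y: "Rep_odd_graph Y = collapse (V, E, fs) ts" for ts p Y
  proof -
    have "length fs = length (concat (map (\<lambda>(vs, es, c). es) ts))" using p(2) by (metis length_permute_list)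
    then have "ordering_sign fs (concat (map (\<lambda>(vs, es, c). es) ts)) = of_int (sign p)"
      using ordering_sign_eqI[OF trace_data_distinct(1)[OF td] _ p(2)] p(1) by simp
    moreover have "odd_graph_class (collapse (V, E, fs) ts) = odd_class (Poly_Mapping.single Y 1)"
      using Rep_odd_graph[of Y] Rep_odd_graph_inverse[of Y] Y by (simp add: odd_graph_class_def)
    ultimately show ?thesis unfolding trace_of_eq[OF td] trace_value_def by simp
  qed
  show ?thesis
  proof
    assume "graphical_trace X y"
    then show "y = trace_of (Rep_forested_graph X)"
    proof cases
      case (collapsing V' E' fs' ts p Y)
      then show ?thesis using tr[of ts p Y] X by simp
    next
      case vanishing
      then show ?thesis by (simp add: trace_of_def)
    qed
  next
    assume y: "y = trace_of (Rep_forested_graph X)"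
    show "graphical_trace X y"
    proof (cases "\<exists>ts. trace_data (V, E, fs) ts")
      case True
      then obtain ts where td: "trace_data (V, E, fs) ts" by blast
      obtain p where p: "p permutes {..<length (concat (map (\<lambda>(vs, es, c). es) ts))}"
        "permute_list p (concat (map (\<lambda>(vs, es, c). es) ts)) = fs"
        using mset_eq_permutation[OF trace_data_distinct(2)[OF td]] by blast
      have p': "p permutes {..<length fs}" using p by (metis length_permute_list)
      define Y where "Y = Abs_odd_graph (collapse (V, E, fs) ts)"
      have Y: "Rep_odd_graph Y = collapse (V, E, fs) ts"
        unfolding Y_def by (rule Rep_Abs_odd_graph[OF oriented_collapse[OF td trivalent_Rep(2)[OF X]]])
      show ?thesis unfolding y X tr[OF td p' p(2)[symmetric] Y]
        by (rule graphical_trace.collapsing[OF X td p' p(2)[symmetric] Y])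
    next
      case False
      then show ?thesis using graphical_trace.vanishing[of X] y by (simp add: X trace_of_def)
    qed
  qed
qed

lemma trace_chain_boundary: "trace_chain (boundary x) = 0"
proof -
  have "trace_chain (boundary_graph X) = 0" for X
  proof -
    obtain V E fs where X: "Rep_forested_graph X = (V, E, fs)" by (cases "Rep_forested_graph X")
    let ?S = "{e \<in> E - set fs. forest V (insert e (set fs))}"
    have "trace_of (Rep_forested_graph (Abs_forested_graph (V, E, e # fs))) = trace_of (V, E, e # fs)"
      if "e \<in> ?S" for e
      using oriented_forested_graph_add_edge[OF X, of e] that by (simp add: Abs_forested_graph_inverse)
    then have "trace_chain (boundary_graph X) = (\<Sum>e\<in>?S. trace_of (V, E, e # fs))"
      by (simp add: boundary_graph_def X trace_chain_sum)
    also have "\<dots> = 0" by (rule trivalent.sum_trace_of_add_edge[OF trivalent_Rep(1)[OF X]])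
    finally show ?thesis .
  qed
  then show ?thesis by (simp add: boundary_def trace_chain_sum trace_chain_scale)
qed

theorem proposition4p5:
  shows "\<exists>Tr :: forested_space \<Rightarrow> odd_space.
    Vector_Spaces.linear scale_forested scale_odd Tr \<and>
    (\<forall>X y. graphical_trace X y \<longleftrightarrow> y = Tr (forested_class (Poly_Mapping.single X 1))) \<and>
    (\<forall>x. Tr (forested_class (boundary x)) = 0)"
proof (intro exI conjI allI)
  show "Vector_Spaces.linear scale_forested scale_odd graphical_trace_map"
    by (rule linear_graphical_trace_map)
  show "graphical_trace X y \<longleftrightarrow> y = graphical_trace_map (forested_class (Poly_Mapping.single X 1))" for X y
    by (simp add: graphical_trace_iff graphical_trace_map_class)
  show "graphical_trace_map (forested_class (boundary x)) = 0" for x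
    by (simp add: graphical_trace_map_class trace_chain_boundary)
qed

end
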